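(* Let $n,m,\ell\in\mathbb{Z}_{\ge0}$. Define $$U_3=\frac{(-1)^{m+1}}{(m+n+2\ell+1)!}\,z^{m+n+2\ell+1}\,{}_2F_1(m+\ell+1,\,m+n+\ell+1;\,m+n+2\ell+2;\,z),$$ $$C_3=\frac{1}{\ell!\,(m+\ell)!\,(n+\ell)!\,(m+n+\ell)!},\qquad P={}_2F_1(-\ell,\,-n-\ell;\,-m-n-2\ell;\,z).$$ Then the following formulas hold: (1) $$\begin{aligned}U_3={}&C_3(m+n+2\ell)!\,P\log(1-z)+\sum_{k=0}^{\ell}\frac{\psi(n+\ell-k+1)+\psi(\ell-k+1)-\psi(m+k+1)-\psi(k+1)}{(m+k)!\,(n+\ell-k)!\,(\ell-k)!\,k!}(1-z)^k\\&-(z-1)^{-m}\sum_{k=0}^{m-1}\frac{(m-k-1)!}{(m+n+\ell-k)!\,(m+\ell-k)!\,k!}(z-1)^k\\&+(-1)^{\ell}(z-1)^{n+\ell}\sum_{k=0}^{n-1}\frac{(n-k-1)!}{(m+n+\ell-k)!\,(n+\ell-k)!\,k!}\frac{1}{(z-1)^k};\end{aligned}$$ (2) $$\begin{aligned}U_3={}&C_3(m+n+2\ell)!\,P\log(1-z)-C_3\,z^{m+n+2\ell+1}(z-1)^{-m}\sum_{k=0}^{m-1}\frac{(n+\ell+k)!\,(\ell+k)!\,(m-k-1)!}{k!}(z-1)^k\\&+C_3\,z^{m+n+2\ell+1}\sum_{k=0}^{\infty}\frac{(m+\ell+k)!\,(m+n+\ell+k)!}{(m+k)!\,k!}(1-z)^k\\&\qquad\times\big(\psi(m+n+\ell+k+1)+\psi(m+\ell+k+1)-\psi(m+k+1)-\psi(k+1)\big);\end{aligned}$$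 (3) $$\begin{aligned}U_3={}&C_3(m+n+2\ell)!\,P\log\frac{1-z}{z}-\frac{z^{m+\ell}(z-1)^{-m}}{(n+\ell)!\,(m+n+\ell)!}\sum_{k=0}^{m-1}\frac{(n+\ell+k)!\,(m-k-1)!}{(m+\ell-k)!\,k!}\frac{(z-1)^k}{z^k}\\&+\frac{z^{\ell}}{(n+\ell)!\,(m+n+\ell)!}\sum_{k=0}^{\ell}\frac{(m+n+\ell+k)!}{(m+k)!\,(\ell-k)!\,k!}\\&\qquad\times\big(\psi(m+n+\ell+k+1)+\psi(\ell-k+1)-\psi(m+k+1)-\psi(k+1)\big)\frac{(1-z)^k}{z^k}\\&+\frac{(-z)^{\ell}}{(n+\ell)!\,(m+n+\ell)!}\sum_{k=\ell+1}^{\infty}\frac{(m+n+\ell+k)!\,(k-\ell-1)!}{(m+k)!\,k!}\frac{(z-1)^k}{z^k};\end{aligned}$$ (4) $$\begin{aligned}U_3={}&C_3(m+n+2\ell)!\,P\log\frac{1-z}{z}-\frac{z^{m+n+\ell}(z-1)^{-m}}{\ell!\,(m+\ell)!}\sum_{k=0}^{m-1}\frac{(\ell+k)!\,(m-k-1)!}{(m+n+\ell-k)!\,k!}\frac{(z-1)^k}{z^k}\\&+\frac{z^{n+\ell}}{\ell!\,(m+\ell)!}\sum_{k=0}^{n+\ell}\frac{(m+\ell+k)!}{(m+k)!\,(n+\ell-k)!\,k!}\\&\qquad\times\big(\psi(m+\ell+k+1)+\psi(n+\ell-k+1)-\psi(m+k+1)-\psi(k+1)\big)\frac{(1-z)^k}{z^k}\\&+\frac{(-z)^{n+\ell}}{\ell!\,(m+\ell)!}\sum_{k=n+\ell+1}^{\infty}\frac{(m+\ell+k)!\,(k-n-\ell-1)!}{(m+k)!\,k!}\frac{(z-1)^k}{z^k}.\end{aligned}$$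 Besides, in each of these expressions (including the defining expression of $U_3$) one can interchange $m$ and $n$, provided that $z$ is replaced by $z/(z-1)$ and the whole expression is multiplied by $(-1)(1-z)^{\ell}$; the result is again an expression for $U_3$.
   Context: ${}_2F_1(a,b;c;z)=\sum_{k\ge0}\frac{(a)_k(b)_k}{(c)_k\,k!}z^k$ is the Gauss hypergeometric function (analytically continued), $(x)_k=x(x+1)\cdots(x+k-1)$, $\psi(x)=\Gamma'(x)/\Gamma(x)$. When the upper parameter is $-p$ and the lower one is $-N$ with $p,N\in\mathbb{Z}_{\ge0}$, $p\le N$, the series is interpreted as terminating: ${}_2F_1(-p,b;-N;z)=\sum_{k=0}^{p}\frac{(-p)_k(b)_k}{(-N)_k\,k!}z^k$; thus $P$ is the polynomial $\sum_{k=0}^{\ell}\frac{(-\ell)_k(-n-\ell)_k}{(-m-n-2\ell)_k\,k!}z^k$. Logarithms take principal values, $z\in\mathbb{C}\setminus\big((-\infty,0]\cup[1,\infty)\big)$ for formulas (1)–(4). Formulas with an infinite series hold where the series converges ($|1-z|<1$ in (2), $|(z-1)/z|<1$ in (3), (4)), and elsewhere by analytic continuation. Empty sums are zero. *)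

theory Defs
  imports "HOL-Complex_Analysis.Complex_Analysis"
begin

text \<open>
  \<open>continues_series t A D g\<close>: on \<open>D\<close>, the holomorphic function \<open>g\<close> is the analytic continuation of
  the sum of the series \<open>\<Sum>k. t k z\<close>, which converges at the points of \<open>A \<inter> D\<close>.  Below, \<open>D\<close> is always
  open and connected and \<open>A \<inter> D\<close> is open and nonempty, so by the identity theorem \<open>g\<close> is unique on \<open>D\<close>
  if it exists.  Accordingly \<open>continued_sum t A D\<close> is meaningful on \<open>D\<close> only, and only if the
  continuation exists.
\<close>

definition continues_series ::
  "(nat \<Rightarrow> complex \<Rightarrow> complex) \<Rightarrow> complex set \<Rightarrow> complex set \<Rightarrow> (complex \<Rightarrow> complex) \<Rightarrow> bool" where
  "continues_series t A D g \<longleftrightarrow>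
     g holomorphic_on D \<and> (\<forall>z \<in> A \<inter> D. (\<lambda>k. t k z) sums g z)"

definition continued_sum ::
  "(nat \<Rightarrow> complex \<Rightarrow> complex) \<Rightarrow> complex set \<Rightarrow> complex set \<Rightarrow> complex \<Rightarrow> complex" where
  "continued_sum t A D = (SOME g. continues_series t A D g)"

definition right_slit :: "complex set" where
  "right_slit = complex_of_real ` {1..}"

definition two_slit_plane :: "complex set" where
  "two_slit_plane = - (\<real>\<^sub>\<le>\<^sub>0 \<union> right_slit)"

definition hyp2F1_summand :: "complex \<Rightarrow> complex \<Rightarrow> complex \<Rightarrow> nat \<Rightarrow> complex \<Rightarrow> complex" where
  "hyp2F1_summand a b c k z =
     pochhammer a k * pochhammer b k / (pochhammer c k * fact k) * z ^ k"

definition hyp2F1 :: "complex \<Rightarrow> complex \<Rightarrow> complex \<Rightarrow> complex \<Rightarrow> complex" where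
  "hyp2F1 a b c = continued_sum (hyp2F1_summand a b c) {z. norm z < 1} (- right_slit)"

text \<open>
  The terminating \<open>2F1(-p, b; -N; z)\<close> for \<open>p \<le> N\<close>.  The sum is cut off at \<open>p\<close>, where all denominators
  are still nonzero, by convention, and not by division by zero.
\<close>

definition hyp2F1_terminating :: "nat \<Rightarrow> complex \<Rightarrow> nat \<Rightarrow> complex \<Rightarrow> complex" where
  "hyp2F1_terminating p b N z =
     (\<Sum>k\<le>p. hyp2F1_summand (- of_nat p) b (- of_nat N) k z)"

definition U3 :: "nat \<Rightarrow> nat \<Rightarrow> nat \<Rightarrow> complex \<Rightarrow> complex" where
  "U3 n m l z =
     (-1) ^ (m + 1) / fact (m + n + 2 * l + 1) * z ^ (m + n + 2 * l + 1) *
     hyp2F1 (of_nat (m + l + 1)) (of_nat (m + n + l + 1)) (of_nat (m + n + 2 * l + 2)) z"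

definition C3 :: "nat \<Rightarrow> nat \<Rightarrow> nat \<Rightarrow> complex" where
  "C3 n m l = 1 / (fact l * fact (m + l) * fact (n + l) * fact (m + n + l))"

definition P :: "nat \<Rightarrow> nat \<Rightarrow> nat \<Rightarrow> complex \<Rightarrow> complex" where
  "P n m l z = hyp2F1_terminating l (- of_nat (n + l)) (m + n + 2 * l) z"

abbreviation psi :: "nat \<Rightarrow> complex" where
  "psi k \<equiv> Digamma (of_nat k)"

definition rhs1 :: "nat \<Rightarrow> nat \<Rightarrow> nat \<Rightarrow> complex \<Rightarrow> complex" where
  "rhs1 n m l z =
     C3 n m l * fact (m + n + 2 * l) * P n m l z * Ln (1 - z)
     + (\<Sum>k\<le>l. (psi (n + l - k + 1) + psi (l - k + 1) - psi (m + k + 1) - psi (k + 1))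
                / (fact (m + k) * fact (n + l - k) * fact (l - k) * fact k) * (1 - z) ^ k)
     - (z - 1) powi (- int m) *
       (\<Sum>k<m. fact (m - k - 1) / (fact (m + n + l - k) * fact (m + l - k) * fact k) * (z - 1) ^ k)
     + (-1) ^ l * (z - 1) ^ (n + l) *
       (\<Sum>k<n. fact (n - k - 1) / (fact (m + n + l - k) * fact (n + l - k) * fact k)
                * (1 / (z - 1) ^ k))"

definition summand2 :: "nat \<Rightarrow> nat \<Rightarrow> nat \<Rightarrow> nat \<Rightarrow> complex \<Rightarrow> complex" where
  "summand2 n m l k z =
     fact (m + l + k) * fact (m + n + l + k) / (fact (m + k) * fact k) * (1 - z) ^ k *
     (psi (m + n + l + k + 1) + psi (m + l + k + 1) - psi (m + k + 1) - psi (k + 1))"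

text \<open>
  The sum of this series continues to a single-valued function on the plane punctured at \<open>0\<close>, and
  not just on \<^const>\<open>two_slit_plane\<close>.  The larger domain is needed to make sense of the formula with
  \<open>z\<close> replaced by \<open>z / (z - 1)\<close> when \<open>z\<close> lies in the interval \<open>(0, 1)\<close>.
\<close>

abbreviation region2 :: "complex set" where
  "region2 \<equiv> {z. norm (1 - z) < 1}"

definition rhs2 :: "nat \<Rightarrow> nat \<Rightarrow> nat \<Rightarrow> complex \<Rightarrow> complex" where
  "rhs2 n m l z =
     C3 n m l * fact (m + n + 2 * l) * P n m l z * Ln (1 - z)
     - C3 n m l * z ^ (m + n + 2 * l + 1) * (z - 1) powi (- int m) *
       (\<Sum>k<m. fact (n + l + k) * fact (l + k) * fact (m - k - 1) / fact k * (z - 1) ^ k)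
     + C3 n m l * z ^ (m + n + 2 * l + 1) * continued_sum (summand2 n m l) region2 (- {0}) z"

abbreviation region34 :: "complex set" where
  "region34 \<equiv> {z. norm ((z - 1) / z) < 1}"

definition summand3 :: "nat \<Rightarrow> nat \<Rightarrow> nat \<Rightarrow> nat \<Rightarrow> complex \<Rightarrow> complex" where
  "summand3 n m l k z =
     (if l + 1 \<le> k
      then fact (m + n + l + k) * fact (k - l - 1) / (fact (m + k) * fact k) * ((z - 1) ^ k / z ^ k)
      else 0)"

definition rhs3 :: "nat \<Rightarrow> nat \<Rightarrow> nat \<Rightarrow> complex \<Rightarrow> complex" where
  "rhs3 n m l z =
     C3 n m l * fact (m + n + 2 * l) * P n m l z * Ln ((1 - z) / z)
     - z ^ (m + l) * (z - 1) powi (- int m) / (fact (n + l) * fact (m + n + l)) *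
       (\<Sum>k<m. fact (n + l + k) * fact (m - k - 1) / (fact (m + l - k) * fact k)
                * ((z - 1) ^ k / z ^ k))
     + z ^ l / (fact (n + l) * fact (m + n + l)) *
       (\<Sum>k\<le>l. fact (m + n + l + k) / (fact (m + k) * fact (l - k) * fact k)
                * (psi (m + n + l + k + 1) + psi (l - k + 1) - psi (m + k + 1) - psi (k + 1))
                * ((1 - z) ^ k / z ^ k))
     + (- z) ^ l / (fact (n + l) * fact (m + n + l)) *
       continued_sum (summand3 n m l) region34 two_slit_plane z"

definition summand4 :: "nat \<Rightarrow> nat \<Rightarrow> nat \<Rightarrow> nat \<Rightarrow> complex \<Rightarrow> complex" where
  "summand4 n m l k z =
     (if n + l + 1 \<le> k
      then fact (m + l + k) * fact (k - n - l - 1) / (fact (m + k) * fact k) * ((z - 1) ^ k / z ^ k)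
      else 0)"

definition rhs4 :: "nat \<Rightarrow> nat \<Rightarrow> nat \<Rightarrow> complex \<Rightarrow> complex" where
  "rhs4 n m l z =
     C3 n m l * fact (m + n + 2 * l) * P n m l z * Ln ((1 - z) / z)
     - z ^ (m + n + l) * (z - 1) powi (- int m) / (fact l * fact (m + l)) *
       (\<Sum>k<m. fact (l + k) * fact (m - k - 1) / (fact (m + n + l - k) * fact k)
                * ((z - 1) ^ k / z ^ k))
     + z ^ (n + l) / (fact l * fact (m + l)) *
       (\<Sum>k\<le>n + l. fact (m + l + k) / (fact (m + k) * fact (n + l - k) * fact k)
                * (psi (m + l + k + 1) + psi (n + l - k + 1) - psi (m + k + 1) - psi (k + 1))
                * ((1 - z) ^ k / z ^ k))
     + (- z) ^ (n + l) / (fact l * fact (m + l)) *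
       continued_sum (summand4 n m l) region34 two_slit_plane z"

definition interchanged ::
  "(nat \<Rightarrow> nat \<Rightarrow> nat \<Rightarrow> complex \<Rightarrow> complex) \<Rightarrow> nat \<Rightarrow> nat \<Rightarrow> nat \<Rightarrow> complex \<Rightarrow> complex" where
  "interchanged E n m l z = (-1) * (1 - z) ^ l * E m n l (z / (z - 1))"

end

theory Submission
  imports Defs
begin

text \<open>
  Put \<open>p = n + l\<close>, \<open>q = l\<close> and \<open>N = m + p + q + 1\<close>.  The function \<open>U3\<close> solves the hypergeometric equation
  whose exponents are \<open>0, N\<close> at \<open>0\<close>, \<open>0, -m\<close> at \<open>1\<close> and \<open>-p, -q\<close> at infinity.  The exponent differences are
  integers, so expansions at \<open>1\<close> contain logarithms.  Such an expansion is the derivative at \<open>e = 0\<close> of a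
  Frobenius series \<open>\<Sum>k. g (k + e) x\<^sup>k\<^sup>+\<^sup>e\<close>, that is,
  \<open>\<Sum>k. (g' k + g k log x) x\<^sup>k\<close> (\<open>frobenius\<close>), where \<open>g\<close> is an entire product of Gamma factors.  Each of the
  four formulas has this form, up to a constant and a power of \<open>z\<close>, with \<open>x = 1 - z\<close> in (1) and (2) and
  \<open>x = (1 - z) / z\<close> in (3) and (4).  At an integer where no factor of \<open>g\<close> vanishes, \<open>g'\<close> contributes \<open>\<psi>\<close> values; where a single reciprocal Gamma
  factor vanishes, it contributes a signed factorial.  This explains the various finite sums and tails.

  That all these expansions represent the same function is proved by induction on \<open>p\<close>, \<open>q\<close> and \<open>m\<close>.
  First-order differential operators (\<open>ladder\<close>) raise each parameter by one, up to a nonzero factor.  On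
  Frobenius series they act by linear relations between values \<open>g s\<close>, \<open>g (s - 1)\<close> and \<open>g (s + 1)\<close> that
  hold for all complex \<open>s\<close> and can therefore be differentiated, so that no identity between \<open>\<psi>\<close> values
  is needed.  For \<open>p = q = m = 0\<close> every expansion is \<open>log (1 - z)\<close>, and \<open>ladder_unique\<close> does the rest.  The
  argument applies verbatim when an arbitrary constant is added to the logarithm; hence the factors
  of the logarithms agree too, and Vandermonde's convolution identifies them with \<open>P\<close>
  (\<open>P_expansion_at_1\<close>).

  The comparison takes place on a small open set next to \<open>1\<close> where all series converge.  The right side
  of (1) is elementary, so by the identity theorem it is the continuation of \<open>U3\<close>
  (\<open>hyp2F1_continuation\<close>), and solving for the infinite series in (2), (3) and (4) continues those
  as well.  The interchange of \<open>m\<close> and \<open>n\<close> is Pfaff's transformation.  It follows by the same kind of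
  induction, because \<open>z \<mapsto> z / (z - 1)\<close> turns the raising operators into operators of the same sort
  (\<open>sol0_reflection\<close>).
\<close>

section \<open>Power series on the unit disc\<close>

definition disc_summable :: "(nat \<Rightarrow> complex) \<Rightarrow> bool" where
  "disc_summable a \<longleftrightarrow> (\<forall>x. norm x < 1 \<longrightarrow> summable (\<lambda>j. a j * x ^ j))"

definition powser :: "(nat \<Rightarrow> complex) \<Rightarrow> complex \<Rightarrow> complex" where
  "powser a x = (\<Sum>j. a j * x ^ j)"

lemma disc_summableD: "disc_summable a \<Longrightarrow> norm x < 1 \<Longrightarrow> summable (\<lambda>j. a j * x ^ j)"
  by (simp add: disc_summable_def)

lemma disc_summable_linear:
  assumes "disc_summable a" "disc_summable b"
  shows "disc_summable (\<lambda>j. \<alpha> * a j + \<beta> * b j)"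
  unfolding disc_summable_def
proof (intro allI impI)
  fix x :: complex assume "norm x < 1"
  then have "summable (\<lambda>j. \<alpha> * (a j * x ^ j) + \<beta> * (b j * x ^ j))"
    using assms by (intro summable_add summable_mult disc_summableD)
  then show "summable (\<lambda>j. (\<alpha> * a j + \<beta> * b j) * x ^ j)"
    by (simp add: algebra_simps)
qed

lemma powser_linear:
  assumes "disc_summable a" "disc_summable b" "norm x < 1"
  shows "powser (\<lambda>j. \<alpha> * a j + \<beta> * b j) x = \<alpha> * powser a x + \<beta> * powser b x"
proof -
  have "(\<lambda>j. \<alpha> * (a j * x ^ j) + \<beta> * (b j * x ^ j)) sums (\<alpha> * powser a x + \<beta> * powser b x)"
    using assms unfolding powser_def
    by (intro sums_add sums_mult summable_sums disc_summableD)
  then show ?thesis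
    unfolding powser_def by (simp add: algebra_simps sums_iff)
qed

lemma disc_summable_Suc: "disc_summable (\<lambda>j. a (Suc j)) \<longleftrightarrow> disc_summable a"
proof -
  have "summable (\<lambda>j. a (Suc j) * x ^ j) \<longleftrightarrow> summable (\<lambda>j. a j * x ^ j)" for x
  proof (cases "x = 0")
    case False
    have "summable (\<lambda>j. a j * x ^ j) \<longleftrightarrow> summable (\<lambda>j. (a (Suc j) * x ^ j) * x)"
      by (subst summable_Suc_iff [symmetric]) (simp add: mult_ac)
    then show ?thesis using False by (simp add: summable_cmult_iff mult.commute [of _ x])
  next
    case True
    have "summable (\<lambda>j. b j * 0 ^ j)" for b :: "nat \<Rightarrow> complex"
      using summable_0_powser by blast
    then show ?thesis using True by simp
  qed
  then show ?thesis by (simp add: disc_summable_def)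
qed

lemma powser_Suc:
  assumes "disc_summable a" "norm x < 1"
  shows "powser a x = a 0 + x * powser (\<lambda>j. a (Suc j)) x"
proof -
  have "summable (\<lambda>j. a (Suc j) * x ^ j)"
    using assms disc_summableD disc_summable_Suc by blast
  then have "x * powser (\<lambda>j. a (Suc j)) x = (\<Sum>j. x * (a (Suc j) * x ^ j))"
    unfolding powser_def by (rule suminf_mult [symmetric])
  also have "\<dots> = (\<Sum>j. a (Suc j) * x ^ Suc j)"
    by (simp add: mult_ac)
  also have "\<dots> = powser a x - a 0"
    unfolding powser_def by (subst suminf_split_head) (use assms disc_summableD in auto)
  finally show ?thesis by simp
qed

lemma disc_summable_index:
  assumes "disc_summable a"
  shows "disc_summable (\<lambda>j. of_nat j * a j)"
proof -
  have "summable (\<lambda>j. diffs a j * x ^ j)" if "norm x < 1" for x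
    by (rule termdiff_converges [of _ 1]) (use that assms disc_summableD in auto)
  then have "disc_summable (\<lambda>j. of_nat (Suc j) * a (Suc j))"
    by (simp add: disc_summable_def diffs_def)
  then show ?thesis
    using disc_summable_Suc [of "\<lambda>j. of_nat j * a j"] by blast
qed

lemma powser_has_derivative:
  assumes "disc_summable a" "norm x < 1"
  shows "(powser a has_field_derivative powser (\<lambda>j. of_nat (Suc j) * a (Suc j)) x) (at x)"
proof -
  have "((\<lambda>x. \<Sum>j. a j * x ^ j) has_field_derivative (\<Sum>j. diffs a j * x ^ j)) (at x)"
    by (rule termdiffs_strong' [of 1]) (use assms disc_summableD in auto)
  then show ?thesis
    by (simp add: powser_def [abs_def] diffs_def)
qed

lemma powser_index:
  assumes "disc_summable a" "norm x < 1"
  shows "powser (\<lambda>j. of_nat j * a j) x = x * powser (\<lambda>j. of_nat (Suc j) * a (Suc j)) x"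
  using powser_Suc [OF disc_summable_index [OF assms(1)] assms(2)] by (simp del: of_nat_Suc)

lemma powser_holomorphic:
  assumes "disc_summable a"
  shows "powser a holomorphic_on ball 0 1"
proof -
  have "\<exists>d. (powser a has_field_derivative d) (at x)" if "x \<in> ball 0 1" for x
    using powser_has_derivative [OF assms, of x] that by (intro exI) simp
  then show ?thesis by (simp add: holomorphic_on_open)
qed

section \<open>Frobenius series with a logarithm\<close>

text \<open>
  This is the derivative at \<open>e = 0\<close> of \<open>\<Sum>k\<ge>c. g (k + e) x\<^sup>k\<^sup>+\<^sup>e\<close>, with \<open>L\<close> written for \<open>log x\<close>.  A separate \<open>L\<close>
  admits every branch of the logarithm, and also a logarithm with an arbitrary constant added to it.
\<close>

definition frobenius :: "int \<Rightarrow> (complex \<Rightarrow> complex) \<Rightarrow> complex \<Rightarrow> complex \<Rightarrow> complex" where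
  "frobenius c g L x = x powi c *
     (powser (\<lambda>j. deriv g (of_int (c + int j))) x + L * powser (\<lambda>j. g (of_int (c + int j))) x)"

definition admissible :: "int \<Rightarrow> (complex \<Rightarrow> complex) \<Rightarrow> bool" where
  "admissible c g \<longleftrightarrow> g holomorphic_on UNIV \<and>
     disc_summable (\<lambda>j. g (of_int (c + int j))) \<and> disc_summable (\<lambda>j. deriv g (of_int (c + int j)))"

lemma entire_has_derivative:
  assumes "g holomorphic_on UNIV"
  shows "(g has_field_derivative deriv g s) (at s)"
  by (rule holomorphic_derivI [OF assms open_UNIV UNIV_I])

lemma deriv_linear_combination:
  assumes "g holomorphic_on UNIV" "h holomorphic_on UNIV"
  shows "deriv (\<lambda>s. \<alpha> * g s + \<beta> * h s) s = \<alpha> * deriv g s + \<beta> * deriv h s"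
  by (intro DERIV_imp_deriv DERIV_add DERIV_cmult entire_has_derivative assms)

lemma admissible_linear:
  assumes "admissible c g" "admissible c h"
  shows "admissible c (\<lambda>s. \<alpha> * g s + \<beta> * h s)"
  using assms unfolding admissible_def
  by (auto simp: deriv_linear_combination intro!: disc_summable_linear holomorphic_intros)

lemma frobenius_linear:
  assumes "admissible c g" "admissible c h" "norm x < 1"
  shows "frobenius c (\<lambda>s. \<alpha> * g s + \<beta> * h s) L x = \<alpha> * frobenius c g L x + \<beta> * frobenius c h L x"
  using assms unfolding admissible_def frobenius_def
  by (simp add: deriv_linear_combination powser_linear algebra_simps)

lemma deriv_mult_id:
  assumes "g holomorphic_on UNIV"
  shows "deriv (\<lambda>s. s * g s) s = g s + s * deriv g s"
  by (rule DERIV_imp_deriv, rule DERIV_cong [OF DERIV_mult [OF DERIV_ident entire_has_derivative [OF assms]]])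
    simp

lemma admissible_mult_id:
  assumes "admissible c g"
  shows "admissible c (\<lambda>s. s * g s)"
proof -
  have *: "disc_summable (\<lambda>j. of_int (c + int j) * a j)" if "disc_summable a" for a
    using disc_summable_linear [OF that disc_summable_index [OF that], of "of_int c" 1]
    by (simp add: algebra_simps)
  have "disc_summable (\<lambda>j. g (of_int (c + int j)) + of_int (c + int j) * deriv g (of_int (c + int j)))"
    using disc_summable_linear [of "\<lambda>j. g (of_int (c + int j))"
        "\<lambda>j. of_int (c + int j) * deriv g (of_int (c + int j))" 1 1] assms *
    by (simp add: admissible_def)
  then show ?thesis
    using assms * [of "\<lambda>j. g (of_int (c + int j))"] unfolding admissible_def
    by (auto simp: deriv_mult_id intro!: holomorphic_intros)
qed

lemma admissible_linear_factor:
  assumes "admissible c g"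
  shows "admissible c (\<lambda>s. (s + \<alpha>) * g s)"
  using admissible_linear [OF admissible_mult_id [OF assms] assms, of 1 \<alpha>]
  by (simp add: algebra_simps)

lemma deriv_shift:
  assumes "g holomorphic_on UNIV"
  shows "deriv (\<lambda>s. g (s + a)) s = deriv g (s + a)"
proof (rule DERIV_imp_deriv)
  show "((\<lambda>s. g (s + a)) has_field_derivative deriv g (s + a)) (at s)"
    using entire_has_derivative [OF assms, of "s + a"] by (simp add: DERIV_shift)
qed

lemma entire_shift:
  assumes "g holomorphic_on UNIV"
  shows "(\<lambda>s::complex. g (s + a)) holomorphic_on UNIV"
proof -
  have "(g \<circ> (\<lambda>s. s + a)) holomorphic_on UNIV"
    by (rule holomorphic_on_compose_gen [OF _ assms]) (auto intro!: holomorphic_intros)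
  then show ?thesis by (simp add: o_def)
qed

lemma admissible_shift:
  assumes "admissible c g"
  shows "admissible (c - d) (\<lambda>s. g (s + of_int d))"
  using assms by (simp add: admissible_def deriv_shift entire_shift algebra_simps)

lemma frobenius_shift:
  assumes "admissible c g" "x \<noteq> 0"
  shows "frobenius (c - d) (\<lambda>s. g (s + of_int d)) L x = x powi (- d) * frobenius c g L x"
proof -
  have "x powi (c - d) = x powi (- d) * x powi c"
    using assms(2) by (simp add: power_int_diff power_int_minus divide_simps)
  then show ?thesis
    using assms by (simp add: frobenius_def admissible_def deriv_shift algebra_simps)
qed

lemma cut_coefficients:
  assumes "f (of_int c) = (0::complex)"
  shows "disc_summable (\<lambda>j. f (of_int (c + 1 + int j))) \<longleftrightarrow> disc_summable (\<lambda>j. f (of_int (c + int j)))"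
    and "disc_summable (\<lambda>j. f (of_int (c + int j))) \<Longrightarrow> norm x < 1 \<Longrightarrow>
      powser (\<lambda>j. f (of_int (c + int j))) x = x * powser (\<lambda>j. f (of_int (c + 1 + int j))) x"
  using disc_summable_Suc [of "\<lambda>j. f (of_int (c + int j))"]
    powser_Suc [of "\<lambda>j. f (of_int (c + int j))" x] assms
  by (simp_all add: algebra_simps)

text \<open>
  At a double zero of \<open>g\<close> both \<open>g k\<close> and \<open>g' k\<close> vanish, so the index at which the series starts may
  move across it.
\<close>

lemma admissible_extend:
  assumes "g (of_int c) = 0" "deriv g (of_int c) = 0"
  shows "admissible (c + 1) g \<longleftrightarrow> admissible c g"
  using assms cut_coefficients [of g c] cut_coefficients [of "deriv g" c]
  by (simp add: admissible_def)

lemma frobenius_extend: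
  assumes "admissible c g" "g (of_int c) = 0" "deriv g (of_int c) = 0" "x \<noteq> 0" "norm x < 1"
  shows "frobenius (c + 1) g L x = frobenius c g L x"
proof -
  have "x powi (c + 1) = x powi c * x" using \<open>x \<noteq> 0\<close> by (simp add: power_int_add)
  moreover have "powser (\<lambda>j. f (of_int (c + int j))) x = x * powser (\<lambda>j. f (of_int (c + 1 + int j))) x"
    if "f = g \<or> f = deriv g" for f
    using that assms by (auto simp: admissible_def simp del: of_int_add intro!: cut_coefficients(2))
  ultimately show ?thesis
    unfolding frobenius_def by (simp add: distrib_left mult_ac del: of_int_add)
qed

text \<open>
  Applied to \<open>x\<^sup>k\<^sup>+\<^sup>e\<close>, the operator \<open>x d/dx\<close> multiplies by \<open>k + e\<close>.  On the coefficient function it is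
  therefore multiplication by the variable, and differentiating this product in \<open>e\<close> takes care of
  the logarithm by itself.
\<close>

lemma frobenius_has_derivative:
  assumes "admissible c g"
    and X: "(X has_field_derivative D) (at z)" and L: "(L has_field_derivative D / X z) (at z)"
    and "X z \<noteq> 0" "norm (X z) < 1"
  shows "((\<lambda>z. frobenius c g (L z) (X z)) has_field_derivative
     D / X z * frobenius c (\<lambda>s. s * g s) (L z) (X z)) (at z)"
proof -
  let ?A = "\<lambda>j. g (of_int (c + int j))" and ?B = "\<lambda>j. deriv g (of_int (c + int j))"
  have A: "disc_summable ?A" and B: "disc_summable ?B" and g: "g holomorphic_on UNIV"
    using assms by (auto simp: admissible_def)
  have index: "powser (\<lambda>j. of_int (c + int j) * a j) (X z) =
      of_int c * powser a (X z) + X z * powser (\<lambda>j. of_nat (Suc j) * a (Suc j)) (X z)"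
    if "disc_summable a" for a
    using powser_linear [OF that disc_summable_index [OF that], of "X z" "of_int c" 1]
      powser_index [OF that] assms(5)
    by (simp add: algebra_simps)
  have sB: "disc_summable (\<lambda>j. of_int (c + int j) * ?B j)"
    using disc_summable_linear [OF B disc_summable_index [OF B], of "of_int c" 1]
    by (simp add: algebra_simps)
  have split: "powser (\<lambda>j. deriv (\<lambda>s. s * g s) (of_int (c + int j))) (X z) =
      powser ?A (X z) + powser (\<lambda>j. of_int (c + int j) * ?B j) (X z)"
    using powser_linear [OF A sB assms(5), of 1 1] by (simp add: deriv_mult_id [OF g])
  have powi: "((\<lambda>z. X z powi c) has_field_derivative of_int c * X z powi c / X z * D) (at z)"
    using X \<open>X z \<noteq> 0\<close> by (auto intro!: derivative_eq_intros simp: power_int_diff)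
  note ps = DERIV_chain2 [OF powser_has_derivative [OF _ assms(5)] X]
  have algebra: "of_int c * y / w * D * (b + L * a) + (b' * D + (D / w * a + a' * D * L)) * y =
      D / w * (y * ((a + (of_int c * b + w * b')) + L * (of_int c * a + w * a')))"
    if "w \<noteq> 0" for a a' b b' y w L
  proof -
    define e where "e = D / w"
    then have D: "D = e * w" using that by simp
    have "of_int c * y / w * D = of_int c * y * e" using that by (simp add: e_def)
    then show ?thesis
      unfolding e_def [symmetric] by (simp add: D algebra_simps)
  qed
  show ?thesis
    unfolding frobenius_def split index [OF A] index [OF B]
    by (rule DERIV_cong [OF DERIV_mult [OF powi DERIV_add [OF ps [OF B] DERIV_mult [OF L ps [OF A]]]]])
      (rule algebra [OF \<open>X z \<noteq> 0\<close>])
qed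

section \<open>Reciprocal factorials of a complex argument\<close>

text \<open>
  The entire function \<open>1 / (a + s)!\<close>.  Its zeros \<open>-a - 1\<close>, \<open>-a - 2\<close>, ... are simple.  A product with exactly
  one such factor vanishes there, but has a nonzero derivative, which is free of \<open>\<psi>\<close>.
\<close>

definition rfact :: "nat \<Rightarrow> complex \<Rightarrow> complex" where
  "rfact a s = rGamma (s + of_nat a + 1)"

lemma rfact_rec: "rfact a s = (s + of_nat a + 1) * rfact (Suc a) s"
  using rGamma_plus1 [of "s + of_nat a + 1"] by (simp add: rfact_def algebra_simps)

lemma rfact_plus1: "rfact a (s + 1) = rfact (Suc a) s"
  by (simp add: rfact_def algebra_simps)

lemma rfact_minus1: "rfact a (s - 1) = (s + of_nat a) * rfact a s"
  using rGamma_plus1 [of "s + of_nat a"] by (simp add: rfact_def algebra_simps)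

lemma rfact_neg_minus1: "rfact a (- (s - 1)) = rfact (Suc a) (- s)"
  by (simp add: rfact_def algebra_simps)

lemma rfact_neg_plus1: "rfact a (- (s + 1)) = (of_nat a - s) * rfact a (- s)"
  using rGamma_plus1 [of "of_nat a - s"] by (simp add: rfact_def algebra_simps)

lemma pochhammer_rfact: "pochhammer (s + of_nat a + 1) r * rfact (a + r) s = rfact a s"
  using pochhammer_rGamma [of "s + of_nat a + 1" r] by (simp add: rfact_def algebra_simps)

lemma rfact_has_derivative_chain:
  "((\<lambda>s. rfact a (f s)) has_field_derivative deriv rGamma (f s + of_nat a + 1) * f') (at s)"
  if "(f has_field_derivative f') (at s)"
proof -
  have g: "((\<lambda>s. f s + of_nat a + 1) has_field_derivative f') (at s)"
    using that by (auto intro!: derivative_eq_intros)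
  show ?thesis
    unfolding rfact_def
    by (rule DERIV_chain2 [OF _ g]) (rule entire_has_derivative [OF holomorphic_rGamma])
qed

lemma entire_rfact [holomorphic_intros]:
  "f holomorphic_on A \<Longrightarrow> (\<lambda>s. rfact a (f s)) holomorphic_on A"
  unfolding rfact_def by (intro holomorphic_intros)

lemma entire_pochhammer [holomorphic_intros]:
  "f holomorphic_on A \<Longrightarrow> (\<lambda>s. pochhammer (f s :: complex) r) holomorphic_on A"
  by (induction r) (auto simp: pochhammer_Suc intro!: holomorphic_intros)

lemma rfact_nat:
  assumes "s + of_nat a = of_nat b"
  shows "rfact a s = 1 / fact b"
    and "(rfact a has_field_derivative - Digamma (of_nat (b + 1)) / fact b) (at s)"
proof -
  show val: "rfact a s = 1 / fact b"
    using assms Gamma_fact [of b, where ?'a = complex]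
    by (simp add: rfact_def rGamma_inverse_Gamma inverse_eq_divide add.commute)
  have "s + of_nat a + 1 = of_nat (Suc b)" using assms by simp
  moreover have "of_nat (Suc b) \<notin> (\<int>\<^sub>\<le>\<^sub>0 :: complex set)"
    using of_nat_in_nonpos_Ints_iff [where ?'a = complex] by blast
  ultimately have "deriv rGamma (s + of_nat a + 1) = - rGamma (s + of_nat a + 1) * Digamma (s + of_nat a + 1)"
    by (intro DERIV_imp_deriv has_field_derivative_rGamma_no_nonpos_int) metis
  then have "deriv rGamma (s + of_nat a + 1) = - Digamma (of_nat (b + 1)) / fact b"
    using val assms by (simp add: rfact_def add.commute)
  then show "(rfact a has_field_derivative - Digamma (of_nat (b + 1)) / fact b) (at s)"
    using rfact_has_derivative_chain [OF DERIV_ident, of a s] by simp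
qed

lemma rfact_negative:
  assumes "s + of_nat a + 1 = - of_nat i"
  shows "rfact a s = 0"
    and "(rfact a has_field_derivative (- 1) ^ i * fact i) (at s)"
proof -
  show "rfact a s = 0"
    using assms by (simp add: rfact_def rGamma_eq_zero_iff)
  have "deriv rGamma (s + of_nat a + 1) = (- 1) ^ i * fact i"
    unfolding assms by (intro DERIV_imp_deriv has_field_derivative_rGamma_nonpos_int)
  then show "(rfact a has_field_derivative (- 1) ^ i * fact i) (at s)"
    using rfact_has_derivative_chain [OF DERIV_ident, of a s] by simp
qed

lemma rfact_neg_has_derivative:
  assumes "(rfact a has_field_derivative d) (at (- s))"
  shows "((\<lambda>s. rfact a (- s)) has_field_derivative - d) (at s)"
proof -
  have "((\<lambda>s. rfact a (- s)) has_field_derivative d * - 1) (at s)"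
    by (rule DERIV_chain2 [where f = "rfact a" and g = uminus, OF assms])
      (auto intro!: derivative_eq_intros)
  then show ?thesis by simp
qed

text \<open>
  The Pochhammer symbol is the quotient of two functions \<open>rfact\<close> whose denominator is regular here.
  Differentiating the product relation treats the regular points and the zeros of the numerator alike.
\<close>

lemma pochhammer_rfact_deriv:
  assumes b: "s + of_nat (a + r) = of_nat b" and d: "(rfact a has_field_derivative d) (at s)"
  shows "pochhammer (s + of_nat a + 1) r = fact b * rfact a s"
    and "((\<lambda>s. pochhammer (s + of_nat a + 1) r) has_field_derivative
      fact b * (d + rfact a s * Digamma (of_nat (b + 1)))) (at s)"
proof -
  note val = rfact_nat(1) [OF b] and der = rfact_nat(2) [OF b]
  show P: "pochhammer (s + of_nat a + 1) r = fact b * rfact a s"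
    using pochhammer_rfact [of s a r] val by (simp add: field_simps)
  have "(\<lambda>s::complex. pochhammer (s + of_nat a + 1) r) holomorphic_on UNIV"
    by (intro holomorphic_intros)
  then obtain e where e: "((\<lambda>s. pochhammer (s + of_nat a + 1) r) has_field_derivative e) (at s)"
    using entire_has_derivative by blast
  have "(rfact a has_field_derivative
     e * rfact (a + r) s + - Digamma (of_nat (b + 1)) / fact b * pochhammer (s + of_nat a + 1) r) (at s)"
    using DERIV_mult [OF e der] by (simp add: pochhammer_rfact)
  then have "d = e * rfact (a + r) s + - Digamma (of_nat (b + 1)) / fact b * pochhammer (s + of_nat a + 1) r"
    using d DERIV_unique by blast
  then have "e = fact b * (d + rfact a s * Digamma (of_nat (b + 1)))"
    unfolding val P by (simp add: field_simps)
  then show "((\<lambda>s. pochhammer (s + of_nat a + 1) r) has_field_derivative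
      fact b * (d + rfact a s * Digamma (of_nat (b + 1)))) (at s)"
    using e by simp
qed

lemma deriv_double_zero:
  assumes "f holomorphic_on UNIV" "g holomorphic_on UNIV" "f a = 0" "g a = 0"
  shows "deriv (\<lambda>s. f s * g s) a = 0"
  by (rule DERIV_imp_deriv, rule DERIV_cong [OF DERIV_mult])
    (rule entire_has_derivative assms | simp add: assms)+

section \<open>Contiguous relations\<close>

text \<open>
  Contiguous relations between solutions with exponents \<open>0, m + p + q + 1\<close> at \<open>0\<close>, \<open>0, -m\<close> at \<open>1\<close> and
  \<open>-p, -q\<close> at infinity.  The normalization, and with it the integer factors on the right, is that of
  \<open>U3\<close>.  Only differentiation leads to higher parameters, so that no constant of integration is ever
  to be determined.
\<close>

definition ladder :: "complex set \<Rightarrow> (nat \<Rightarrow> nat \<Rightarrow> nat \<Rightarrow> complex \<Rightarrow> complex) \<Rightarrow> bool" where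
  "ladder D V \<longleftrightarrow> (\<forall>p q m. \<forall>z\<in>D. \<exists>V'. (V p q m has_field_derivative V') (at z) \<and>
     z * (1 - z) * V' - (of_nat (m + p + q + 1) - of_nat q * z) * V p q m z =
       - of_nat ((p + 1) * (m + p + 1)) * V (Suc p) q m z \<and>
     z * (1 - z) * V' - (of_nat (m + p + q + 1) - of_nat p * z) * V p q m z =
       - of_nat ((q + 1) * (m + q + 1)) * V p (Suc q) m z \<and>
     z * V' - of_nat (m + p + q + 1) * V p q m z =
       - of_nat ((m + p + 1) * (m + q + 1)) * V p q (Suc m) z)"

lemma ladderE:
  assumes "ladder D V" "z \<in> D"
  obtains V' where "(V p q m has_field_derivative V') (at z)"
     "z * (1 - z) * V' - (of_nat (m + p + q + 1) - of_nat q * z) * V p q m z =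
       - of_nat ((p + 1) * (m + p + 1)) * V (Suc p) q m z"
     "z * (1 - z) * V' - (of_nat (m + p + q + 1) - of_nat p * z) * V p q m z =
       - of_nat ((q + 1) * (m + q + 1)) * V p (Suc q) m z"
     "z * V' - of_nat (m + p + q + 1) * V p q m z =
       - of_nat ((m + p + 1) * (m + q + 1)) * V p q (Suc m) z"
  using assms unfolding ladder_def by metis

lemma ladder_swap:
  assumes "ladder D V"
  shows "ladder D (\<lambda>p q m. V q p m)"
  unfolding ladder_def
proof (intro allI ballI)
  fix p q m z assume "z \<in> D"
  from ladderE [OF assms this, of q p m] obtain V' where *:
     "(V q p m has_field_derivative V') (at z)"
     "z * (1 - z) * V' - (of_nat (m + q + p + 1) - of_nat p * z) * V q p m z =
       - of_nat ((q + 1) * (m + q + 1)) * V (Suc q) p m z"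
     "z * (1 - z) * V' - (of_nat (m + q + p + 1) - of_nat q * z) * V q p m z =
       - of_nat ((p + 1) * (m + p + 1)) * V q (Suc p) m z"
     "z * V' - of_nat (m + q + p + 1) * V q p m z =
       - of_nat ((m + q + 1) * (m + p + 1)) * V q p (Suc m) z" by blast
  show "\<exists>V'. (V q p m has_field_derivative V') (at z) \<and>
     z * (1 - z) * V' - (of_nat (m + p + q + 1) - of_nat q * z) * V q p m z =
       - of_nat ((p + 1) * (m + p + 1)) * V q (Suc p) m z \<and>
     z * (1 - z) * V' - (of_nat (m + p + q + 1) - of_nat p * z) * V q p m z =
       - of_nat ((q + 1) * (m + q + 1)) * V (Suc q) p m z \<and>
     z * V' - of_nat (m + p + q + 1) * V q p m z =
       - of_nat ((m + p + 1) * (m + q + 1)) * V q p (Suc m) z"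
    by (intro exI [of _ V'] conjI)
      (use * in \<open>simp_all only: add.commute [of q p] add.assoc mult.commute [of "m + (q + 1)"]\<close>)
qed

text \<open>
  On an open set a function determines its derivative, and the integer factors on the right of the
  relations do not vanish.  Hence agreement at \<open>(p, q, m)\<close> passes to the three next parameters.
\<close>

lemma ladder_unique:
  assumes "ladder D V" "ladder D W" "open D" and base: "\<And>z. z \<in> D \<Longrightarrow> V 0 0 0 z = W 0 0 0 z"
    and "z \<in> D"
  shows "V p q m z = W p q m z"
proof -
  have step: "(\<forall>z\<in>D. V (Suc p) q m z = W (Suc p) q m z) \<and>
      (\<forall>z\<in>D. V p (Suc q) m z = W p (Suc q) m z) \<and>
      (\<forall>z\<in>D. V p q (Suc m) z = W p q (Suc m) z)"
    if eq: "\<forall>z\<in>D. V p q m z = W p q m z" for p q m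
  proof -
    have "V (Suc p) q m z = W (Suc p) q m z \<and> V p (Suc q) m z = W p (Suc q) m z \<and>
        V p q (Suc m) z = W p q (Suc m) z" if z: "z \<in> D" for z
    proof -
      from ladderE [OF assms(1) z, of p q m] obtain V' where V:
         "(V p q m has_field_derivative V') (at z)"
         "z * (1 - z) * V' - (of_nat (m + p + q + 1) - of_nat q * z) * V p q m z =
           - of_nat ((p + 1) * (m + p + 1)) * V (Suc p) q m z"
         "z * (1 - z) * V' - (of_nat (m + p + q + 1) - of_nat p * z) * V p q m z =
           - of_nat ((q + 1) * (m + q + 1)) * V p (Suc q) m z"
         "z * V' - of_nat (m + p + q + 1) * V p q m z =
           - of_nat ((m + p + 1) * (m + q + 1)) * V p q (Suc m) z" by blast
      from ladderE [OF assms(2) z, of p q m] obtain W' where W: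
         "(W p q m has_field_derivative W') (at z)"
         "z * (1 - z) * W' - (of_nat (m + p + q + 1) - of_nat q * z) * W p q m z =
           - of_nat ((p + 1) * (m + p + 1)) * W (Suc p) q m z"
         "z * (1 - z) * W' - (of_nat (m + p + q + 1) - of_nat p * z) * W p q m z =
           - of_nat ((q + 1) * (m + q + 1)) * W p (Suc q) m z"
         "z * W' - of_nat (m + p + q + 1) * W p q m z =
           - of_nat ((m + p + 1) * (m + q + 1)) * W p q (Suc m) z" by blast
      have "(V p q m has_field_derivative W') (at z)"
        by (rule has_field_derivative_transform_within_open [OF W(1) \<open>open D\<close> z]) (use eq in auto)
      then have "V' = W'" using V(1) DERIV_unique by blast
      moreover have "V p q m z = W p q m z" using eq z by blast
      moreover have "v = w" if "- of_nat ((a + 1) * (c + 1)) * v = - of_nat ((a + 1) * (c + 1)) * w"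
        for a c :: nat and v w :: complex
        using that by (simp del: of_nat_mult of_nat_add of_nat_Suc)
      ultimately show ?thesis
        using V(2-4) W(2-4) by metis
    qed
    then show ?thesis by blast
  qed
  have "\<forall>z\<in>D. V p 0 0 z = W p 0 0 z" by (induction p) (use base step in blast)+
  then have "\<forall>z\<in>D. V p q 0 z = W p q 0 z" by (induction q) (use step in blast)+
  then have "\<forall>z\<in>D. V p q m z = W p q m z" by (induction m) (use step in blast)+
  then show ?thesis using \<open>z \<in> D\<close> by blast
qed

text \<open>
  Multiplication by \<open>x\<close> shifts the index.  A double zero just below the first index makes room for the
  original starting point.
\<close>

lemma frobenius_times_x:
  assumes "admissible c g" "x \<noteq> 0" "norm x < 1"
    and "g (of_int (c - 1)) = 0" "deriv g (of_int (c - 1)) = 0"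
  shows "admissible c (\<lambda>s. g (s - 1))"
    and "x * frobenius c g L x = frobenius c (\<lambda>s. g (s - 1)) L x"
proof -
  have adm: "admissible (c + 1) (\<lambda>s. g (s - 1))"
    using admissible_shift [OF assms(1), of "-1"] by simp
  have hol: "g holomorphic_on UNIV" using assms(1) by (simp add: admissible_def)
  have zero: "g (of_int c - 1) = 0" "deriv (\<lambda>s. g (s - 1)) (of_int c) = 0"
    using assms(4,5) deriv_shift [OF hol, of "-1" "of_int c"] by simp_all
  show adm': "admissible c (\<lambda>s. g (s - 1))"
    using admissible_extend [of "\<lambda>s. g (s - 1)" c] zero adm by simp
  show "x * frobenius c g L x = frobenius c (\<lambda>s. g (s - 1)) L x"
    using frobenius_shift [OF assms(1,2), of "-1" L] frobenius_extend [OF adm', of x L] zero assms(2,3)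
    by simp
qed

lemma frobenius_divide_x:
  assumes "admissible c g" "x \<noteq> 0"
  shows "admissible (c - 1) (\<lambda>s. g (s + 1))"
    and "frobenius c g L x / x = frobenius (c - 1) (\<lambda>s. g (s + 1)) L x"
  using admissible_shift [OF assms(1), of 1] frobenius_shift [OF assms, of 1 L]
  by (simp_all add: power_int_minus field_simps)

lemma frobenius_cmult:
  assumes "admissible c g" "norm x < 1"
  shows "frobenius c (\<lambda>s. \<alpha> * g s) L x = \<alpha> * frobenius c g L x"
  using frobenius_linear [OF assms(1,1,2), of \<alpha> 0] by simp

lemma frobenius_linear_factor:
  assumes "admissible c g" "norm x < 1"
  shows "frobenius c (\<lambda>s. (s + \<alpha>) * g s) L x = frobenius c (\<lambda>s. s * g s) L x + \<alpha> * frobenius c g L x"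
  using frobenius_linear [OF admissible_mult_id [OF assms(1)] assms, of 1 \<alpha>] by (simp add: algebra_simps)

lemma admissible_pochhammer:
  assumes "admissible c g"
  shows "admissible c (\<lambda>s. pochhammer (s + \<alpha>) r * g s)"
proof (induction r)
  case (Suc r)
  have "admissible c (\<lambda>s. (s + (\<alpha> + of_nat r)) * (pochhammer (s + \<alpha>) r * g s))"
    by (rule admissible_linear_factor [OF Suc])
  then show ?case by (simp add: pochhammer_Suc algebra_simps)
qed (use assms in simp)

lemma disc_summable_bounded:
  assumes "\<And>j. j \<ge> J \<Longrightarrow> norm (a j) \<le> B"
  shows "disc_summable a"
  unfolding disc_summable_def
proof (intro allI impI)
  fix x :: complex assume x: "norm x < 1"
  show "summable (\<lambda>j. a j * x ^ j)"
  proof (rule summable_comparison_test' [of "\<lambda>j. B * norm x ^ j" J])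
    show "summable (\<lambda>j. B * norm x ^ j)"
      using x by (intro summable_mult summable_geometric) simp
    show "norm (a j * x ^ j) \<le> B * norm x ^ j" if "j \<ge> J" for j
      using assms [OF that] by (simp add: norm_mult norm_power mult_right_mono)
  qed
qed

section \<open>Coefficient functions of the expansions at 1\<close>

text \<open>
  On this set the series in \<open>z\<close>, in \<open>1 - z\<close> and in \<open>(1 - z) / z\<close> all converge, and the principal values
  satisfy \<open>log ((1 - z) / z) = log (1 - z) - log z\<close>.
\<close>

definition lens :: "complex set" where
  "lens = ball 0 1 \<inter> ball 1 (1/2)"

text \<open>
  The coefficient functions of the expansions at \<open>1\<close> are \<open>1 / (s! (m+s)! (p-s)! (q-s)!)\<close> for formula (1),
  \<open>(m+p+s)! (m+q+s)! / (s! (m+s)!)\<close> for (2), and \<open>(m+p+s)! / (s! (m+s)! (q-s)!)\<close> for (3).  Formula (4) is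
  (3) with \<open>p\<close> and \<open>q\<close> exchanged.  Quotients of factorials are written as Pochhammer symbols, which
  makes all three functions entire.
\<close>

definition coeff1 :: "nat \<Rightarrow> nat \<Rightarrow> nat \<Rightarrow> complex \<Rightarrow> complex" where
  "coeff1 p q m s = rfact 0 s * rfact p (- s) * (rfact m s * rfact q (- s))"

definition coeff2 :: "nat \<Rightarrow> nat \<Rightarrow> nat \<Rightarrow> complex \<Rightarrow> complex" where
  "coeff2 p q m s = pochhammer (s + of_nat m + 1) p * (pochhammer (s + of_nat m + 1) q * pochhammer (s + 1) m)"

definition coeff3 :: "nat \<Rightarrow> nat \<Rightarrow> nat \<Rightarrow> complex \<Rightarrow> complex" where
  "coeff3 p q m s = pochhammer (s + of_nat m + 1) p * (rfact 0 s * rfact q (- s))"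

text \<open>
  All expansions start at the index \<open>-m\<close>, the smaller exponent at \<open>1\<close>.  The constant \<open>\<mu>\<close> added to the
  logarithm separates the logarithmic part of a solution from the rest: the former is the coefficient
  of \<open>\<mu>\<close>.
\<close>

definition sol1 :: "complex \<Rightarrow> nat \<Rightarrow> nat \<Rightarrow> nat \<Rightarrow> complex \<Rightarrow> complex" where
  "sol1 \<mu> p q m z = frobenius (- int m) (coeff1 p q m) (Ln (1 - z) + \<mu>) (1 - z)"

definition sol2 :: "complex \<Rightarrow> nat \<Rightarrow> nat \<Rightarrow> nat \<Rightarrow> complex \<Rightarrow> complex" where
  "sol2 \<mu> p q m z = z ^ (m + p + q + 1) / (fact p * fact q * fact (m + p) * fact (m + q)) *
     frobenius (- int m) (coeff2 p q m) (Ln (1 - z) + \<mu>) (1 - z)"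

definition sol3 :: "complex \<Rightarrow> nat \<Rightarrow> nat \<Rightarrow> nat \<Rightarrow> complex \<Rightarrow> complex" where
  "sol3 \<mu> p q m z = z ^ q / (fact p * fact (m + p)) *
     frobenius (- int m) (coeff3 p q m) (Ln ((1 - z) / z) + \<mu>) ((1 - z) / z)"

lemma coeff_holomorphic [holomorphic_intros]:
  "coeff1 p q m holomorphic_on UNIV" "coeff2 p q m holomorphic_on UNIV" "coeff3 p q m holomorphic_on UNIV"
  unfolding coeff1_def [abs_def] coeff2_def [abs_def] coeff3_def [abs_def]
  by (intro holomorphic_intros)+

lemma rfact_neg_zero: "rfact a (- of_nat k) = 0" if "a < k"
proof -
  have "- of_nat k + of_nat a + 1 = (- of_nat (k - a - 1) :: complex)"
    using that by (simp add: of_nat_diff)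
  then show ?thesis by (rule rfact_negative)
qed

lemma coeff1_double_zero:
  assumes "p < k" "q < k"
  shows "coeff1 p q m (of_nat k) = 0" "deriv (coeff1 p q m) (of_nat k) = 0"
  unfolding coeff1_def [abs_def] using assms
  by (auto intro!: deriv_double_zero holomorphic_intros simp: rfact_neg_zero)

lemma admissible_coeff1: "admissible (- int m) (coeff1 p q m)"
proof -
  have *: "coeff1 p q m (of_int (- int m + int j)) = 0 \<and> deriv (coeff1 p q m) (of_int (- int m + int j)) = 0"
    if "j \<ge> m + p + q + 1" for j
  proof -
    have "of_int (- int m + int j) = (of_nat (j - m) :: complex)"
      using that by (simp add: of_nat_diff)
    then show ?thesis using coeff1_double_zero [of p "j - m" q m] that by simp
  qed
  have "disc_summable (\<lambda>j. coeff1 p q m (of_int (- int m + int j)))"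
    by (rule disc_summable_bounded [of "m + p + q + 1" _ 0]) (use * in simp)
  moreover have "disc_summable (\<lambda>j. deriv (coeff1 p q m) (of_int (- int m + int j)))"
    by (rule disc_summable_bounded [of "m + p + q + 1" _ 0]) (use * in simp)
  ultimately show ?thesis by (simp add: admissible_def coeff_holomorphic)
qed

lemma admissible_coeff2: "admissible (- int m) (coeff2 p q m)"
proof -
  have "admissible (- int m) (\<lambda>s. 1)"
    unfolding admissible_def
    by (auto intro!: disc_summable_bounded [of 0 _ 1])
  then show ?thesis
    using admissible_pochhammer [of "- int m" "\<lambda>s. 1" 1 m]
      admissible_pochhammer [of "- int m" _ "of_nat m + 1" q]
      admissible_pochhammer [of "- int m" _ "of_nat m + 1" p]
    unfolding coeff2_def [abs_def] add.assoc by simp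
qed

text \<open>
  Beyond \<open>q\<close> only the factor \<open>1 / (q - s)!\<close> has a zero, and a simple one.  Its derivative produces the
  infinite series without \<open>\<psi>\<close> in formulas (3) and (4).
\<close>

lemma rfact_product_beyond:
  assumes "q < k"
  shows "rfact 0 (of_nat k) * rfact q (- of_nat k) = 0"
    and "((\<lambda>s. rfact 0 s * rfact q (- s)) has_field_derivative
      (- 1) ^ (k - q) * fact (k - q - 1) / fact k) (at (of_nat k))"
proof -
  have eq: "- of_nat k + of_nat q + 1 = (- of_nat (k - q - 1) :: complex)"
    using assms by (simp add: of_nat_diff)
  show "rfact 0 (of_nat k) * rfact q (- of_nat k) = 0"
    using rfact_negative(1) [OF eq] by simp
  have "k - q = Suc (k - q - 1)" using assms by simp
  then have sign: "(- 1) ^ (k - q) = - ((- 1) ^ (k - q - 1) :: complex)"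
    by (metis power_Suc mult_minus1)
  show "((\<lambda>s. rfact 0 s * rfact q (- s)) has_field_derivative
      (- 1) ^ (k - q) * fact (k - q - 1) / fact k) (at (of_nat k))"
    using DERIV_mult [OF rfact_nat(2) [of "of_nat k" 0 k]
        rfact_neg_has_derivative [OF rfact_negative(2) [OF eq]]]
      rfact_nat(1) [of "of_nat k" 0 k] rfact_negative(1) [OF eq]
    by (simp add: sign)
qed

lemma admissible_rfact_product: "admissible (- int m) (\<lambda>s. rfact 0 s * rfact q (- s))"
proof -
  let ?g = "\<lambda>s. rfact 0 s * rfact q (- s)"
  have *: "?g (of_int (- int m + int j)) = 0 \<and> norm (deriv ?g (of_int (- int m + int j))) \<le> 1"
    if "j \<ge> m + q + 1" for j
  proof -
    have eq: "of_int (- int m + int j) = (of_nat (j - m) :: complex)"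
      using that by (simp add: of_nat_diff)
    have q: "q < j - m" using that by simp
    have le: "fact (j - m - q - 1) \<le> (fact (j - m) :: real)"
      by (rule fact_mono) simp
    have "norm (deriv ?g (of_nat (j - m))) = fact (j - m - q - 1) / fact (j - m)"
      unfolding DERIV_imp_deriv [OF rfact_product_beyond(2) [OF q]]
      by (simp only: norm_mult norm_divide norm_power norm_minus_cancel norm_one norm_fact
          power_one mult_1)
    then show ?thesis
      unfolding eq using rfact_product_beyond(1) [OF q] le by simp
  qed
  have "disc_summable (\<lambda>j. ?g (of_int (- int m + int j)))"
    by (rule disc_summable_bounded [of "m + q + 1" _ 0]) (use * in simp)
  moreover have "disc_summable (\<lambda>j. deriv ?g (of_int (- int m + int j)))"
    by (rule disc_summable_bounded [of "m + q + 1" _ 1]) (use * in simp)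
  moreover have "?g holomorphic_on UNIV" by (intro holomorphic_intros)
  ultimately show ?thesis by (simp add: admissible_def)
qed

lemma admissible_coeff3: "admissible (- int m) (coeff3 p q m)"
  using admissible_pochhammer [OF admissible_rfact_product, of m "of_nat m + 1" p q]
  unfolding coeff3_def [abs_def] add.assoc .

section \<open>Contiguous relations for the expansions at 1\<close>

text \<open>
  By the functional equation of the Gamma function, the contiguous relations for coefficient functions
  hold at every complex \<open>s\<close>, not only at integers.  They may therefore be differentiated, and the \<open>\<psi>\<close>
  terms need no separate treatment.
\<close>

lemma coeff1_Suc_p:
  "of_nat ((p + 1) * (m + p + 1)) * coeff1 (Suc p) q m s =
   (s + of_nat (m + p + 1)) * coeff1 p q m s - (s - 1 - of_nat q) * coeff1 p q m (s - 1)"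
  unfolding coeff1_def rfact_minus1 rfact_neg_minus1 rfact_rec [of p "- s"] rfact_rec [of q "- s"]
  by (simp add: algebra_simps)

lemma coeff1_Suc_m:
  "of_nat ((m + p + 1) * (m + q + 1)) * coeff1 p q (Suc m) s =
   (s + 1) * coeff1 p q m (s + 1) - (s - of_nat (m + p + q + 1)) * coeff1 p q m s"
  unfolding coeff1_def rfact_plus1 rfact_neg_plus1 rfact_rec [of m s] rfact_rec [of 0 s]
  by (simp add: algebra_simps)

lemma coeff2_Suc_p: "coeff2 (Suc p) q m s = (s + of_nat (m + p + 1)) * coeff2 p q m s"
  by (simp add: coeff2_def pochhammer_Suc algebra_simps)

lemma coeff2_Suc_m: "coeff2 p q (Suc m) s = (s + 1) * coeff2 p q m (s + 1)"
  by (simp add: coeff2_def pochhammer_rec algebra_simps)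

lemma coeff3_Suc_p: "coeff3 (Suc p) q m s = (s + of_nat (m + p + 1)) * coeff3 p q m s"
  by (simp add: coeff3_def pochhammer_Suc algebra_simps)

lemma pochhammer_shift: "(z + of_nat r) * pochhammer z r = z * pochhammer (z + 1) r"
  using pochhammer_rec [of z r] pochhammer_rec' [of z r] by simp

lemma coeff3_Suc_q:
  "of_nat ((q + 1) * (m + q + 1)) * coeff3 p (Suc q) m s =
   (s + of_nat (m + q + 1)) * coeff3 p q m s + (s - 1 + of_nat (m + p + 1)) * coeff3 p q m (s - 1)"
proof -
  have "(s - 1 + of_nat (m + p + 1)) * coeff3 p q m (s - 1) =
      ((s + of_nat m + of_nat p) * pochhammer (s + of_nat m) p) * (s * rfact 0 s * rfact (Suc q) (- s))"
    unfolding coeff3_def rfact_minus1 rfact_neg_minus1 by (simp add: algebra_simps)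
  also have "\<dots> = (s + of_nat m) * pochhammer (s + of_nat m + 1) p * (s * rfact 0 s * rfact (Suc q) (- s))"
    unfolding pochhammer_shift ..
  finally show ?thesis
    unfolding coeff3_def rfact_rec [of q "- s"] by (simp add: algebra_simps)
qed

lemma coeff3_Suc_m:
  "of_nat (m + q + 1) * coeff3 p q (Suc m) s =
   (s + of_nat (m + p + 1)) * coeff3 p q m s + (s + 1) * coeff3 p q m (s + 1)"
proof -
  have "(s + of_nat (m + p + 1)) * coeff3 p q m s =
      ((s + of_nat m + 1 + of_nat p) * pochhammer (s + of_nat m + 1) p) * (rfact 0 s * rfact q (- s))"
    unfolding coeff3_def by (simp add: algebra_simps)
  also have "\<dots> = (s + of_nat m + 1) * pochhammer (s + of_nat m + 1 + 1) p * (rfact 0 s * rfact q (- s))"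
    unfolding pochhammer_shift ..
  finally show ?thesis
    unfolding coeff3_def rfact_plus1 rfact_neg_plus1 rfact_rec [of 0 s]
    by (simp add: algebra_simps)
qed

lemma lensD:
  assumes "z \<in> lens"
  shows "1 - z \<noteq> 0" "norm (1 - z) < 1" "z \<noteq> 0" "(1 - z) / z \<noteq> 0" "norm ((1 - z) / z) < 1"
    "1 - z \<notin> \<real>\<^sub>\<le>\<^sub>0" "z \<notin> \<real>\<^sub>\<le>\<^sub>0" "(1 - z) / z \<notin> \<real>\<^sub>\<le>\<^sub>0" "0 < Re z" "0 < Re (1 - z)"
proof -
  have z: "norm z < 1" "norm (1 - z) < 1 / 2"
    using assms by (auto simp: lens_def dist_norm)
  have "1 - norm (1 - z) \<le> norm z"
    using norm_triangle_ineq [of z "1 - z"] by simp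
  with z have z': "norm (1 - z) < norm z" by simp
  have "Re z \<le> norm z" by (rule complex_Re_le_cmod)
  with z show re: "0 < Re (1 - z)" by simp
  have "\<bar>Re (1 - z)\<bar> \<le> norm (1 - z)" by (rule abs_Re_le_cmod)
  with z show re': "0 < Re z" by simp
  show nz: "1 - z \<noteq> 0" "z \<noteq> 0" using re re' by auto
  show "norm (1 - z) < 1" using z by simp
  show "(1 - z) / z \<noteq> 0" using nz by simp
  show "norm ((1 - z) / z) < 1" using z' nz by (simp add: norm_divide)
  show nr: "1 - z \<notin> \<real>\<^sub>\<le>\<^sub>0" "z \<notin> \<real>\<^sub>\<le>\<^sub>0" using re re' by (auto simp: complex_nonpos_Reals_iff)
  show "(1 - z) / z \<notin> \<real>\<^sub>\<le>\<^sub>0"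
  proof
    assume "(1 - z) / z \<in> \<real>\<^sub>\<le>\<^sub>0"
    then obtain r where r: "(1 - z) / z = complex_of_real r" "r \<le> 0"
      using nonpos_Reals_cases by blast
    then have *: "1 - z = complex_of_real r * z" using nz by (simp add: field_simps)
    then have "Re (1 - z) = r * Re z" by simp
    then show False using re re' r by (smt (verit) mult_nonpos_nonneg)
  qed
qed

lemma open_lens: "open lens"
  unfolding lens_def by (intro open_Int open_ball)

text \<open>
  For a family symmetric in \<open>p\<close> and \<open>q\<close> the relation that raises \<open>q\<close> is the one that raises \<open>p\<close>, read
  for the exchanged parameters.
\<close>

lemma ladder_symmetricI:
  assumes sym: "\<And>p q m z. V p q m z = V q p m z"
    and "\<And>p q m z. z \<in> D \<Longrightarrow> \<exists>V'. (V p q m has_field_derivative V') (at z) \<and>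
     z * (1 - z) * V' - (of_nat (m + p + q + 1) - of_nat q * z) * V p q m z =
       - of_nat ((p + 1) * (m + p + 1)) * V (Suc p) q m z \<and>
     z * V' - of_nat (m + p + q + 1) * V p q m z =
       - of_nat ((m + p + 1) * (m + q + 1)) * V p q (Suc m) z"
  shows "ladder D V"
  unfolding ladder_def
proof (intro allI ballI)
  fix p q m z assume z: "z \<in> D"
  obtain V' where V: "(V p q m has_field_derivative V') (at z)"
     "z * (1 - z) * V' - (of_nat (m + p + q + 1) - of_nat q * z) * V p q m z =
       - of_nat ((p + 1) * (m + p + 1)) * V (Suc p) q m z"
     "z * V' - of_nat (m + p + q + 1) * V p q m z =
       - of_nat ((m + p + 1) * (m + q + 1)) * V p q (Suc m) z"
    using assms(2) [OF z] by metis
  obtain W' where W: "(V q p m has_field_derivative W') (at z)"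
     "z * (1 - z) * W' - (of_nat (m + q + p + 1) - of_nat p * z) * V q p m z =
       - of_nat ((q + 1) * (m + q + 1)) * V (Suc q) p m z"
    using assms(2) [OF z] by metis
  have "V q p m = V p q m" using sym by blast
  then have "W' = V'" using V(1) W(1) DERIV_unique by metis
  have "z * (1 - z) * V' - (of_nat (m + p + q + 1) - of_nat p * z) * V p q m z =
       - of_nat ((q + 1) * (m + q + 1)) * V p (Suc q) m z"
    using W(2) unfolding \<open>W' = V'\<close> sym [of q] sym [of "Suc q"] by (simp only: add.assoc add.commute [of q p])
  with V show "\<exists>V'. (V p q m has_field_derivative V') (at z) \<and>
     z * (1 - z) * V' - (of_nat (m + p + q + 1) - of_nat q * z) * V p q m z =
       - of_nat ((p + 1) * (m + p + 1)) * V (Suc p) q m z \<and>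
     z * (1 - z) * V' - (of_nat (m + p + q + 1) - of_nat p * z) * V p q m z =
       - of_nat ((q + 1) * (m + q + 1)) * V p (Suc q) m z \<and>
     z * V' - of_nat (m + p + q + 1) * V p q m z =
       - of_nat ((m + p + 1) * (m + q + 1)) * V p q (Suc m) z" by blast
qed

lemma coeff1_below:
  assumes "m < k"
  shows "coeff1 p q m (- of_nat k) = 0" "deriv (coeff1 p q m) (- of_nat k) = 0"
  unfolding coeff1_def [abs_def] using assms
  by (auto intro!: deriv_double_zero holomorphic_intros simp: rfact_neg_zero)

lemma deriv_linear_factor_zero:
  assumes "g holomorphic_on UNIV" "g a = 0" "deriv g a = 0"
  shows "deriv (\<lambda>s. (s + \<alpha>) * g s) a = 0"
  by (rule DERIV_imp_deriv, rule DERIV_cong [OF DERIV_mult [OF _ entire_has_derivative [OF assms(1)]]])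
    (auto intro!: derivative_eq_intros simp: assms)

lemma of_int_below: "of_int (- int m - 1) = (- of_nat (Suc m) :: complex)"
  by simp

text \<open>
  In the variable \<open>x = 1 - z\<close> the operators that raise \<open>p\<close> and \<open>m\<close> combine \<open>x d/dx\<close> with multiplication
  and division by \<open>x\<close>.  The double zero of \<open>coeff1\<close> at \<open>-m - 1\<close> allows series that start at different
  indices to be added.
\<close>

lemma ladder_sol1: "ladder lens (sol1 \<mu>)"
proof (rule ladder_symmetricI)
  show "sol1 \<mu> p q m z = sol1 \<mu> q p m z" for p q m z
  proof -
    have "coeff1 p q m = coeff1 q p m" by (simp add: coeff1_def fun_eq_iff mult_ac)
    then show ?thesis by (simp add: sol1_def)
  qed
next
  fix p q m z assume z: "z \<in> lens"
  define X where "X = 1 - z"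
  define c where "c = - int m"
  define F where "F g = frobenius c g (Ln (1 - z) + \<mu>) X" for g
  let ?g = "coeff1 p q m"
  have X: "X \<noteq> 0" "norm X < 1" and z_X: "z = 1 - X" using lensD [OF z] by (auto simp: X_def)
  have adm: "admissible c ?g" by (simp add: admissible_coeff1 c_def)
  note adms = admissible_linear_factor [OF adm]
  have below: "?g (of_int (c - 1)) = 0" "deriv ?g (of_int (c - 1)) = 0"
    using coeff1_below [of m "Suc m" p q] by (simp_all only: c_def of_int_below)
  have below': "(of_int (c - 1) + \<alpha>) * ?g (of_int (c - 1)) = 0"
    "deriv (\<lambda>s. (s + \<alpha>) * ?g s) (of_int (c - 1)) = 0" for \<alpha>
    using below by (simp_all only: mult_zero_right deriv_linear_factor_zero coeff_holomorphic)
  define dF where "dF = F (\<lambda>s. s * ?g s)"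
  have lin: "F (\<lambda>s. (s + \<alpha>) * ?g s) = dF + \<alpha> * F ?g" for \<alpha>
    unfolding F_def dF_def by (rule frobenius_linear_factor [OF adm X(2)])
  have D: "(sol1 \<mu> p q m has_field_derivative - 1 / X * dF) (at z)"
    unfolding sol1_def [abs_def] dF_def F_def X_def c_def
    by (rule frobenius_has_derivative [OF admissible_coeff1])
      (use lensD [OF z] in \<open>auto intro!: derivative_eq_intros simp: divide_simps\<close>)
  have p: "of_nat ((p + 1) * (m + p + 1)) * sol1 \<mu> (Suc p) q m z =
      (dF + of_nat (m + p + 1) * F ?g) - X * (dF - of_nat q * F ?g)"
  proof -
    note shift = frobenius_times_x [OF adms X below', of "- of_nat q"]
    have "of_nat ((p + 1) * (m + p + 1)) * sol1 \<mu> (Suc p) q m z =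
        F (\<lambda>s. of_nat ((p + 1) * (m + p + 1)) * coeff1 (Suc p) q m s)"
      unfolding F_def sol1_def c_def X_def
      by (rule frobenius_cmult [symmetric, OF admissible_coeff1]) (use lensD [OF z] in simp)
    also have "\<dots> = F (\<lambda>s. 1 * ((s + of_nat (m + p + 1)) * ?g s) + (- 1) * ((s - 1 + - of_nat q) * ?g (s - 1)))"
      unfolding coeff1_Suc_p by simp
    also have "\<dots> = F (\<lambda>s. (s + of_nat (m + p + 1)) * ?g s) - X * F (\<lambda>s. (s + - of_nat q) * ?g s)"
      unfolding F_def shift(2) by (subst frobenius_linear [OF adms shift(1) X(2)]) simp
    finally show ?thesis unfolding lin by simp
  qed
  have m: "of_nat ((m + p + 1) * (m + q + 1)) * sol1 \<mu> p q (Suc m) z =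
      dF / X - (dF - of_nat (m + p + q + 1) * F ?g)"
  proof -
    have adm0: "admissible c (\<lambda>s. s * ?g s)" by (rule admissible_mult_id [OF adm])
    note shift = frobenius_divide_x [OF adm0 X(1)]
    let ?h = "\<lambda>s. (s + - of_nat (m + p + q + 1)) * ?g s"
    have ext: "admissible (c - 1) ?h" "frobenius (c - 1) ?h L X = frobenius c ?h L X" for L
      using admissible_extend [OF below'] adms
        frobenius_extend [OF _ below' X, of "- of_nat (m + p + q + 1)" L]
      by (simp_all only: diff_add_cancel)
    have c: "- int (Suc m) = c - 1" by (simp add: c_def)
    have "of_nat ((m + p + 1) * (m + q + 1)) * sol1 \<mu> p q (Suc m) z =
        frobenius (c - 1) (\<lambda>s. of_nat ((m + p + 1) * (m + q + 1)) * coeff1 p q (Suc m) s) (Ln (1 - z) + \<mu>) X"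
      unfolding sol1_def c [symmetric] X_def
      by (rule frobenius_cmult [symmetric, OF admissible_coeff1]) (use lensD [OF z] in simp)
    also have "\<dots> = frobenius (c - 1) (\<lambda>s. 1 * ((s + 1) * ?g (s + 1)) + (- 1) * ?h s) (Ln (1 - z) + \<mu>) X"
      unfolding coeff1_Suc_m add_uminus_conv_diff by simp
    also have "\<dots> = dF / X - F ?h"
      unfolding dF_def F_def shift(2) by (subst frobenius_linear [OF shift(1) ext(1) X(2)]) (unfold ext(2), simp)
    finally show ?thesis
      unfolding lin by (simp only: mult_minus_left add_uminus_conv_diff)
  qed
  have sol: "sol1 \<mu> p q m z = F ?g" by (simp add: sol1_def F_def X_def c_def)
  have N: "of_nat (m + p + q + 1) = (of_nat (m + p + 1) + of_nat q :: complex)" by simp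
  have zD: "z * (1 - z) * (- 1 / X * dF) = - z * dF" and zD': "z * (- 1 / X * dF) = dF - dF / X"
    using X by (simp_all add: z_X field_simps)
  show "\<exists>V'. (sol1 \<mu> p q m has_field_derivative V') (at z) \<and>
     z * (1 - z) * V' - (of_nat (m + p + q + 1) - of_nat q * z) * sol1 \<mu> p q m z =
       - of_nat ((p + 1) * (m + p + 1)) * sol1 \<mu> (Suc p) q m z \<and>
     z * V' - of_nat (m + p + q + 1) * sol1 \<mu> p q m z =
       - of_nat ((m + p + 1) * (m + q + 1)) * sol1 \<mu> p q (Suc m) z"
  proof (intro exI conjI)
    show "(sol1 \<mu> p q m has_field_derivative - 1 / X * dF) (at z)" by (rule D)
    show "z * (1 - z) * (- 1 / X * dF) - (of_nat (m + p + q + 1) - of_nat q * z) * sol1 \<mu> p q m z =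
       - of_nat ((p + 1) * (m + p + 1)) * sol1 \<mu> (Suc p) q m z"
      unfolding mult_minus_left p sol zD N using z_X by algebra
    show "z * (- 1 / X * dF) - of_nat (m + p + q + 1) * sol1 \<mu> p q m z =
       - of_nat ((m + p + 1) * (m + q + 1)) * sol1 \<mu> p q (Suc m) z"
      unfolding mult_minus_left m sol zD' N by algebra
  qed
qed

text \<open>
  The prefactor \<open>z\<^sup>N\<close>, where \<open>N = m + p + q + 1\<close> is the larger exponent at \<open>0\<close>, reduces the operators to
  \<open>x d/dx + m + p + 1\<close> and \<open>d/dx\<close>, up to sign and a power of \<open>z\<close>.
\<close>

lemma ladder_sol2: "ladder lens (sol2 \<mu>)"
proof (rule ladder_symmetricI)
  show "sol2 \<mu> p q m z = sol2 \<mu> q p m z" for p q m z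
  proof -
    have "coeff2 p q m = coeff2 q p m" by (simp add: coeff2_def fun_eq_iff mult_ac)
    then show ?thesis by (simp add: sol2_def ac_simps)
  qed
next
  fix p q m z assume z: "z \<in> lens"
  define X where "X = 1 - z"
  define c where "c = - int m"
  define F where "F g = frobenius c g (Ln (1 - z) + \<mu>) X" for g
  define N where "N = m + p + q + 1"
  define K :: complex where "K = 1 / (fact p * fact q * fact (m + p) * fact (m + q))"
  let ?g = "coeff2 p q m"
  have X: "X \<noteq> 0" "norm X < 1" and z_X: "z = 1 - X" and "z \<noteq> 0"
    using lensD [OF z] by (auto simp: X_def)
  have adm: "admissible c ?g" by (simp add: admissible_coeff2 c_def)
  define dF where "dF = F (\<lambda>s. s * ?g s)"
  have sol: "sol2 \<mu> p q m z = K * z ^ N * F ?g"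
    by (simp add: sol2_def F_def X_def c_def N_def K_def)
  have "((\<lambda>z. frobenius c ?g (Ln (1 - z) + \<mu>) (1 - z)) has_field_derivative - 1 / X * dF) (at z)"
    unfolding dF_def F_def X_def
    by (rule frobenius_has_derivative [OF adm])
      (use lensD [OF z] in \<open>auto intro!: derivative_eq_intros simp: divide_simps\<close>)
  then have D: "((\<lambda>z. K * z ^ N * frobenius c ?g (Ln (1 - z) + \<mu>) (1 - z)) has_field_derivative
      K * (of_nat N * z ^ (N - 1)) * F ?g + - 1 / X * dF * (K * z ^ N)) (at z)"
    unfolding F_def X_def by (intro DERIV_mult) (auto intro!: derivative_eq_intros)
  have p: "of_nat ((p + 1) * (m + p + 1)) * sol2 \<mu> (Suc p) q m z =
      K * z ^ N * z * (dF + of_nat (m + p + 1) * F ?g)"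
  proof -
    have "frobenius (- int m) (coeff2 (Suc p) q m) (Ln (1 - z) + \<mu>) (1 - z) = dF + of_nat (m + p + 1) * F ?g"
      using frobenius_linear_factor [OF adm X(2)]
      unfolding dF_def F_def c_def coeff2_Suc_p X_def by blast
    moreover have "of_nat ((p + 1) * (m + p + 1)) * (1 / (fact (Suc p) * fact q * fact (m + Suc p) * fact (m + q))) = K"
      by (simp add: K_def field_simps del: of_nat_Suc of_nat_add) (simp add: algebra_simps)
    moreover have "of_nat ((p + 1) * (m + p + 1)) * sol2 \<mu> (Suc p) q m z = (of_nat ((p + 1) * (m + p + 1)) * (1 / (fact (Suc p) * fact q * fact (m + Suc p) * fact (m + q)))) *
        z ^ (m + Suc p + q + 1) * frobenius (- int (m)) (coeff2 (Suc p) q m) (Ln (1 - z) + \<mu>) (1 - z)"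
      unfolding sol2_def by (simp only: divide_inverse mult_1_left mult_ac)
    moreover have "z ^ (m + Suc p + q + 1) = z ^ N * z" by (simp add: N_def)
    ultimately show ?thesis by (simp only: mult_ac)
  qed
  have m: "of_nat ((m + p + 1) * (m + q + 1)) * sol2 \<mu> p q (Suc m) z = K * z ^ N * z * (dF / X)"
  proof -
    have c: "- int (Suc m) = c - 1" by (simp add: c_def)
    have "frobenius (- int (Suc m)) (coeff2 p q (Suc m)) (Ln (1 - z) + \<mu>) (1 - z) = dF / X"
      unfolding c dF_def F_def frobenius_divide_x(2) [OF admissible_mult_id [OF adm] X(1)]
      by (simp add: coeff2_Suc_m [abs_def] X_def)
    moreover have "of_nat ((m + p + 1) * (m + q + 1)) *
        (1 / (fact p * fact q * fact (Suc m + p) * fact (Suc m + q))) = K"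
      by (simp add: K_def field_simps del: of_nat_Suc of_nat_add) (simp add: algebra_simps)
    moreover have "of_nat ((m + p + 1) * (m + q + 1)) * sol2 \<mu> p q (Suc m) z = (of_nat ((m + p + 1) * (m + q + 1)) * (1 / (fact p * fact q * fact (Suc m + p) * fact (Suc m + q)))) *
        z ^ (Suc m + p + q + 1) * frobenius (- int ((Suc m))) (coeff2 p q (Suc m)) (Ln (1 - z) + \<mu>) (1 - z)"
      unfolding sol2_def by (simp only: divide_inverse mult_1_left mult_ac)
    moreover have "z ^ (Suc m + p + q + 1) = z ^ N * z" by (simp add: N_def)
    ultimately show ?thesis by (simp only: mult_ac)
  qed
  define e where "e = dF / X"
  define Z where "Z = z ^ N"
  define V' where "V' = K * (of_nat N * z ^ (N - 1)) * F ?g + - 1 / X * dF * (K * z ^ N)"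
  have N: "of_nat (m + p + q + 1) = (of_nat (m + p + 1) + of_nat q :: complex)" by simp
  have "z ^ N = z * z ^ (N - 1)" by (simp add: N_def)
  then have "z * V' = K * z ^ N * (of_nat N * F ?g - z * (dF / X))"
    by (simp add: V'_def algebra_simps)
  then have zV': "z * V' = K * Z * ((of_nat (m + p + 1) + of_nat q) * F ?g - z * e)"
    unfolding N_def N Z_def e_def .
  have Xe: "(1 - z) * e = dF" using X by (simp add: e_def X_def)
  show "\<exists>V'. (sol2 \<mu> p q m has_field_derivative V') (at z) \<and>
     z * (1 - z) * V' - (of_nat (m + p + q + 1) - of_nat q * z) * sol2 \<mu> p q m z =
       - of_nat ((p + 1) * (m + p + 1)) * sol2 \<mu> (Suc p) q m z \<and>
     z * V' - of_nat (m + p + q + 1) * sol2 \<mu> p q m z =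
       - of_nat ((m + p + 1) * (m + q + 1)) * sol2 \<mu> p q (Suc m) z"
  proof (intro exI conjI)
    show "(sol2 \<mu> p q m has_field_derivative V') (at z)"
      using D by (simp add: sol2_def [abs_def] K_def N_def c_def V'_def mult_ac)
    show "z * (1 - z) * V' - (of_nat (m + p + q + 1) - of_nat q * z) * sol2 \<mu> p q m z =
       - of_nat ((p + 1) * (m + p + 1)) * sol2 \<mu> (Suc p) q m z"
      unfolding mult_minus_left p sol N Z_def [symmetric] using zV' Xe by algebra
    show "z * V' - of_nat (m + p + q + 1) * sol2 \<mu> p q m z =
       - of_nat ((m + p + 1) * (m + q + 1)) * sol2 \<mu> p q (Suc m) z"
      unfolding mult_minus_left m sol zV' N Z_def [symmetric] e_def [symmetric] by algebra
  qed
qed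

lemma pochhammer_zero: "pochhammer (- of_nat (Suc m) + of_nat m + 1 :: complex) (Suc r) = 0"
  by (simp add: pochhammer_rec)

text \<open>
  The factor \<open>s + m + p + 1\<close> that distinguishes \<open>coeff3 (Suc p)\<close> from \<open>coeff3 p\<close> is essential: for
  \<open>p = 0\<close> the function \<open>coeff3 p\<close> itself has only a simple zero at \<open>-m - 1\<close>.
\<close>

lemma coeff3_below:
  "coeff3 (Suc p) q m (- of_nat (Suc m)) = 0" "deriv (coeff3 (Suc p) q m) (- of_nat (Suc m)) = 0"
proof -
  have "rfact 0 (- of_nat (Suc m)) = 0" by (rule rfact_neg_zero) simp
  then show "deriv (coeff3 (Suc p) q m) (- of_nat (Suc m)) = 0"
    unfolding coeff3_def [abs_def]
    by (intro deriv_double_zero holomorphic_intros pochhammer_zero) simp_all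
  show "coeff3 (Suc p) q m (- of_nat (Suc m)) = 0"
    unfolding coeff3_def pochhammer_zero by simp
qed

text \<open>
  The variable is \<open>x = (1 - z) / z\<close>, so that \<open>1 / z = 1 + x\<close>.  This family is not symmetric in \<open>p\<close> and
  \<open>q\<close>, and the relations for both have to be verified.
\<close>

lemma ladder_sol3: "ladder lens (sol3 \<mu>)"
  unfolding ladder_def
proof (intro allI ballI)
  fix p q m z assume z: "z \<in> lens"
  define X where "X = (1 - z) / z"
  define c where "c = - int m"
  define F where "F g = frobenius c g (Ln ((1 - z) / z) + \<mu>) X" for g
  define N where "N = m + p + q + 1"
  define K :: complex where "K = 1 / (fact p * fact (m + p))"
  let ?g = "coeff3 p q m"
  let ?h = "\<lambda>s. (s + of_nat (m + p + 1)) * ?g s"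
  have X: "X \<noteq> 0" "norm X < 1" and z0: "z \<noteq> 0" "1 - z \<noteq> 0"
    using lensD [OF z] by (auto simp: X_def)
  have zX: "z * X = 1 - z" using z0 by (simp add: X_def)
  have adm: "admissible c ?g" by (simp add: admissible_coeff3 c_def)
  have adm_h: "admissible c ?h" by (rule admissible_linear_factor [OF adm])
  define dF where "dF = F (\<lambda>s. s * ?g s)"
  have lin: "F (\<lambda>s. (s + \<alpha>) * ?g s) = dF + \<alpha> * F ?g" for \<alpha>
    unfolding F_def dF_def by (rule frobenius_linear_factor [OF adm X(2)])
  have below: "?h (of_int (c - 1)) = 0" "deriv ?h (of_int (c - 1)) = 0"
    using coeff3_below [of p q m]
    by (simp_all only: c_def of_int_below coeff3_Suc_p [abs_def])
  have sol: "sol3 \<mu> p q m z = K * z ^ q * F ?g"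
    by (simp add: sol3_def F_def X_def c_def K_def)
  have dX: "((\<lambda>z. (1 - z) / z) has_field_derivative - 1 / (z * z)) (at z)"
    using z0 by (auto intro!: derivative_eq_intros simp: field_simps)
  have dL: "((\<lambda>z. Ln ((1 - z) / z) + \<mu>) has_field_derivative (- 1 / (z * z)) / ((1 - z) / z)) (at z)"
    by (rule DERIV_cong [OF DERIV_add [OF DERIV_chain2 [OF has_field_derivative_Ln dX] DERIV_const]])
      (use lensD [OF z] in \<open>auto simp: field_simps\<close>)
  have "((\<lambda>z. frobenius c ?g (Ln ((1 - z) / z) + \<mu>) ((1 - z) / z)) has_field_derivative
      (- 1 / (z * z)) / ((1 - z) / z) * dF) (at z)"
    unfolding dF_def F_def X_def
    by (rule frobenius_has_derivative [OF adm dX dL]) (use lensD [OF z] in auto)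
  then have D: "((\<lambda>z. K * z ^ q * frobenius c ?g (Ln ((1 - z) / z) + \<mu>) ((1 - z) / z)) has_field_derivative
      K * (of_nat q * z ^ (q - 1)) * F ?g + (- 1 / (z * z)) / ((1 - z) / z) * dF * (K * z ^ q)) (at z)"
    unfolding F_def X_def by (intro DERIV_mult) (auto intro!: derivative_eq_intros)
  have p: "of_nat ((p + 1) * (m + p + 1)) * sol3 \<mu> (Suc p) q m z =
      K * z ^ q * (dF + of_nat (m + p + 1) * F ?g)"
  proof -
    have "frobenius (- int m) (coeff3 (Suc p) q m) (Ln ((1 - z) / z) + \<mu>) ((1 - z) / z) =
        dF + of_nat (m + p + 1) * F ?g"
      using lin unfolding F_def c_def X_def coeff3_Suc_p by blast
    moreover have "of_nat ((p + 1) * (m + p + 1)) * (1 / (fact (Suc p) * fact (m + Suc p))) = K"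
      by (simp add: K_def field_simps del: of_nat_Suc of_nat_add) (simp add: algebra_simps)
    moreover have "of_nat ((p + 1) * (m + p + 1)) * sol3 \<mu> (Suc p) q m z =
        (of_nat ((p + 1) * (m + p + 1)) * (1 / (fact (Suc p) * fact (m + Suc p)))) * z ^ q *
        frobenius (- int m) (coeff3 (Suc p) q m) (Ln ((1 - z) / z) + \<mu>) ((1 - z) / z)"
      unfolding sol3_def by (simp only: divide_inverse mult_1_left mult_ac)
    ultimately show ?thesis by (simp only: mult_ac)
  qed
  have q: "of_nat ((q + 1) * (m + q + 1)) * sol3 \<mu> p (Suc q) m z =
      K * z ^ q * z * ((dF + of_nat (m + q + 1) * F ?g) + X * (dF + of_nat (m + p + 1) * F ?g))"
  proof -
    note shift = frobenius_times_x [OF adm_h X below]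
    have "of_nat ((q + 1) * (m + q + 1)) * F (coeff3 p (Suc q) m) =
        F (\<lambda>s. of_nat ((q + 1) * (m + q + 1)) * coeff3 p (Suc q) m s)"
      unfolding F_def c_def by (rule frobenius_cmult [symmetric, OF admissible_coeff3 X(2)])
    also have "\<dots> = F (\<lambda>s. 1 * ((s + of_nat (m + q + 1)) * ?g s) + 1 * ((s - 1 + of_nat (m + p + 1)) * ?g (s - 1)))"
      unfolding coeff3_Suc_q by (simp del: of_nat_add)
    also have "\<dots> = F (\<lambda>s. (s + of_nat (m + q + 1)) * ?g s) + X * F ?h"
      unfolding F_def shift(2)
      by (subst frobenius_linear [OF admissible_linear_factor [OF adm] shift(1) X(2)]) (simp del: of_nat_add)
    finally show ?thesis
      unfolding lin by (simp add: sol3_def K_def F_def c_def X_def mult_ac)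
  qed
  have m: "of_nat ((m + p + 1) * (m + q + 1)) * sol3 \<mu> p q (Suc m) z =
      K * z ^ q * ((dF + of_nat (m + p + 1) * F ?g) + dF / X)"
  proof -
    note shift = frobenius_divide_x [OF admissible_mult_id [OF adm] X(1)]
    have ext: "admissible (c - 1) ?h" "frobenius (c - 1) ?h L X = frobenius c ?h L X" for L
      using admissible_extend [OF below] adm_h frobenius_extend [OF _ below X, of L]
      by (simp_all only: diff_add_cancel)
    have c: "- int (Suc m) = c - 1" by (simp add: c_def)
    let ?L = "Ln ((1 - z) / z) + \<mu>"
    have "of_nat (m + q + 1) * frobenius (c - 1) (coeff3 p q (Suc m)) ?L X =
        frobenius (c - 1) (\<lambda>s. of_nat (m + q + 1) * coeff3 p q (Suc m) s) ?L X"
      unfolding c [symmetric] by (rule frobenius_cmult [symmetric, OF admissible_coeff3 X(2)])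
    also have "\<dots> = frobenius (c - 1) (\<lambda>s. 1 * ?h s + 1 * ((s + 1) * ?g (s + 1))) ?L X"
      unfolding coeff3_Suc_m by (simp del: of_nat_add)
    also have "\<dots> = F ?h + dF / X"
      unfolding dF_def F_def shift(2) by (subst frobenius_linear [OF ext(1) shift(1) X(2)]) (unfold ext(2), simp del: of_nat_add)
    finally have *: "of_nat (m + q + 1) * frobenius (c - 1) (coeff3 p q (Suc m)) ?L X =
        (dF + of_nat (m + p + 1) * F ?g) + dF / X" unfolding lin .
    have K: "of_nat (m + p + 1) * (1 / (fact p * fact (Suc m + p))) = K"
      by (simp add: K_def field_simps del: of_nat_Suc of_nat_add)
    have "of_nat ((m + p + 1) * (m + q + 1)) * sol3 \<mu> p q (Suc m) z =
        (of_nat (m + p + 1) * (1 / (fact p * fact (Suc m + p)))) * z ^ q *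
        (of_nat (m + q + 1) * frobenius (c - 1) (coeff3 p q (Suc m)) ?L X)"
      unfolding sol3_def c X_def of_nat_mult by (simp only: divide_inverse mult_1_left mult_ac)
    then show ?thesis unfolding * K .
  qed
  define e where "e = dF / X"
  define Z where "Z = z ^ q"
  define V' where "V' = K * (of_nat q * z ^ (q - 1)) * F ?g + (- 1 / (z * z)) / ((1 - z) / z) * dF * (K * z ^ q)"
  have Xe: "(1 - z) * e = z * dF" using z0 by (simp add: e_def X_def field_simps)
  have zV: "z * (1 - z) * V' = K * Z * (of_nat q * (1 - z) * F ?g - dF)"
  proof -
    have "of_nat q * z ^ (q - 1) * z = of_nat q * z ^ q" by (cases q) auto
    moreover have "z * (1 - z) * ((- 1 / (z * z)) / ((1 - z) / z)) = - 1"
      using z0 by (simp add: field_simps)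
    moreover have "z * (1 - z) * (K * (n * w) * f + e * d * (K * u)) = K * u * (n * (1 - z) * f - d)"
      if "n * w * z = n * u" "z * (1 - z) * e = - 1" for n w u e f d
      using that by algebra
    ultimately show ?thesis unfolding V'_def Z_def by blast
  qed
  have zV': "z * V' = K * Z * (of_nat q * F ?g - dF - e)"
  proof -
    have "(1 - z) * (z * V') = (1 - z) * (K * Z * (of_nat q * F ?g - dF - e))"
      using zV Xe by algebra
    then show ?thesis using z0 by simp
  qed
  have N: "of_nat (m + p + q + 1) = (of_nat m + of_nat p + of_nat q + 1 :: complex)"
    "of_nat (m + p + 1) = (of_nat m + of_nat p + 1 :: complex)"
    "of_nat (m + q + 1) = (of_nat m + of_nat q + 1 :: complex)" by simp_all
  show "\<exists>V'. (sol3 \<mu> p q m has_field_derivative V') (at z) \<and>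
     z * (1 - z) * V' - (of_nat (m + p + q + 1) - of_nat q * z) * sol3 \<mu> p q m z =
       - of_nat ((p + 1) * (m + p + 1)) * sol3 \<mu> (Suc p) q m z \<and>
     z * (1 - z) * V' - (of_nat (m + p + q + 1) - of_nat p * z) * sol3 \<mu> p q m z =
       - of_nat ((q + 1) * (m + q + 1)) * sol3 \<mu> p (Suc q) m z \<and>
     z * V' - of_nat (m + p + q + 1) * sol3 \<mu> p q m z =
       - of_nat ((m + p + 1) * (m + q + 1)) * sol3 \<mu> p q (Suc m) z"
  proof (intro exI conjI)
    show "(sol3 \<mu> p q m has_field_derivative V') (at z)"
      using D by (simp add: sol3_def [abs_def] K_def c_def V'_def mult_ac)
    show "z * (1 - z) * V' - (of_nat (m + p + q + 1) - of_nat q * z) * sol3 \<mu> p q m z =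
       - of_nat ((p + 1) * (m + p + 1)) * sol3 \<mu> (Suc p) q m z"
      unfolding mult_minus_left p sol zV N Z_def [symmetric] by algebra
    show "z * (1 - z) * V' - (of_nat (m + p + q + 1) - of_nat p * z) * sol3 \<mu> p q m z =
       - of_nat ((q + 1) * (m + q + 1)) * sol3 \<mu> p (Suc q) m z"
      unfolding mult_minus_left q sol zV N Z_def [symmetric] using zX by algebra
    show "z * V' - of_nat (m + p + q + 1) * sol3 \<mu> p q m z =
       - of_nat ((m + p + 1) * (m + q + 1)) * sol3 \<mu> p q (Suc m) z"
      unfolding mult_minus_left m sol zV' N Z_def [symmetric] e_def [symmetric] by algebra
  qed
qed

section \<open>The expansion at 0\<close>

text \<open>
  The expansion at \<open>0\<close> that starts at the larger exponent \<open>m + p + q + 1\<close>.  For \<open>p = n + l\<close> and \<open>q = l\<close> it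
  is, up to sign, the defining series of \<open>U3\<close>; the sign is supplied in \<open>sol0\<close>.
\<close>

definition coeff0 :: "nat \<Rightarrow> nat \<Rightarrow> nat \<Rightarrow> nat \<Rightarrow> complex" where
  "coeff0 p q m j = pochhammer (of_nat (m + p + 1)) j * pochhammer (of_nat (m + q + 1)) j /
     (fact (m + p + q + 1 + j) * fact j)"

definition sol0 :: "nat \<Rightarrow> nat \<Rightarrow> nat \<Rightarrow> complex \<Rightarrow> complex" where
  "sol0 p q m z = (- 1) ^ (m + 1) * z ^ (m + p + q + 1) * powser (coeff0 p q m) z"

lemma coeff0_Suc:
  "of_nat (Suc j) * coeff0 p q m (Suc j) =
   of_nat (m + p + 1 + j) * of_nat (m + q + 1 + j) / of_nat (m + p + q + 2 + j) * coeff0 p q m j"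
proof -
  have f: "fact (m + p + q + 1 + Suc j) = of_nat (m + p + q + 2 + j) * (fact (m + p + q + 1 + j) :: complex)"
    using fact_Suc [of "m + p + q + 1 + j", where ?'a = complex] by (simp only: add_Suc_right) simp
  show ?thesis
    unfolding coeff0_def f fact_Suc [of j] pochhammer_Suc of_nat_add [symmetric]
    by (simp add: field_simps del: of_nat_Suc of_nat_add)
qed

lemma coeff0_Suc_p:
  "of_nat (m + p + 1) * coeff0 (Suc p) q m j =
   of_nat (m + p + 1 + j) / of_nat (m + p + q + 2 + j) * coeff0 p q m j"
proof -
  have f: "fact (m + Suc p + q + 1 + j) = of_nat (m + p + q + 2 + j) * (fact (m + p + q + 1 + j) :: complex)"
    using fact_Suc [of "m + p + q + 1 + j", where ?'a = complex] by (simp add: algebra_simps)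
  have "of_nat (m + p + 1) * pochhammer (of_nat (m + p + 1) + 1) j =
      (of_nat (m + p + 1) + of_nat j) * (pochhammer (of_nat (m + p + 1)) j :: complex)"
    by (rule pochhammer_shift [symmetric])
  moreover have "of_nat (m + Suc p + 1) = (of_nat (m + p + 1) + 1 :: complex)"
    "of_nat (m + p + 1 + j) = (of_nat (m + p + 1) + of_nat j :: complex)" by simp_all
  ultimately have "of_nat (m + p + 1) * pochhammer (of_nat (m + Suc p + 1)) j =
      (of_nat (m + p + 1 + j) * pochhammer (of_nat (m + p + 1)) j :: complex)" by metis
  then show ?thesis
    unfolding coeff0_def f by (simp add: field_simps del: of_nat_Suc of_nat_add)
qed

lemma coeff0_Suc_m:
  "of_nat ((m + p + 1) * (m + q + 1)) * coeff0 p q (Suc m) j =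
   of_nat (Suc j) * coeff0 p q m (Suc j)"
proof -
  have P: "pochhammer (of_nat (m + r + 1)) (Suc j) =
      (of_nat (m + r + 1) * pochhammer (of_nat (Suc m + r + 1)) j :: complex)" for r
    unfolding pochhammer_rec by (simp add: algebra_simps)
  have "fact (Suc m + p + q + 1 + j) = (fact (m + p + q + 1 + Suc j) :: complex)" by simp
  then show ?thesis
    unfolding coeff0_def fact_Suc [of j] P of_nat_mult
    by (simp only:) (simp add: divide_simps del: of_nat_Suc of_nat_add fact_Suc)
qed

lemma coeff0_diagonal:
  "coeff0 (Suc p) (Suc q) m j = coeff0 p q (Suc m) j / of_nat (m + p + q + 3 + j)"
proof -
  have f: "fact (m + Suc p + Suc q + 1 + j) = of_nat (m + p + q + 3 + j) * (fact (Suc m + p + q + 1 + j) :: complex)"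
    using fact_Suc [of "m + p + q + 2 + j", where ?'a = complex] by (simp add: algebra_simps)
  show ?thesis
    unfolding coeff0_def f by (simp add: field_simps del: of_nat_Suc of_nat_add)
qed

lemma disc_summable_coeff0: "disc_summable (coeff0 p q m)"
proof -
  have "pochhammer (m + r + 1) j \<noteq> 0" for r j
    using pochhammer_pos [of "m + r + 1" j] by simp
  then have nz: "coeff0 p q m j \<noteq> 0" for j
    unfolding coeff0_def pochhammer_of_nat by (simp del: of_nat_add of_nat_Suc)
  have "norm (coeff0 p q m j) / norm (coeff0 p q m (Suc j)) =
      (real j + 1) * (real j + real (m + p + q + 2)) / ((real j + real (m + p + 1)) * (real j + real (m + q + 1)))" for j
  proof -
    have "norm (of_nat (Suc j) * coeff0 p q m (Suc j)) =
        norm (of_nat (m + p + 1 + j) * of_nat (m + q + 1 + j) / of_nat (m + p + q + 2 + j) * coeff0 p q m j)"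
      by (simp only: coeff0_Suc)
    then have eq: "real (Suc j) * norm (coeff0 p q m (Suc j)) =
        real (m + p + 1 + j) * real (m + q + 1 + j) / real (m + p + q + 2 + j) * norm (coeff0 p q m j)"
      by (simp only: norm_mult norm_divide norm_of_nat)
    have ratio: "x / y = A * d / (b * c)"
      if "A * y = b * c / d * x" "y \<noteq> 0" "b > 0" "c > 0" "d > 0" for A b c d x y :: real
      using that by (simp add: field_simps)
    have "norm (coeff0 p q m j) / norm (coeff0 p q m (Suc j)) =
        real (Suc j) * real (m + p + q + 2 + j) / (real (m + p + 1 + j) * real (m + q + 1 + j))"
      by (rule ratio [OF eq]) (use nz [of "Suc j"] in simp_all)
    then show ?thesis by (simp add: add_ac)
  qed
  moreover have "(\<lambda>j. (real j + 1) * (real j + real (m + p + q + 2)) /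
      ((real j + real (m + p + 1)) * (real j + real (m + q + 1)))) \<longlonglongrightarrow> 1"
    by real_asymp
  ultimately have "conv_radius (coeff0 p q m) = 1"
    by (intro conv_radius_ratio_limit_nonzero [of _ 1]) (simp_all add: one_ereal_def)
  then show ?thesis
    unfolding disc_summable_def by (intro allI impI summable_in_conv_radius) (simp add: one_ereal_def)
qed

text \<open>
  Up to a power of \<open>z\<close>, the left side is the effect of a raising operator on \<open>z\<^sup>N\<close> times the power series
  of \<open>a\<close>, where \<open>\<alpha>\<close> depends on the operator.
\<close>

lemma powser_combine:
  assumes "disc_summable a" "norm z < 1"
  shows "(1 - z) * powser (\<lambda>j. of_nat (Suc j) * a (Suc j)) z - \<alpha> * powser a z =
     powser (\<lambda>j. of_nat (Suc j) * a (Suc j) - (of_nat j + \<alpha>) * a j) z"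
proof -
  let ?d = "\<lambda>j. of_nat (Suc j) * a (Suc j)" and ?i = "\<lambda>j. of_nat j * a j"
  have i: "disc_summable ?i" by (rule disc_summable_index [OF assms(1)])
  have d: "disc_summable ?d" using i disc_summable_Suc [of ?i] by blast
  have "powser (\<lambda>j. 1 * ?d j + (- 1) * (1 * ?i j + \<alpha> * a j)) z =
      powser ?d z - (powser ?i z + \<alpha> * powser a z)"
    using powser_linear [OF d disc_summable_linear [OF i assms(1)] assms(2), of 1 "-1" 1 \<alpha>]
      powser_linear [OF i assms, of 1 \<alpha>] by simp
  moreover have "powser ?i z = z * powser ?d z" by (rule powser_index [OF assms])
  moreover have "(\<lambda>j. 1 * ?d j + (- 1) * (1 * ?i j + \<alpha> * a j)) = (\<lambda>j. ?d j - (of_nat j + \<alpha>) * a j)"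
    by (simp add: fun_eq_iff algebra_simps)
  ultimately show ?thesis by (simp only: left_diff_distrib mult_1 diff_diff_add)
qed

lemma powser_cmult:
  assumes "disc_summable a" "norm z < 1"
  shows "powser (\<lambda>j. \<alpha> * a j) z = \<alpha> * powser a z"
  using powser_linear [OF assms(1,1,2), of \<alpha> 0] by simp

lemma coeff0_powser_step:
  assumes "norm z < 1"
  obtains H' where "(powser (coeff0 p q m) has_field_derivative H') (at z)"
    "(1 - z) * H' - of_nat (m + p + 1) * powser (coeff0 p q m) z =
       - of_nat ((p + 1) * (m + p + 1)) * powser (coeff0 (Suc p) q m) z"
    "H' = of_nat ((m + p + 1) * (m + q + 1)) * powser (coeff0 p q (Suc m)) z"
    "m = Suc k \<Longrightarrow> (1 - z) * H' - of_nat m * powser (coeff0 p q m) z =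
       of_nat ((p + 1) * (q + 1)) * powser (coeff0 (Suc p) (Suc q) k) z"
proof -
  let ?a = "coeff0 p q m"
  let ?H' = "powser (\<lambda>j. of_nat (Suc j) * ?a (Suc j)) z"
  note a = disc_summable_coeff0
  have 1: "(powser ?a has_field_derivative ?H') (at z)"
    by (rule powser_has_derivative [OF a assms])
  have 2: "(1 - z) * ?H' - of_nat (m + p + 1) * powser ?a z =
       - of_nat ((p + 1) * (m + p + 1)) * powser (coeff0 (Suc p) q m) z"
  proof -
    have "of_nat (Suc j) * ?a (Suc j) - (of_nat j + of_nat (m + p + 1)) * ?a j =
        - of_nat ((p + 1) * (m + p + 1)) * coeff0 (Suc p) q m j" for j
    proof -
      have s: "of_nat (m + p + 1) * coeff0 (Suc p) q m j * of_nat (m + p + q + 2 + j) =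
          of_nat (m + p + 1 + j) * ?a j"
        unfolding coeff0_Suc_p by (simp del: of_nat_add of_nat_Suc)
      have t: "of_nat (Suc j) * ?a (Suc j) = of_nat (m + q + 1 + j) * (of_nat (m + p + 1) * coeff0 (Suc p) q m j)"
        unfolding coeff0_Suc_p coeff0_Suc by simp
      show ?thesis unfolding t using s by (simp add: algebra_simps)
    qed
    then show ?thesis
      unfolding powser_combine [OF a assms] by (simp only: powser_cmult [OF a assms])
  qed
  have 3: "?H' = of_nat ((m + p + 1) * (m + q + 1)) * powser (coeff0 p q (Suc m)) z"
    unfolding coeff0_Suc_m [symmetric] by (rule powser_cmult [OF a assms])
  have 4: "(1 - z) * ?H' - of_nat m * powser ?a z =
       of_nat ((p + 1) * (q + 1)) * powser (coeff0 (Suc p) (Suc q) k) z" if m: "m = Suc k"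
  proof -
    have "of_nat (Suc j) * ?a (Suc j) - (of_nat j + of_nat m) * ?a j =
        of_nat ((p + 1) * (q + 1)) * coeff0 (Suc p) (Suc q) k j" for j
    proof -
      define b where "b = coeff0 (Suc p) (Suc q) k j"
      have s: "?a j = of_nat (m + p + q + 2 + j) * b"
      proof -
        have "m + p + q + 2 + j = k + p + q + 3 + j" using m by simp
        then show ?thesis
          unfolding b_def coeff0_diagonal m by (simp only:) (simp del: of_nat_add of_nat_Suc)
      qed
      have "of_nat (Suc j) * ?a (Suc j) = of_nat (m + p + 1 + j) * of_nat (m + q + 1 + j) * b"
        unfolding coeff0_Suc s by (simp del: of_nat_add of_nat_Suc)
      then show ?thesis
        unfolding s b_def [symmetric] by (simp add: algebra_simps)
    qed
    then show ?thesis
      unfolding powser_combine [OF a assms] by (simp only: powser_cmult [OF a assms])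
  qed
  show thesis by (rule that [OF 1 2 3 4])
qed

text \<open>
  The last relation raises \<open>p\<close> and \<open>q\<close> and lowers \<open>m\<close>.  Under \<open>z \<mapsto> z / (z - 1)\<close> it corresponds to the
  relation that raises \<open>q\<close> alone.
\<close>

lemma sol0_derivative:
  assumes "norm z < 1"
  obtains V' where "(sol0 p q m has_field_derivative V') (at z)"
    "z * (1 - z) * V' - (of_nat (m + p + q + 1) - of_nat q * z) * sol0 p q m z =
       - of_nat ((p + 1) * (m + p + 1)) * sol0 (Suc p) q m z"
    "z * V' - of_nat (m + p + q + 1) * sol0 p q m z =
       - of_nat ((m + p + 1) * (m + q + 1)) * sol0 p q (Suc m) z"
    "m = Suc k \<Longrightarrow> z * (1 - z) * V' - (of_nat (m + p + q + 1) - of_nat (p + q + 1) * z) * sol0 p q m z =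
       - of_nat ((p + 1) * (q + 1)) * sol0 (Suc p) (Suc q) k z"
proof -
  define N where "N = m + p + q + 1"
  define S :: complex where "S = (- 1) ^ (m + 1)"
  define H where "H = powser (coeff0 p q m) z"
  define Z where "Z = z ^ N"
  obtain H' where H': "(powser (coeff0 p q m) has_field_derivative H') (at z)"
    and p: "(1 - z) * H' - of_nat (m + p + 1) * H =
       - of_nat ((p + 1) * (m + p + 1)) * powser (coeff0 (Suc p) q m) z"
    and m: "H' = of_nat ((m + p + 1) * (m + q + 1)) * powser (coeff0 p q (Suc m)) z"
    and d: "m = Suc k \<Longrightarrow> (1 - z) * H' - of_nat m * H =
       of_nat ((p + 1) * (q + 1)) * powser (coeff0 (Suc p) (Suc q) k) z"
    using coeff0_powser_step [OF assms, of p q m k] unfolding H_def by metis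
  define V' where "V' = S * (of_nat N * z ^ (N - 1)) * H + H' * (S * z ^ N)"
  have V: "sol0 p q m z = S * Z * H" by (simp add: sol0_def S_def Z_def H_def N_def)
  have "((\<lambda>z. S * z ^ N * powser (coeff0 p q m) z) has_field_derivative V') (at z)"
    unfolding V'_def H_def by (intro DERIV_mult H') (auto intro!: derivative_eq_intros)
  then have 1: "(sol0 p q m has_field_derivative V') (at z)"
    by (simp add: sol0_def [abs_def] S_def N_def)
  have N: "of_nat (m + p + q + 1) = (of_nat m + of_nat p + of_nat q + 1 :: complex)"
    "of_nat (m + p + 1) = (of_nat m + of_nat p + 1 :: complex)"
    "of_nat (p + q + 1) = (of_nat p + of_nat q + 1 :: complex)" by simp_all
  have "z ^ N = z * z ^ (N - 1)" by (simp add: N_def)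
  then have "z * V' = S * Z * (of_nat N * H + z * H')"
    by (simp add: V'_def Z_def algebra_simps)
  then have zV': "z * V' = S * Z * ((of_nat m + of_nat p + of_nat q + 1) * H + z * H')"
    unfolding N_def N .
  have Vp: "of_nat ((p + 1) * (m + p + 1)) * sol0 (Suc p) q m z =
      - (S * Z * z * ((1 - z) * H' - of_nat (m + p + 1) * H))"
    unfolding p by (simp add: sol0_def S_def Z_def N_def algebra_simps)
  have Vm: "of_nat ((m + p + 1) * (m + q + 1)) * sol0 p q (Suc m) z = - (S * Z * z * H')"
    unfolding m by (simp add: sol0_def S_def Z_def N_def algebra_simps)
  have Vd: "of_nat ((p + 1) * (q + 1)) * sol0 (Suc p) (Suc q) k z =
      - (S * Z * z * ((1 - z) * H' - of_nat m * H))" if "m = Suc k"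
    unfolding d [OF that] by (simp add: that sol0_def S_def Z_def N_def algebra_simps)
  have 2: "z * (1 - z) * V' - (of_nat (m + p + q + 1) - of_nat q * z) * sol0 p q m z =
       - of_nat ((p + 1) * (m + p + 1)) * sol0 (Suc p) q m z"
    unfolding mult_minus_left Vp V N using zV' by algebra
  have 3: "z * V' - of_nat (m + p + q + 1) * sol0 p q m z =
       - of_nat ((m + p + 1) * (m + q + 1)) * sol0 p q (Suc m) z"
    unfolding mult_minus_left Vm V N using zV' by algebra
  have 4: "z * (1 - z) * V' - (of_nat (m + p + q + 1) - of_nat (p + q + 1) * z) * sol0 p q m z =
       - of_nat ((p + 1) * (q + 1)) * sol0 (Suc p) (Suc q) k z" if "m = Suc k"
    unfolding mult_minus_left Vd [OF that] V N using zV' by algebra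
  show thesis by (rule that [OF 1 2 3 4])
qed

lemma ladder_sol0: "ladder (ball 0 1) sol0"
proof (rule ladder_symmetricI)
  show "sol0 p q m z = sol0 q p m z" for p q m z
    by (simp add: sol0_def coeff0_def [abs_def] ac_simps)
qed (metis sol0_derivative mem_ball_0)

lemma sol0_base:
  assumes "norm z < 1"
  shows "sol0 0 0 0 z = Ln (1 - z)"
proof -
  have "coeff0 0 0 0 = (\<lambda>j. 1 / of_nat (Suc j))"
    unfolding coeff0_def add_0_left of_nat_1 pochhammer_fact [symmetric]
    by (simp add: fun_eq_iff del: of_nat_Suc)
  then have *: "sol0 0 0 0 z = - (z * powser (\<lambda>j. 1 / of_nat (Suc j)) z)"
    by (simp add: sol0_def del: of_nat_Suc)
  have "(\<lambda>j. - ((- (- z)) ^ j) / of_nat j) sums ln (1 + - z)"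
    by (rule Ln_series') (use assms in simp)
  then have "(\<lambda>j. - (z ^ Suc j) / of_nat (Suc j)) sums Ln (1 - z)"
    using sums_Suc_iff [of "\<lambda>j. - ((- (- z)) ^ j) / of_nat j" "Ln (1 - z)"]
    by (simp del: of_nat_Suc)
  moreover have "(\<lambda>j. - z * (1 / of_nat (Suc j) * z ^ j)) sums (- z * powser (\<lambda>j. 1 / of_nat (Suc j)) z)"
  proof (unfold powser_def, intro sums_mult summable_sums)
    have "disc_summable (coeff0 0 0 0)" by (rule disc_summable_coeff0)
    then show "summable (\<lambda>j. 1 / of_nat (Suc j) * z ^ j)"
      using assms \<open>coeff0 0 0 0 = _\<close> by (simp add: disc_summable_def del: of_nat_Suc)
  qed
  ultimately show ?thesis
    unfolding * by (simp add: sums_iff del: of_nat_Suc)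
qed

section \<open>The coefficient of the logarithm\<close>

lemma pochhammer_minus_nat:
  assumes "k \<le> a"
  shows "pochhammer (- of_nat a :: complex) k = (- 1) ^ k * fact a / fact (a - k)"
  using assms
proof (induction k)
  case (Suc k)
  define d where "d = (of_nat (a - k) :: complex)"
  have "fact (a - k) = d * fact (a - Suc k)"
    using Suc.prems unfolding d_def by (metis Suc_diff_Suc Suc_le_lessD fact_Suc)
  moreover have "- of_nat a + of_nat k = - d" "d \<noteq> 0"
    using Suc.prems by (simp_all add: d_def of_nat_diff)
  moreover have "pochhammer (- of_nat a) k = (- 1) ^ k * fact a / (fact (a - k) :: complex)"
    using Suc by simp
  ultimately show ?case
    by (simp add: pochhammer_Suc)
qed simp

text \<open>
  After multiplication by \<open>(m + p)! (q - j)!\<close> this is Vandermonde's convolution of two binomial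
  coefficients.
\<close>

lemma vandermonde_reciprocal_factorials:
  assumes "j \<le> q" "q \<le> p"
  shows "(\<Sum>k=j..q. 1 / (fact (m + k) * fact (p - k) * fact (q - k) * fact (k - j))) =
    (fact (m + p + q - j) / (fact (m + p) * fact (m + q) * fact (p - j) * fact (q - j)) :: complex)"
proof -
  have "(\<Sum>k=j..q. 1 / (fact (m + k) * fact (p - k) * fact (q - k) * fact (k - j))) =
      (\<Sum>k=j..q. of_nat ((q - j choose (q - k)) * (m + p choose (m + k))) / (fact (m + p) * fact (q - j)) :: complex)"
  proof (rule sum.cong [OF refl])
    fix k assume k: "k \<in> {j..q}"
    have "of_nat (q - j choose (q - k)) = (fact (q - j) / (fact (q - k) * fact (k - j)) :: complex)"
      using k by (subst binomial_fact) (auto simp: algebra_simps)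
    moreover have "of_nat (m + p choose (m + k)) = (fact (m + p) / (fact (m + k) * fact (p - k)) :: complex)"
      using k assms by (subst binomial_fact) auto
    ultimately show "1 / (fact (m + k) * fact (p - k) * fact (q - k) * fact (k - j)) =
        (of_nat ((q - j choose (q - k)) * (m + p choose (m + k))) / (fact (m + p) * fact (q - j)) :: complex)"
      by simp
  qed
  also have "\<dots> = of_nat (\<Sum>k=j..q. (q - j choose (q - k)) * (m + p choose (m + k))) / (fact (m + p) * fact (q - j))"
    by (simp add: sum_divide_distrib)
  also have "(\<Sum>k=j..q. (q - j choose (q - k)) * (m + p choose (m + k))) =
      (\<Sum>t\<le>q - j. (q - j choose t) * (m + p choose (m + q - t)))"
    by (rule sum.reindex_bij_witness [of _ "\<lambda>t. q - t" "\<lambda>k. q - k"]) (use assms in auto)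
  also have "\<dots> = (\<Sum>t\<le>m + q. (q - j choose t) * (m + p choose (m + q - t)))"
    by (rule sum.mono_neutral_left) (use assms in \<open>auto simp: binomial_eq_0\<close>)
  also have "\<dots> = (q - j + (m + p)) choose (m + q)"
    by (rule vandermonde)
  also have "of_nat \<dots> / (fact (m + p) * fact (q - j)) =
      (fact (m + p + q - j) / (fact (m + p) * fact (m + q) * fact (p - j) * fact (q - j)) :: complex)"
  proof -
    have "q - j + (m + p) = m + p + q - j" "q - j + (m + p) - (m + q) = p - j" "m + q \<le> q - j + (m + p)"
      using assms by auto
    then show ?thesis by (simp add: binomial_fact mult_ac)
  qed
  finally show ?thesis .
qed

text \<open>
  The coefficient of the logarithm, expanded at \<open>1\<close> instead of \<open>0\<close>; the right side is the part of the
  series with coefficient function \<open>coeff1\<close> that multiplies the logarithm.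
\<close>

lemma P_expansion_at_1:
  "C3 n m l * fact (m + n + 2 * l) * P n m l z =
   (\<Sum>k\<le>l. 1 / (fact (m + k) * fact (n + l - k) * fact (l - k) * fact k) * (1 - z) ^ k)"
proof -
  define p where "p = n + l"
  define c :: "nat \<Rightarrow> complex" where "c j = fact (m + p + l - j) / (fact (m + p) * fact (m + l) * fact (p - j) * fact (l - j))" for j :: nat
  have N: "m + n + 2 * l = m + p + l" "m + n + l = m + p" and lp: "l \<le> p" by (auto simp: p_def)
  have "C3 n m l * fact (m + n + 2 * l) * P n m l z = (\<Sum>j\<le>l. c j * (- z) ^ j / fact j)"
    unfolding P_def hyp2F1_terminating_def sum_distrib_left
  proof (rule sum.cong [OF refl])
    fix j assume "j \<in> {..l}"
    then have "hyp2F1_summand (- of_nat l) (- of_nat (n + l)) (- of_nat (m + n + 2 * l)) j z =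
      ((- 1) ^ j * fact l / fact (l - j)) * ((- 1) ^ j * fact p / fact (p - j)) /
      (((- 1) ^ j * fact (m + p + l) / fact (m + p + l - j)) * fact j) * z ^ j"
      using lp unfolding hyp2F1_summand_def N p_def [symmetric]
      by (subst (1 2 3) pochhammer_minus_nat) auto
    then show "C3 n m l * fact (m + n + 2 * l) *
        hyp2F1_summand (- of_nat l) (- of_nat (n + l)) (- of_nat (m + n + 2 * l)) j z =
        c j * (- z) ^ j / fact j"
      unfolding C3_def N c_def p_def [symmetric] power_minus [of z]
      by (cases "even j") (simp_all add: field_simps)
  qed
  also have "\<dots> = (\<Sum>j\<le>l. \<Sum>k=j..l. 1 / (fact (m + k) * fact (p - k) * fact (l - k) * fact (k - j)) * (- z) ^ j / fact j)"
  proof (rule sum.cong [OF refl])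
    fix j assume "j \<in> {..l}"
    then have "c j = (\<Sum>k=j..l. 1 / (fact (m + k) * fact (p - k) * fact (l - k) * fact (k - j)))"
      unfolding c_def using vandermonde_reciprocal_factorials [of j l p m] lp by simp
    then show "c j * (- z) ^ j / fact j =
        (\<Sum>k=j..l. 1 / (fact (m + k) * fact (p - k) * fact (l - k) * fact (k - j)) * (- z) ^ j / fact j)"
      by (simp only: sum_distrib_right sum_divide_distrib)
  qed
  also have "\<dots> = (\<Sum>k\<le>l. \<Sum>j\<le>k. 1 / (fact (m + k) * fact (p - k) * fact (l - k) * fact (k - j)) * (- z) ^ j / fact j)"
    by (subst (1 2) sum.Sigma; (simp; fail)?)
      (rule sum.reindex_bij_witness [of _ "\<lambda>(k, j). (j, k)" "\<lambda>(j, k). (k, j)"]; force)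
  also have "\<dots> = (\<Sum>k\<le>l. 1 / (fact (m + k) * fact (p - k) * fact (l - k) * fact k) * (1 - z) ^ k)"
  proof (rule sum.cong [OF refl])
    fix k assume k: "k \<in> {..l}"
    have "(1 - z) ^ k = (- z + 1) ^ k" by simp
    also have "\<dots> = (\<Sum>j\<le>k. of_nat (k choose j) * (- z) ^ j)"
      by (subst binomial_ring) simp
    also have "\<dots> = (\<Sum>j\<le>k. fact k / (fact j * fact (k - j)) * (- z) ^ j)"
      by (intro sum.cong refl) (simp add: binomial_fact)
    finally have "1 / (fact (m + k) * fact (p - k) * fact (l - k) * fact k) * (1 - z) ^ k =
      (\<Sum>j\<le>k. 1 / (fact (m + k) * fact (p - k) * fact (l - k) * fact k) * (fact k / (fact j * fact (k - j)) * (- z) ^ j))"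
      by (simp only: sum_distrib_left)
    then show "(\<Sum>j\<le>k. 1 / (fact (m + k) * fact (p - k) * fact (l - k) * fact (k - j)) * (- z) ^ j / fact j) =
        1 / (fact (m + k) * fact (p - k) * fact (l - k) * fact k) * (1 - z) ^ k"
      by (simp add: field_simps)
  qed
  finally show ?thesis unfolding p_def .
qed

section \<open>Coefficient functions at the integers\<close>

text \<open>
  Logarithmic derivatives add up.  At the integers where no factor vanishes they are differences of
  \<open>\<psi>\<close> values.
\<close>

lemma DERIV_mult_log:
  assumes "(f has_field_derivative f s * \<alpha>) (at s)" "(g has_field_derivative g s * \<beta>) (at s)"
  shows "((\<lambda>s::complex. f s * g s) has_field_derivative f s * g s * (\<alpha> + \<beta>)) (at s)"
  by (rule DERIV_cong [OF DERIV_mult [OF assms]]) (simp add: algebra_simps)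

lemma rfact_log_derivative:
  assumes "s + of_nat a = of_nat b"
  shows "(rfact a has_field_derivative rfact a s * - psi (b + 1)) (at s)"
  using rfact_nat [OF assms] by simp

lemma rfact_neg_log_derivative:
  assumes "- s + of_nat a = of_nat b"
  shows "((\<lambda>s. rfact a (- s)) has_field_derivative rfact a (- s) * psi (b + 1)) (at s)"
  using rfact_neg_has_derivative [OF rfact_log_derivative [OF assms]] by simp

lemma pochhammer_nat_log:
  assumes "s + of_nat a = (of_nat b :: complex)"
  shows "pochhammer (s + of_nat a + 1) r = fact (b + r) / fact b"
    and "((\<lambda>s. pochhammer (s + of_nat a + 1) r) has_field_derivative
      pochhammer (s + of_nat a + 1) r * (psi (b + r + 1) - psi (b + 1))) (at s)"
proof -
  have b: "s + of_nat (a + r) = of_nat (b + r)" using assms by simp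
  note d = pochhammer_rfact_deriv [OF b rfact_log_derivative [OF assms]]
  show "pochhammer (s + of_nat a + 1) r = fact (b + r) / fact b"
    using d(1) rfact_nat(1) [OF assms] by simp
  show "((\<lambda>s. pochhammer (s + of_nat a + 1) r) has_field_derivative
      pochhammer (s + of_nat a + 1) r * (psi (b + r + 1) - psi (b + 1))) (at s)"
    by (rule DERIV_cong [OF d(2)]) (simp only: d(1), simp add: algebra_simps)
qed

lemma DERIV_mult_zero:
  assumes "f holomorphic_on UNIV" "(g has_field_derivative d) (at s)" "g s = 0"
  shows "((\<lambda>s::complex. f s * g s) has_field_derivative f s * d) (at s)"
  by (rule DERIV_cong [OF DERIV_mult [OF entire_has_derivative [OF assms(1)] assms(2)]]) (simp add: assms)

text \<open>
  At the integers where no factor of a coefficient function vanishes its derivative carries \<open>\<psi>\<close>.  Below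
  and, for \<open>coeff1\<close> and \<open>coeff3\<close>, also above this range a single factor vanishes, and only the derivative
  of that factor survives; these integers produce the sums without \<open>\<psi>\<close> in the formulas.
\<close>

lemma coeff1_middle:
  assumes "k \<le> p" "k \<le> q"
  shows "coeff1 p q m (of_nat k) = 1 / (fact (m + k) * fact (p - k) * fact (q - k) * fact k)"
    and "deriv (coeff1 p q m) (of_nat k) =
      (psi (p - k + 1) + psi (q - k + 1) - psi (m + k + 1) - psi (k + 1)) /
      (fact (m + k) * fact (p - k) * fact (q - k) * fact k)"
proof -
  have s: "of_nat k + of_nat 0 = (of_nat k :: complex)" "of_nat k + of_nat m = (of_nat (m + k) :: complex)"
    "- of_nat k + of_nat p = (of_nat (p - k) :: complex)" "- of_nat k + of_nat q = (of_nat (q - k) :: complex)"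
    using assms by (simp_all add: of_nat_diff)
  note vals = s [THEN rfact_nat(1)]
  show val: "coeff1 p q m (of_nat k) = 1 / (fact (m + k) * fact (p - k) * fact (q - k) * fact k)"
    unfolding coeff1_def vals by simp
  have "(coeff1 p q m has_field_derivative coeff1 p q m (of_nat k) *
      ((- psi (k + 1) + psi (p - k + 1)) + (- psi (m + k + 1) + psi (q - k + 1)))) (at (of_nat k))"
    unfolding coeff1_def [abs_def]
    by (intro DERIV_mult_log rfact_log_derivative rfact_neg_log_derivative s)
  from DERIV_imp_deriv [OF this] show "deriv (coeff1 p q m) (of_nat k) =
      (psi (p - k + 1) + psi (q - k + 1) - psi (m + k + 1) - psi (k + 1)) /
      (fact (m + k) * fact (p - k) * fact (q - k) * fact k)"
    unfolding val by (simp add: field_simps)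
qed

text \<open>
  The range \<open>q < k \<le> p\<close>; beyond \<open>p\<close> there is a double zero, which makes formula (1) finite.
\<close>

lemma coeff1_upper:
  assumes "q < k" "k \<le> p"
  shows "coeff1 p q m (of_nat k) = 0"
    and "deriv (coeff1 p q m) (of_nat k) =
      (- 1) ^ (k - q) * fact (k - q - 1) / (fact (m + k) * fact (p - k) * fact k)"
proof -
  have s: "of_nat k + of_nat m = (of_nat (m + k) :: complex)"
    "- of_nat k + of_nat p = (of_nat (p - k) :: complex)"
    using assms by (simp_all add: of_nat_diff)
  note vals = s [THEN rfact_nat(1)]
  have c: "coeff1 p q m = (\<lambda>s. (rfact m s * rfact p (- s)) * (rfact 0 s * rfact q (- s)))"
    by (simp add: coeff1_def fun_eq_iff)
  show "coeff1 p q m (of_nat k) = 0"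
    unfolding c using rfact_product_beyond(1) [OF assms(1)] by simp
  have "(coeff1 p q m has_field_derivative (rfact m (of_nat k) * rfact p (- of_nat k)) *
      ((- 1) ^ (k - q) * fact (k - q - 1) / fact k)) (at (of_nat k))"
    unfolding c using rfact_product_beyond(1) [OF assms(1)]
    by (intro DERIV_mult_zero rfact_product_beyond(2) [OF assms(1)] holomorphic_intros)
  from DERIV_imp_deriv [OF this] show "deriv (coeff1 p q m) (of_nat k) =
      (- 1) ^ (k - q) * fact (k - q - 1) / (fact (m + k) * fact (p - k) * fact k)"
    unfolding vals by simp
qed

lemma rfact_0_negative:
  assumes "j < m"
  shows "rfact 0 (of_int (- int m + int j)) = 0"
    and "(rfact 0 has_field_derivative (- 1) ^ (m - j - 1) * fact (m - j - 1)) (at (of_int (- int m + int j)))"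
proof -
  have *: "of_int (- int m + int j) + of_nat 0 + 1 = (- of_nat (m - j - 1) :: complex)"
    using assms by (simp add: of_nat_diff)
  show "rfact 0 (of_int (- int m + int j)) = 0"
    and "(rfact 0 has_field_derivative (- 1) ^ (m - j - 1) * fact (m - j - 1)) (at (of_int (- int m + int j)))"
    using rfact_negative [OF *] by auto
qed

lemma coeff1_lower:
  assumes "j < m"
  shows "coeff1 p q m (of_int (- int m + int j)) = 0"
    and "deriv (coeff1 p q m) (of_int (- int m + int j)) =
      (- 1) ^ (m - j - 1) * fact (m - j - 1) / (fact (m + p - j) * fact (m + q - j) * fact j)"
proof -
  let ?s = "of_int (- int m + int j) :: complex"
  have s: "?s + of_nat m = of_nat j"
    "- ?s + of_nat p = of_nat (m + p - j)" "- ?s + of_nat q = of_nat (m + q - j)"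
    using assms by (simp_all add: of_nat_diff)
  note vals = s [THEN rfact_nat(1)]
  have c: "coeff1 p q m = (\<lambda>s. (rfact p (- s) * (rfact m s * rfact q (- s))) * rfact 0 s)"
    by (simp add: coeff1_def fun_eq_iff)
  show "coeff1 p q m ?s = 0"
    unfolding c rfact_0_negative(1) [OF assms] by simp
  have "(coeff1 p q m has_field_derivative (rfact p (- ?s) * (rfact m ?s * rfact q (- ?s))) *
      ((- 1) ^ (m - j - 1) * fact (m - j - 1))) (at ?s)"
    unfolding c by (intro DERIV_mult_zero rfact_0_negative [OF assms] holomorphic_intros)
  from DERIV_imp_deriv [OF this] show "deriv (coeff1 p q m) ?s =
      (- 1) ^ (m - j - 1) * fact (m - j - 1) / (fact (m + p - j) * fact (m + q - j) * fact j)"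
    unfolding vals by simp
qed

lemma coeff2_upper:
  "deriv (coeff2 p q m) (of_nat k) = fact (m + p + k) * fact (m + q + k) / (fact (m + k) * fact k) *
     (psi (m + p + k + 1) + psi (m + q + k + 1) - psi (m + k + 1) - psi (k + 1))"
proof -
  have s: "of_nat k + of_nat m = (of_nat (m + k) :: complex)" "of_nat k + of_nat 0 = (of_nat k :: complex)" by simp_all
  note vals = pochhammer_nat_log(1) [OF s(1)] pochhammer_nat_log(1) [OF s(2)]
  have c: "coeff2 p q m = (\<lambda>s. pochhammer (s + of_nat m + 1) p * (pochhammer (s + of_nat m + 1) q * pochhammer (s + of_nat 0 + 1) m))"
    by (simp add: coeff2_def fun_eq_iff)
  have "(coeff2 p q m has_field_derivative
      coeff2 p q m (of_nat k) * ((psi (m + k + p + 1) - psi (m + k + 1)) +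
      ((psi (m + k + q + 1) - psi (m + k + 1)) + (psi (k + m + 1) - psi (k + 1))))) (at (of_nat k))"
    unfolding c by (intro DERIV_mult_log pochhammer_nat_log(2) s)
  from DERIV_imp_deriv [OF this] show ?thesis
    unfolding c vals by (simp add: add_ac)
qed

lemma coeff2_lower:
  assumes "j < m"
  shows "deriv (coeff2 p q m) (of_int (- int m + int j)) =
      (- 1) ^ (m - j - 1) * fact (m - j - 1) * fact (p + j) * fact (q + j) / fact j"
proof -
  let ?s = "of_int (- int m + int j) :: complex"
  have s: "?s + of_nat m = of_nat j" "?s + of_nat (0 + m) = of_nat j" by simp_all
  note vals = pochhammer_nat_log(1) [OF s(1)]
  note d = pochhammer_rfact_deriv [OF s(2) rfact_0_negative(2) [OF assms]]
  have c: "coeff2 p q m = (\<lambda>s. (pochhammer (s + of_nat m + 1) p * pochhammer (s + of_nat m + 1) q) * pochhammer (s + of_nat 0 + 1) m)"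
    by (simp add: coeff2_def fun_eq_iff)
  have z: "pochhammer (?s + of_nat 0 + 1) m = 0"
    using d(1) rfact_0_negative(1) [OF assms] by simp
  have "(coeff2 p q m has_field_derivative
      (pochhammer (?s + of_nat m + 1) p * pochhammer (?s + of_nat m + 1) q) *
      (fact j * ((- 1) ^ (m - j - 1) * fact (m - j - 1) + rfact 0 ?s * psi (j + 1)))) (at ?s)"
    unfolding c by (intro DERIV_mult_zero d z holomorphic_intros)
  from DERIV_imp_deriv [OF this] show ?thesis
    unfolding vals rfact_0_negative(1) [OF assms] by (simp add: field_simps)
qed

lemma coeff3_middle:
  assumes "k \<le> q"
  shows "deriv (coeff3 p q m) (of_nat k) = fact (m + p + k) / (fact (m + k) * fact (q - k) * fact k) *
     (psi (m + p + k + 1) + psi (q - k + 1) - psi (m + k + 1) - psi (k + 1))"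
proof -
  have s: "of_nat k + of_nat m = (of_nat (m + k) :: complex)" "of_nat k + of_nat 0 = (of_nat k :: complex)"
    "- of_nat k + of_nat q = (of_nat (q - k) :: complex)"
    using assms by (simp_all add: of_nat_diff)
  note vals = pochhammer_nat_log(1) [OF s(1)] rfact_nat(1) [OF s(2)] rfact_nat(1) [OF s(3)]
  have "(coeff3 p q m has_field_derivative
      coeff3 p q m (of_nat k) * ((psi (m + k + p + 1) - psi (m + k + 1)) + (- psi (k + 1) + psi (q - k + 1))))
      (at (of_nat k))"
    unfolding coeff3_def [abs_def]
    by (intro DERIV_mult_log pochhammer_nat_log(2) rfact_log_derivative rfact_neg_log_derivative s)
  from DERIV_imp_deriv [OF this] show ?thesis
    unfolding coeff3_def vals by (simp add: add_ac) (simp add: field_simps)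
qed

lemma coeff3_upper:
  assumes "q < k"
  shows "deriv (coeff3 p q m) (of_nat k) =
      (- 1) ^ (k - q) * fact (m + p + k) * fact (k - q - 1) / (fact (m + k) * fact k)"
proof -
  have s: "of_nat k + of_nat m = (of_nat (m + k) :: complex)" by simp
  have "(coeff3 p q m has_field_derivative pochhammer (of_nat k + of_nat m + 1) p *
      ((- 1) ^ (k - q) * fact (k - q - 1) / fact k)) (at (of_nat k))"
    unfolding coeff3_def [abs_def]
    by (intro DERIV_mult_zero rfact_product_beyond [OF assms] holomorphic_intros)
  from DERIV_imp_deriv [OF this] show ?thesis
    unfolding pochhammer_nat_log(1) [OF s] by (simp add: add_ac mult_ac)
qed

lemma coeff3_lower:
  assumes "j < m"
  shows "deriv (coeff3 p q m) (of_int (- int m + int j)) =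
      (- 1) ^ (m - j - 1) * fact (m - j - 1) * fact (p + j) / (fact (m + q - j) * fact j)"
proof -
  let ?s = "of_int (- int m + int j) :: complex"
  have s: "?s + of_nat m = of_nat j" "- ?s + of_nat q = of_nat (m + q - j)"
    using assms by (simp_all add: of_nat_diff)
  note vals = pochhammer_nat_log(1) [OF s(1)] rfact_nat(1) [OF s(2)]
  have c: "coeff3 p q m = (\<lambda>s. (pochhammer (s + of_nat m + 1) p * rfact q (- s)) * rfact 0 s)"
    by (simp add: coeff3_def fun_eq_iff)
  have "(coeff3 p q m has_field_derivative
      (pochhammer (?s + of_nat m + 1) p * rfact q (- ?s)) * ((- 1) ^ (m - j - 1) * fact (m - j - 1))) (at ?s)"
    unfolding c by (intro DERIV_mult_zero rfact_0_negative [OF assms] holomorphic_intros)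
  from DERIV_imp_deriv [OF this] show ?thesis
    unfolding vals by (simp add: add_ac mult_ac)
qed

section \<open>The formulas near 1\<close>

lemma powser_finite:
  assumes "\<And>k. k > K \<Longrightarrow> a k = 0"
  shows "powser a x = (\<Sum>k\<le>K. a k * x ^ k)"
  unfolding powser_def by (rule suminf_finite) (use assms in auto)

lemma disc_summable_shift: "disc_summable (\<lambda>k. a (k + m)) \<longleftrightarrow> disc_summable a"
proof (induction m)
  case (Suc m)
  then show ?case using disc_summable_Suc [of "\<lambda>k. a (k + m)"] by simp
qed simp

lemma disc_summable_nonneg:
  assumes "disc_summable (\<lambda>j. f (of_int (- int m + int j)))"
  shows "disc_summable (\<lambda>k. f (of_nat k))"
  using disc_summable_shift [of "\<lambda>j. f (of_int (- int m + int j))" m] assms by simp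

lemma powser_split:
  assumes "disc_summable (\<lambda>j. f (of_int (- int m + int j)))" "norm x < 1"
  shows "powser (\<lambda>j. f (of_int (- int m + int j))) x =
    (\<Sum>j<m. f (of_int (- int m + int j)) * x ^ j) + x ^ m * powser (\<lambda>k. f (of_nat k)) x"
proof -
  let ?t = "\<lambda>j. f (of_int (- int m + int j)) * x ^ j"
  have "(\<Sum>k. ?t (k + m)) = (\<Sum>k. x ^ m * (f (of_nat k) * x ^ k))"
    by (simp add: power_add mult_ac)
  also have "\<dots> = x ^ m * powser (\<lambda>k. f (of_nat k)) x"
    unfolding powser_def
    by (rule suminf_mult) (rule disc_summableD [OF disc_summable_nonneg [of f m, OF assms(1)] assms(2)])
  finally show ?thesis
    unfolding powser_def
    using suminf_split_initial_segment [OF disc_summableD [OF assms], of m] by simp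
qed

text \<open>
  The terms of negative index are split off because they form the sums over \<open>k < m\<close> in the formulas.
\<close>

lemma frobenius_log_free:
  assumes "admissible (- int m) g" "x \<noteq> 0" "norm x < 1"
  shows "frobenius (- int m) g 0 x =
    x powi (- int m) * (\<Sum>j<m. deriv g (of_int (- int m + int j)) * x ^ j) + powser (\<lambda>k. deriv g (of_nat k)) x"
  unfolding frobenius_def using assms
  by (subst powser_split) (auto simp: admissible_def power_int_minus field_simps)

lemma negated_powi:
  assumes "j < m" "w \<noteq> 0"
  shows "(- w) powi (- int m) * ((- 1) ^ (m - j - 1) * (- w) ^ j) = - ((w::complex) powi (- int m) * w ^ j)"
proof -
  obtain i where m: "m = Suc (j + i)" using less_imp_Suc_add [OF assms(1)] by blast
  show ?thesis
    unfolding m power_int_minus power_int_of_nat using assms(2)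
    by (cases "even i"; cases "even j") simp_all
qed

lemma negated_lower_sum:
  assumes "w \<noteq> (0::complex)" "\<And>j. j < m \<Longrightarrow> d j = (- 1) ^ (m - j - 1) * c j"
  shows "(- w) powi (- int m) * (\<Sum>j<m. d j * (- w) ^ j) = - (w powi (- int m) * (\<Sum>j<m. c j * w ^ j))"
proof -
  have "(- w) powi (- int m) * (d j * (- w) ^ j) = - (w powi (- int m) * (c j * w ^ j))" if "j < m" for j
    using negated_powi [OF that assms(1)] unfolding assms(2) [OF that] by (simp add: mult_ac)
  then have "(\<Sum>j<m. (- w) powi (- int m) * (d j * (- w) ^ j)) = (\<Sum>j<m. - (w powi (- int m) * (c j * w ^ j)))"
    by (intro sum.cong) auto
  then show ?thesis by (simp only: sum_distrib_left sum_negf)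
qed

text \<open>
  For vanishing parameters all expansions reduce to the logarithm.  In the third one the series
  \<open>\<Sum> (-t)\<^sup>k / k\<close> with \<open>1 + t = 1 / z\<close> contributes the \<open>log z\<close> that distinguishes \<open>log (1 - z)\<close> from
  \<open>log ((1 - z) / z)\<close>.
\<close>

lemma sol_base:
  assumes z: "z \<in> lens"
  shows "sol1 \<mu> 0 0 0 z = Ln (1 - z) + \<mu>" "sol2 \<mu> 0 0 0 z = Ln (1 - z) + \<mu>"
    "sol3 \<mu> 0 0 0 z = Ln (1 - z) + \<mu>"
proof -
  note zl = lensD [OF z]
  have 1: "powser (\<lambda>k. deriv (coeff1 0 0 0) (of_nat k)) (1 - z) = 0"
    "powser (\<lambda>k. coeff1 0 0 0 (of_nat k)) (1 - z) = 1"
    using coeff1_middle [of 0 0 0 0] by (subst powser_finite [of 0]; simp add: coeff1_double_zero)+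
  show "sol1 \<mu> 0 0 0 z = Ln (1 - z) + \<mu>"
    unfolding sol1_def frobenius_def using 1 by simp
  have "powser (\<lambda>k. 1) (1 - z) = 1 / z"
    using zl suminf_geometric [of "1 - z"] by (simp add: powser_def)
  moreover have "powser (\<lambda>k. 0) (1 - z) = 0" by (simp add: powser_def)
  ultimately show "sol2 \<mu> 0 0 0 z = Ln (1 - z) + \<mu>"
    unfolding sol2_def frobenius_def coeff2_def [abs_def] using zl by simp
  define t where "t = (1 - z) / z"
  have t: "norm t < 1" using zl by (simp add: t_def)
  have 3: "powser (\<lambda>k. coeff3 0 0 0 (of_nat k)) t = 1"
    using rfact_product_beyond(1) [of 0] rfact_nat(1) [of 0 0 0]
    by (subst powser_finite [of 0]) (simp_all add: coeff3_def)
  have "deriv (coeff3 0 0 0) (of_nat k) = - (- ((- 1) ^ k) / of_nat k)" for k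
  proof (cases k)
    case 0
    then show ?thesis using coeff3_middle [of 0 0 0 0] by simp
  next
    case (Suc i)
    then show ?thesis using coeff3_upper [of 0 k 0 0] by simp
  qed
  then have "powser (\<lambda>k. deriv (coeff3 0 0 0) (of_nat k)) t = (\<Sum>k. - (- ((- t) ^ k) / of_nat k))"
    by (simp add: powser_def power_minus [of t])
  also have "(\<lambda>k. - (- ((- t) ^ k) / of_nat k)) sums (- ln (1 + t))"
    by (intro sums_minus Ln_series' t)
  then have "(\<Sum>k. - (- ((- t) ^ k) / of_nat k)) = - Ln (1 + t)" by (simp only: sums_iff)
  also have "1 + t = inverse z" using zl by (simp add: t_def field_simps)
  also have "- Ln (inverse z) = Ln z"
    using zl by (simp add: Ln_inverse)
  finally have "powser (\<lambda>k. deriv (coeff3 0 0 0) (of_nat k)) t = Ln z" .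
  moreover have "Ln t = Ln (1 - z) - Ln z"
  proof -
    have "\<bar>Im (Ln (1 - z))\<bar> < pi / 2" "\<bar>Im (Ln z)\<bar> < pi / 2"
      by (rule Re_Ln_pos_lt [THEN iffD2]; use zl in simp)+
    then show ?thesis
      unfolding t_def using zl by (intro Ln_unique) (auto simp: exp_diff)
  qed
  ultimately show "sol3 \<mu> 0 0 0 z = Ln (1 - z) + \<mu>"
    unfolding sol3_def frobenius_def t_def [symmetric] using 3 by simp
qed


text \<open>
  Agreement holds for every \<open>\<mu>\<close>, which is two statements in one: equality of the solutions and equality
  of the coefficients of their logarithms.
\<close>

lemma ladder_solutions_agree:
  assumes "z \<in> lens"
  shows "sol0 p q m z = sol1 0 p q m z" "sol2 \<mu> p q m z = sol1 \<mu> p q m z"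
    "sol3 \<mu> p q m z = sol1 \<mu> p q m z" "sol3 \<mu> q p m z = sol1 \<mu> p q m z"
proof -
  have "ladder lens sol0"
    using ladder_sol0 unfolding ladder_def lens_def by blast
  then show "sol0 p q m z = sol1 0 p q m z"
    by (rule ladder_unique [OF _ ladder_sol1 open_lens _ assms])
      (simp add: sol_base, simp add: sol0_base lens_def)
  show "sol2 \<mu> p q m z = sol1 \<mu> p q m z"
    by (rule ladder_unique [OF ladder_sol2 ladder_sol1 open_lens _ assms]) (simp add: sol_base)
  show "sol3 \<mu> p q m z = sol1 \<mu> p q m z"
    by (rule ladder_unique [OF ladder_sol3 ladder_sol1 open_lens _ assms]) (simp add: sol_base)
  show "sol3 \<mu> q p m z = sol1 \<mu> p q m z"
    using ladder_unique [OF ladder_swap [OF ladder_sol3] ladder_sol1 open_lens _ assms, of \<mu> \<mu> q p m]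
    by (simp add: sol_base)
qed

definition log_coeff :: "nat \<Rightarrow> nat \<Rightarrow> nat \<Rightarrow> complex \<Rightarrow> complex" where
  "log_coeff n m l z = C3 n m l * fact (m + n + 2 * l) * P n m l z"

lemma sol1_log_coeff:
  assumes "z \<in> lens"
  shows "sol1 \<mu> (n + l) l m z = sol1 (- Ln (1 - z)) (n + l) l m z + (Ln (1 - z) + \<mu>) * log_coeff n m l z"
proof -
  let ?g = "coeff1 (n + l) l m"
  note zl = lensD [OF assms]
  have "powser (\<lambda>j. ?g (of_int (- int m + int j))) (1 - z) =
      (1 - z) ^ m * powser (\<lambda>k. ?g (of_nat k)) (1 - z)"
    using powser_split [of ?g m "1 - z"] admissible_coeff1 [of m "n + l" l] zl coeff1_lower(1) [of _ m "n + l" l]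
    by (simp add: admissible_def)
  also have "powser (\<lambda>k. ?g (of_nat k)) (1 - z) = (\<Sum>k\<le>l. ?g (of_nat k) * (1 - z) ^ k)"
    by (rule powser_finite) (metis coeff1_double_zero(1) coeff1_upper(1) not_le_imp_less order_less_le_trans)
  also have "\<dots> = log_coeff n m l z"
    unfolding log_coeff_def P_expansion_at_1
    by (rule sum.cong) (simp_all add: coeff1_middle)
  finally have "(1 - z) powi (- int m) * powser (\<lambda>j. ?g (of_int (- int m + int j))) (1 - z) = log_coeff n m l z"
    using zl by (simp add: power_int_minus)
  then show ?thesis
    unfolding sol1_def frobenius_def by (simp add: algebra_simps)
qed

text \<open>
  With \<open>\<mu>\<close> equal to minus the logarithm an expansion is reduced to its part free of logarithms, at the
  cost of a multiple of \<open>log_coeff\<close>.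
\<close>

lemma sol0_log_split:
  assumes "z \<in> lens"
  shows "sol0 (n + l) l m z = log_coeff n m l z * Ln (1 - z) + sol1 (- Ln (1 - z)) (n + l) l m z"
    and "sol0 (n + l) l m z = log_coeff n m l z * Ln (1 - z) + sol2 (- Ln (1 - z)) (n + l) l m z"
    and "sol0 (n + l) l m z =
      log_coeff n m l z * Ln ((1 - z) / z) + sol3 (- Ln ((1 - z) / z)) (n + l) l m z"
    and "sol0 (n + l) l m z =
      log_coeff n m l z * Ln ((1 - z) / z) + sol3 (- Ln ((1 - z) / z)) l (n + l) m z"
proof -
  have 1: "sol0 (n + l) l m z = sol1 (- Ln (1 - z)) (n + l) l m z + Ln (1 - z) * log_coeff n m l z"
    unfolding ladder_solutions_agree(1) [OF assms] using sol1_log_coeff [OF assms, of 0] by simp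
  then show "sol0 (n + l) l m z = log_coeff n m l z * Ln (1 - z) + sol1 (- Ln (1 - z)) (n + l) l m z"
    by simp
  then show "sol0 (n + l) l m z = log_coeff n m l z * Ln (1 - z) + sol2 (- Ln (1 - z)) (n + l) l m z"
    unfolding ladder_solutions_agree(2) [OF assms] .
  have 3: "sol0 (n + l) l m z =
      log_coeff n m l z * Ln ((1 - z) / z) + sol1 (- Ln ((1 - z) / z)) (n + l) l m z"
    unfolding 1 sol1_log_coeff [OF assms, of "- Ln ((1 - z) / z)"] by (simp add: algebra_simps)
  then show "sol0 (n + l) l m z =
      log_coeff n m l z * Ln ((1 - z) / z) + sol3 (- Ln ((1 - z) / z)) (n + l) l m z"
    unfolding ladder_solutions_agree(3) [OF assms] .
  show "sol0 (n + l) l m z =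
      log_coeff n m l z * Ln ((1 - z) / z) + sol3 (- Ln ((1 - z) / z)) l (n + l) m z"
    unfolding ladder_solutions_agree(4) [OF assms] by (rule 3)
qed

definition finite_part2 :: "nat \<Rightarrow> nat \<Rightarrow> nat \<Rightarrow> complex \<Rightarrow> complex" where
  "finite_part2 n m l z = - C3 n m l * z ^ (m + n + 2 * l + 1) * (z - 1) powi (- int m) *
     (\<Sum>k<m. fact (n + l + k) * fact (l + k) * fact (m - k - 1) / fact k * (z - 1) ^ k)"

text \<open>
  Formulas (3) and (4) have the same shape; they are treated together, with \<open>p = n + l\<close> and \<open>q = l\<close> in
  (3) and with \<open>p = l\<close> and \<open>q = n + l\<close> in (4).
\<close>

definition finite_part3 :: "nat \<Rightarrow> nat \<Rightarrow> nat \<Rightarrow> complex \<Rightarrow> complex" where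
  "finite_part3 p q m z =
     - (z ^ (m + q) * (z - 1) powi (- int m) / (fact p * fact (m + p)) *
       (\<Sum>k<m. fact (p + k) * fact (m - k - 1) / (fact (m + q - k) * fact k) * ((z - 1) ^ k / z ^ k)))
     + z ^ q / (fact p * fact (m + p)) *
       (\<Sum>k\<le>q. fact (m + p + k) / (fact (m + k) * fact (q - k) * fact k)
                * (psi (m + p + k + 1) + psi (q - k + 1) - psi (m + k + 1) - psi (k + 1))
                * ((1 - z) ^ k / z ^ k))"

definition tail3 :: "nat \<Rightarrow> nat \<Rightarrow> nat \<Rightarrow> nat \<Rightarrow> complex \<Rightarrow> complex" where
  "tail3 p q m k z =
     (if q + 1 \<le> k
      then fact (m + p + k) * fact (k - q - 1) / (fact (m + k) * fact k) * ((z - 1) ^ k / z ^ k)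
      else 0)"

lemma rhs_decomposition:
  "rhs2 n m l z = log_coeff n m l z * Ln (1 - z) + finite_part2 n m l z +
     C3 n m l * z ^ (m + n + 2 * l + 1) * continued_sum (summand2 n m l) region2 (- {0}) z"
  "rhs3 n m l z = log_coeff n m l z * Ln ((1 - z) / z) + finite_part3 (n + l) l m z +
     (- z) ^ l / (fact (n + l) * fact (m + n + l)) * continued_sum (summand3 n m l) region34 two_slit_plane z"
  "rhs4 n m l z = log_coeff n m l z * Ln ((1 - z) / z) + finite_part3 l (n + l) m z +
     (- z) ^ (n + l) / (fact l * fact (m + l)) * continued_sum (summand4 n m l) region34 two_slit_plane z"
  "summand3 n m l = tail3 (n + l) l m" "summand4 n m l = tail3 l (n + l) m"
  unfolding rhs2_def rhs3_def rhs4_def log_coeff_def finite_part2_def finite_part3_def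
    summand3_def [abs_def] summand4_def [abs_def] tail3_def [abs_def]
  by (simp_all add: add.assoc fun_eq_iff)

definition series2 :: "nat \<Rightarrow> nat \<Rightarrow> nat \<Rightarrow> complex \<Rightarrow> complex" where
  "series2 n m l z = powser (\<lambda>k. deriv (coeff2 (n + l) l m) (of_nat k)) (1 - z)"

text \<open>
  The sum of \<open>tail3\<close>, written as a full power series minus its head: one coefficient function gives the
  terms with \<open>\<psi>\<close> and those of the tail.
\<close>

definition series3 :: "nat \<Rightarrow> nat \<Rightarrow> nat \<Rightarrow> complex \<Rightarrow> complex" where
  "series3 p q m z = (- 1) ^ q * (powser (\<lambda>k. deriv (coeff3 p q m) (of_nat k)) ((1 - z) / z) -
     (\<Sum>k\<le>q. deriv (coeff3 p q m) (of_nat k) * ((1 - z) / z) ^ k))"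

lemma disc_summable_deriv:
  "disc_summable (\<lambda>k. deriv (coeff2 p q m) (of_nat k))"
  "disc_summable (\<lambda>k. deriv (coeff3 p q m) (of_nat k))"
  using admissible_coeff2 [of m p q] admissible_coeff3 [of m p q] disc_summable_nonneg
  unfolding admissible_def by blast+

lemma summand2_sums:
  assumes "norm (1 - z) < 1"
  shows "(\<lambda>k. summand2 n m l k z) sums series2 n m l z"
proof -
  have "summand2 n m l k z = deriv (coeff2 (n + l) l m) (of_nat k) * (1 - z) ^ k" for k
    unfolding summand2_def coeff2_upper by (simp add: add_ac mult_ac)
  then show ?thesis
    unfolding series2_def powser_def
    using summable_sums [OF disc_summableD [OF disc_summable_deriv(1) assms]] by simp
qed

lemma tail3_sums:
  assumes "norm ((1 - z) / z) < 1"
  shows "(\<lambda>k. tail3 p q m k z) sums series3 p q m z"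
proof -
  define t where "t = (1 - z) / z"
  let ?d = "\<lambda>k. deriv (coeff3 p q m) (of_nat k)"
  have "(\<lambda>k. (- 1) ^ q * (?d k * t ^ k - (if k \<in> {..q} then ?d k * t ^ k else 0))) sums
      ((- 1) ^ q * (powser ?d t - (\<Sum>k\<le>q. ?d k * t ^ k)))"
    unfolding powser_def using assms disc_summable_deriv(2) [of p q m]
    by (intro sums_mult sums_diff sums_If_finite_set summable_sums disc_summableD) (auto simp: t_def)
  moreover have "(- 1) ^ q * (?d k * t ^ k - (if k \<in> {..q} then ?d k * t ^ k else 0)) = tail3 p q m k z" for k
  proof (cases "q < k")
    case True
    define i where "i = k - q"
    have k: "k = q + i" using True by (simp add: i_def)
    have t: "t ^ k = (- 1) ^ k * ((z - 1) ^ k / z ^ k)"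
      unfolding t_def power_divide [symmetric] power_mult_distrib [symmetric]
      by (simp add: minus_divide_left)
    have sgn: "(- 1) ^ q * ((- 1) ^ (k - q) * (- 1) ^ k) = (1 :: complex)"
      unfolding k by (cases "even q"; cases "even i") simp_all
    have "(- 1) ^ q * (?d k * t ^ k) = ((- 1) ^ q * ((- 1) ^ (k - q) * (- 1) ^ k)) *
        (fact (m + p + k) * fact (k - q - 1) / (fact (m + k) * fact k) * ((z - 1) ^ k / z ^ k))"
      unfolding t coeff3_upper [OF True] by simp
    then show ?thesis unfolding sgn using True by (simp add: tail3_def)
  next
    case False
    then show ?thesis by (simp add: tail3_def)
  qed
  ultimately show ?thesis by (simp add: series3_def t_def)
qed

lemma sol2_log_free:
  assumes "z \<in> lens"
  shows "sol2 (- Ln (1 - z)) (n + l) l m z = finite_part2 n m l z +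
    C3 n m l * z ^ (m + n + 2 * l + 1) * series2 n m l z"
proof -
  let ?g = "coeff2 (n + l) l m"
  note zl = lensD [OF assms]
  define w where "w = z - 1"
  have w: "w \<noteq> 0" "1 - z = - w" using zl by (auto simp: w_def)
  have low: "(- w) powi (- int m) * (\<Sum>j<m. deriv ?g (of_int (- int m + int j)) * (- w) ^ j) =
    - (w powi (- int m) * (\<Sum>k<m. fact (n + l + k) * fact (l + k) * fact (m - k - 1) / fact k * w ^ k))"
    by (rule negated_lower_sum [OF w(1)], subst coeff2_lower) simp_all
  have N: "m + (n + l) + l + 1 = m + n + 2 * l + 1" by simp
  have C: "C3 n m l = 1 / (fact (n + l) * fact l * fact (m + (n + l)) * fact (m + l))"
    by (simp add: C3_def add.assoc mult_ac)
  have "sol2 (- Ln (1 - z)) (n + l) l m z =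
      C3 n m l * z ^ (m + n + 2 * l + 1) * frobenius (- int m) ?g 0 (1 - z)"
    unfolding sol2_def N C by simp
  then show ?thesis
    unfolding w(2) frobenius_log_free [OF admissible_coeff2 zl(1,2) [unfolded w(2)]] low
    unfolding finite_part2_def series2_def w_def [symmetric] w(2)
    by (simp add: algebra_simps)
qed

lemma sol3_log_free:
  assumes "z \<in> lens"
  shows "sol3 (- Ln ((1 - z) / z)) p q m z = finite_part3 p q m z +
    (- z) ^ q / (fact p * fact (m + p)) * series3 p q m z"
proof -
  let ?g = "coeff3 p q m"
  define w where "w = (z - 1) / z"
  note zl = lensD [OF assms]
  have w: "w \<noteq> 0" and tw: "(1 - z) / z = - w"
    using zl by (auto simp: w_def minus_divide_left)
  let ?S = "\<Sum>k<m. fact (p + k) * fact (m - k - 1) / (fact (m + q - k) * fact k) * w ^ k"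
  have low: "(- w) powi (- int m) * (\<Sum>j<m. deriv ?g (of_int (- int m + int j)) * (- w) ^ j) =
    - (w powi (- int m) * ?S)"
    by (rule negated_lower_sum [OF w], subst coeff3_lower) simp_all
  have S: "?S = (\<Sum>k<m. fact (p + k) * fact (m - k - 1) / (fact (m + q - k) * fact k) * ((z - 1) ^ k / z ^ k))"
    by (simp add: w_def power_divide)
  have wm: "z ^ q * w powi (- int m) = z ^ (m + q) * (z - 1) powi (- int m)"
    using zl by (simp add: w_def power_int_minus power_divide power_add field_simps)
  have middle: "(\<Sum>k\<le>q. deriv ?g (of_nat k) * ((1 - z) / z) ^ k) =
       (\<Sum>k\<le>q. fact (m + p + k) / (fact (m + k) * fact (q - k) * fact k)
                * (psi (m + p + k + 1) + psi (q - k + 1) - psi (m + k + 1) - psi (k + 1))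
                * ((1 - z) ^ k / z ^ k))"
    by (rule sum.cong) (simp_all add: coeff3_middle power_divide)
  have "frobenius (- int m) ?g 0 ((1 - z) / z) = - (w powi (- int m) * ?S) + powser (\<lambda>k. deriv ?g (of_nat k)) ((1 - z) / z)"
    unfolding tw frobenius_log_free [OF admissible_coeff3 zl(4,5) [unfolded tw]] low ..
  also have "powser (\<lambda>k. deriv ?g (of_nat k)) ((1 - z) / z) =
      (\<Sum>k\<le>q. deriv ?g (of_nat k) * ((1 - z) / z) ^ k) + (- 1) ^ q * series3 p q m z"
    by (cases "even q") (simp_all add: series3_def)
  finally have F: "frobenius (- int m) ?g 0 ((1 - z) / z) = - (w powi (- int m) * ?S) +
      ((\<Sum>k\<le>q. deriv ?g (of_nat k) * ((1 - z) / z) ^ k) + (- 1) ^ q * series3 p q m z)" .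
  have alg: "Z / D * (- (a * s) + (M + e * S)) = - (Z * a / D * s) + Z / D * M + (Z * e) / D * S"
    for Z D a s M e S :: complex
    by (simp add: divide_inverse algebra_simps)
  have "sol3 (- Ln ((1 - z) / z)) p q m z =
      z ^ q / (fact p * fact (m + p)) * frobenius (- int m) ?g 0 ((1 - z) / z)"
    unfolding sol3_def by simp
  also have "\<dots> =
      - (z ^ q * w powi (- int m) / (fact p * fact (m + p)) * ?S) +
      z ^ q / (fact p * fact (m + p)) * (\<Sum>k\<le>q. deriv ?g (of_nat k) * ((1 - z) / z) ^ k) +
      (z ^ q * (- 1) ^ q) / (fact p * fact (m + p)) * series3 p q m z"
    unfolding F by (rule alg)
  also have "z ^ q * (- 1) ^ q = (- z) ^ q"
    unfolding power_minus [of z] by simp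
  finally show ?thesis
    unfolding wm S middle finite_part3_def .
qed

text \<open>
  Formula (1) on the lens.  The sum over \<open>k < n\<close> there runs through the range \<open>l < k \<le> n + l\<close> downwards.
\<close>

lemma sol1_log_free:
  assumes "z \<in> lens"
  shows "log_coeff n m l z * Ln (1 - z) + sol1 (- Ln (1 - z)) (n + l) l m z = rhs1 n m l z"
proof -
  let ?g = "coeff1 (n + l) l m"
  note zl = lensD [OF assms]
  define w where "w = z - 1"
  have w: "w \<noteq> 0" "1 - z = - w" using zl by (auto simp: w_def)
  have low: "(- w) powi (- int m) * (\<Sum>j<m. deriv ?g (of_int (- int m + int j)) * (- w) ^ j) =
    - (w powi (- int m) * (\<Sum>k<m. fact (m - k - 1) / (fact (m + n + l - k) * fact (m + l - k) * fact k) * w ^ k))"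
    by (rule negated_lower_sum [OF w(1)], subst coeff1_lower) (simp_all add: add.assoc)
  have "powser (\<lambda>k. deriv ?g (of_nat k)) (- w) = (\<Sum>k\<le>n + l. deriv ?g (of_nat k) * (- w) ^ k)"
    by (rule powser_finite) (simp add: coeff1_double_zero)
  also have "{..n + l} = {..l} \<union> {l<..n + l}" by auto
  also have "(\<Sum>k\<in>{..l} \<union> {l<..n + l}. deriv ?g (of_nat k) * (- w) ^ k) =
      (\<Sum>k\<le>l. deriv ?g (of_nat k) * (- w) ^ k) + (\<Sum>k\<in>{l<..n + l}. deriv ?g (of_nat k) * (- w) ^ k)"
    by (rule sum.union_disjoint) auto
  also have "(\<Sum>k\<le>l. deriv ?g (of_nat k) * (- w) ^ k) =
      (\<Sum>k\<le>l. (psi (n + l - k + 1) + psi (l - k + 1) - psi (m + k + 1) - psi (k + 1))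
                / (fact (m + k) * fact (n + l - k) * fact (l - k) * fact k) * (1 - z) ^ k)"
    unfolding w(2) by (rule sum.cong) (simp_all add: coeff1_middle)
  also have "(\<Sum>k\<in>{l<..n + l}. deriv ?g (of_nat k) * (- w) ^ k) =
      (\<Sum>k<n. (- 1) ^ l * w ^ (n + l) *
        (fact (n - k - 1) / (fact (m + n + l - k) * fact (n + l - k) * fact k) * (1 / w ^ k)))"
  proof (rule sum.reindex_bij_witness [of _ "\<lambda>k. n + l - k" "\<lambda>k. n + l - k"])
    fix k assume k: "k \<in> {l<..n + l}"
    define i where "i = k - l"
    define j where "j = n + l - k"
    have k': "k = l + i" and n: "n = i + j" using k by (auto simp: i_def j_def)
    have d: "deriv ?g (of_nat k) = (- 1) ^ i * fact (i - 1) / (fact (m + k) * fact j * fact k)"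
      using coeff1_upper(2) [of l k "n + l" m] k by (simp add: i_def j_def)
    have ix: "n - (n + l - k) - 1 = i - 1" "m + n + l - (n + l - k) = m + k" "n + l - (n + l - k) = k"
      using k by (auto simp: i_def)
    have "(- 1) ^ i * (- w) ^ k = (- 1) ^ l * w ^ k"
      unfolding k' by (cases "even i"; cases "even l") simp_all
    moreover have "w ^ (n + l) * (1 / w ^ j) = w ^ k"
      using w(1) unfolding k' n by (simp add: power_add field_simps)
    ultimately have "(- 1) ^ i * (- w) ^ k = (- 1) ^ l * (w ^ (n + l) * (1 / w ^ j))" by simp
    then have "c * ((- 1) ^ i * (- w) ^ k) = c * ((- 1) ^ l * (w ^ (n + l) * (1 / w ^ j)))" for c by simp
    from this [of "fact (i - 1) / (fact (m + k) * fact j * fact k)"]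
    show "(- 1) ^ l * w ^ (n + l) * (fact (n - (n + l - k) - 1) /
        (fact (m + n + l - (n + l - k)) * fact (n + l - (n + l - k)) * fact (n + l - k)) * (1 / w ^ (n + l - k))) =
        deriv ?g (of_nat k) * (- w) ^ k"
      unfolding d ix unfolding j_def [symmetric] by (simp add: mult_ac)
  qed auto
  finally have up: "powser (\<lambda>k. deriv ?g (of_nat k)) (- w) =
      (\<Sum>k\<le>l. (psi (n + l - k + 1) + psi (l - k + 1) - psi (m + k + 1) - psi (k + 1))
                / (fact (m + k) * fact (n + l - k) * fact (l - k) * fact k) * (1 - z) ^ k) +
      (- 1) ^ l * w ^ (n + l) * (\<Sum>k<n. fact (n - k - 1) / (fact (m + n + l - k) * fact (n + l - k) * fact k) * (1 / w ^ k))"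
    by (simp only: sum_distrib_left)
  have "sol1 (- Ln (1 - z)) (n + l) l m z = frobenius (- int m) ?g 0 (1 - z)"
    by (simp add: sol1_def)
  then show ?thesis
    unfolding w(2) frobenius_log_free [OF admissible_coeff1 zl(1,2) [unfolded w(2)]] low up
    unfolding rhs1_def log_coeff_def w_def by simp
qed

section \<open>Analytic continuation\<close>

lemma right_slit_iff: "z \<in> right_slit \<longleftrightarrow> Im z = 0 \<and> Re z \<ge> 1"
  by (auto simp: right_slit_def image_iff complex_eq_iff)

lemma two_slit_plane_iff: "z \<in> two_slit_plane \<longleftrightarrow> (Im z = 0 \<longrightarrow> 0 < Re z \<and> Re z < 1)"
  by (auto simp: two_slit_plane_def right_slit_iff complex_nonpos_Reals_iff)

lemma two_slit_plane_altdef: "two_slit_plane = - (complex_of_real ` ({..0} \<union> {1..}))"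
  by (auto simp: two_slit_plane_iff image_iff complex_eq_iff)

lemma open_slit_complement: "open (- right_slit)"
proof -
  have "closed (complex_of_real ` {1..})"
    by (intro closed_injective_linear_image) (auto simp: inj_def bounded_linear.linear [OF bounded_linear_of_real])
  then show ?thesis by (simp add: right_slit_def open_Compl)
qed

lemma open_two_slit_plane: "open two_slit_plane"
  unfolding two_slit_plane_def using open_slit_complement
  by (simp add: open_Int Compl_Un open_Compl)

lemma connected_slit_complement: "connected (- right_slit)"
  unfolding right_slit_def by (intro starlike_imp_connected starlike_slotted_complex_plane_right)

lemma connected_two_slit_plane: "connected two_slit_plane"
  unfolding two_slit_plane_altdef by (intro starlike_imp_connected starlike_doubly_slotted_complex_plane) simp

lemma two_slit_plane_subset: "two_slit_plane \<subseteq> - right_slit - {0}"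
  by (auto simp: two_slit_plane_iff right_slit_iff)

lemma ball_subset_slit_complement: "ball 0 1 \<subseteq> - right_slit"
proof
  fix z :: complex assume "z \<in> ball 0 1"
  then have "Re z < 1" using complex_Re_le_cmod [of z] by simp
  then show "z \<in> - right_slit" by (auto simp: right_slit_iff)
qed

lemma lens_subset: "lens \<subseteq> two_slit_plane" "lens \<subseteq> ball 0 1" "lens \<subseteq> ball 1 1 - {1}"
proof -
  show "lens \<subseteq> two_slit_plane"
    using lensD by (auto simp: two_slit_plane_iff)
  show "lens \<subseteq> ball 0 1" by (auto simp: lens_def)
  show "lens \<subseteq> ball 1 1 - {1}" by (auto simp: lens_def)
qed

lemma lens_nonempty: "lens \<noteq> {}"
proof -
  have "norm (3 / 4 :: complex) < 1" "norm (1 - 3 / 4 :: complex) < 1 / 2" by simp_all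
  then have "3 / 4 \<in> lens" by (simp add: lens_def dist_norm)
  then show ?thesis by blast
qed

text \<open>
  What has been shown on the lens, where the expansions agree, extends by the identity theorem.
\<close>

lemma eq_from_lens:
  assumes "open D" "connected D" "lens \<subseteq> D" "f holomorphic_on D" "g holomorphic_on D"
    "\<And>z. z \<in> lens \<Longrightarrow> f z = g z" "z \<in> D"
  shows "f z = g z"
  by (rule analytic_continuation_open [OF open_lens assms(1) lens_nonempty assms(2,3)])
    (use assms in auto)

lemma closed_segment_half_plane:
  fixes z x :: complex
  assumes "norm (z - 1) < norm z" "x \<in> closed_segment (3 / 4) z"
  shows "norm (x - 1) < norm x"
proof -
  have iff: "norm (y - 1) < norm y \<longleftrightarrow> 1 / 2 < Re y" for y :: complex
  proof -
    have "norm (y - 1) < norm y \<longleftrightarrow> (norm (y - 1))\<^sup>2 < (norm y)\<^sup>2"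
      by (meson norm_ge_zero power2_less_imp_less power_strict_mono zero_less_numeral)
    then show ?thesis unfolding cmod_power2 by (simp add: power2_eq_square algebra_simps)
  qed
  obtain u where u: "0 \<le> u" "u \<le> 1" "x = (1 - u) *\<^sub>R (3 / 4) + u *\<^sub>R z"
    using assms(2) by (auto simp: closed_segment_def)
  have "1 / 2 < (1 - u) * (3 / 4) + u * Re z"
  proof (cases "u = 0")
    case False
    then have "u * (1 / 2) < u * Re z" using assms(1) u iff [of z] by simp
    then show ?thesis using u by argo
  qed simp
  then show ?thesis unfolding iff u(3) by simp
qed

text \<open>
  The region of convergence of the series in (3) and (4) is the half-plane \<open>Re z > 1/2\<close>.  The half-plane
  without the slit stays star-shaped with respect to any point of the interval \<open>(1/2, 1)\<close>.
\<close>

lemma region34_domain: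
  "open (region34 \<inter> two_slit_plane)" "connected (region34 \<inter> two_slit_plane)"
  "lens \<subseteq> region34 \<inter> two_slit_plane"
proof -
  have eq: "region34 \<inter> two_slit_plane = {z. norm (z - 1) < norm z} \<inter> two_slit_plane"
    using two_slit_plane_subset by (auto simp: norm_divide divide_simps split: if_splits)
  show "open (region34 \<inter> two_slit_plane)"
    unfolding eq by (intro open_Int open_Collect_less continuous_intros open_two_slit_plane)
  have "starlike (region34 \<inter> two_slit_plane)"
    unfolding starlike_def
  proof (rule bexI [of _ "3 / 4"]; (intro ballI)?)
    show "3 / 4 \<in> region34 \<inter> two_slit_plane" by (simp add: two_slit_plane_iff norm_divide)
    show "closed_segment (3 / 4) z \<subseteq> region34 \<inter> two_slit_plane" if "z \<in> region34 \<inter> two_slit_plane" for z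
    proof -
      have "closed_segment (complex_of_real (3 / 4)) z \<subseteq> two_slit_plane"
        using that starlike_doubly_slotted_complex_plane_aux [of z 0 1 "3 / 4"]
        by (simp add: two_slit_plane_altdef)
      moreover have "closed_segment (3 / 4) z \<subseteq> {z. norm (z - 1) < norm z}"
        using that closed_segment_half_plane unfolding eq by blast
      ultimately show ?thesis unfolding eq by simp
    qed
  qed
  then show "connected (region34 \<inter> two_slit_plane)" by (rule starlike_imp_connected)
  show "lens \<subseteq> region34 \<inter> two_slit_plane"
    using lensD(5) lens_subset(1) by (auto simp: norm_divide norm_minus_commute)
qed

lemma log_coeff_holomorphic [holomorphic_intros]: "log_coeff n m l holomorphic_on A"
proof -
  have "(\<lambda>z. \<Sum>k\<le>l. c k * z ^ k) holomorphic_on A" for c :: "nat \<Rightarrow> complex"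
    by (intro holomorphic_intros)
  then show ?thesis
    unfolding log_coeff_def [abs_def] P_def hyp2F1_terminating_def hyp2F1_summand_def
    by (rule holomorphic_on_mult [OF holomorphic_on_const])
qed

text \<open>
  What formula (1) adds to the logarithmic term: a polynomial in \<open>1 - z\<close> and its inverse.
\<close>

definition rational1 :: "nat \<Rightarrow> nat \<Rightarrow> nat \<Rightarrow> complex \<Rightarrow> complex" where
  "rational1 n m l z = rhs1 n m l z - log_coeff n m l z * Ln (1 - z)"

lemma rational1_holomorphic:
  assumes "1 \<notin> A"
  shows "rational1 n m l holomorphic_on A"
proof -
  have eq: "rational1 n m l = (\<lambda>z.
     (\<Sum>k\<le>l. (psi (n + l - k + 1) + psi (l - k + 1) - psi (m + k + 1) - psi (k + 1))
              / (fact (m + k) * fact (n + l - k) * fact (l - k) * fact k) * (1 - z) ^ k)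
     - (z - 1) powi (- int m) *
     (\<Sum>k<m. fact (m - k - 1) / (fact (m + n + l - k) * fact (m + l - k) * fact k) * (z - 1) ^ k)
     + (-1) ^ l * (z - 1) ^ (n + l) *
     (\<Sum>k<n. fact (n - k - 1) / (fact (m + n + l - k) * fact (n + l - k) * fact k)
              * (1 / (z - 1) ^ k)))"
    by (simp add: rational1_def rhs1_def log_coeff_def fun_eq_iff)
  have nz: "z \<noteq> 1" if "z \<in> A" for z using assms that by auto
  have sums: "(\<lambda>z. \<Sum>k\<in>K. c k * (1 - z) ^ k) holomorphic_on A"
    "(\<lambda>z. \<Sum>k\<in>K. c k * (z - 1) ^ k) holomorphic_on A"
    "(\<lambda>z. \<Sum>k\<in>K. c k * (1 / (z - 1) ^ k)) holomorphic_on A" for K and c :: "nat \<Rightarrow> complex"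
    by (intro holomorphic_intros, intro holomorphic_intros, intro holomorphic_intros) (simp add: nz)
  have factors: "(\<lambda>z. (z - 1) powi (- int m)) holomorphic_on A"
    "(\<lambda>z. (-1) ^ l * (z - 1) ^ (n + l)) holomorphic_on A"
    by (intro holomorphic_on_power_int holomorphic_intros, simp add: nz, intro holomorphic_intros)
  show ?thesis
    unfolding eq
    by (rule holomorphic_on_add [OF holomorphic_on_diff [OF sums(1)
          holomorphic_on_mult [OF factors(1) sums(2)]] holomorphic_on_mult [OF factors(2) sums(3)]])
qed

lemma one_minus_slit: "z \<in> - right_slit \<Longrightarrow> 1 - z \<notin> \<real>\<^sub>\<le>\<^sub>0"
  by (auto simp: right_slit_iff complex_nonpos_Reals_iff)

lemma rhs1_holomorphic: "rhs1 n m l holomorphic_on - right_slit"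
proof -
  have "(\<lambda>z. rational1 n m l z + log_coeff n m l z * Ln (1 - z)) holomorphic_on - right_slit"
  proof (rule holomorphic_on_add [OF _ holomorphic_on_mult [OF log_coeff_holomorphic]])
    show "rational1 n m l holomorphic_on - right_slit"
      by (rule rational1_holomorphic) (simp add: right_slit_iff)
    show "(\<lambda>z. Ln (1 - z)) holomorphic_on - right_slit"
      by (intro holomorphic_on_Ln' holomorphic_intros one_minus_slit)
  qed
  moreover have "(\<lambda>z. rational1 n m l z + log_coeff n m l z * Ln (1 - z)) = rhs1 n m l"
    by (simp add: rational1_def fun_eq_iff)
  ultimately show ?thesis by simp
qed

lemma sol0_holomorphic: "sol0 p q m holomorphic_on ball 0 1"
  unfolding sol0_def [abs_def]
  by (rule holomorphic_on_mult [OF _ powser_holomorphic [OF disc_summable_coeff0]])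
    (intro holomorphic_intros)

lemma sol0_eq_rhs1:
  assumes "norm z < 1"
  shows "sol0 (n + l) l m z = rhs1 n m l z"
proof (rule eq_from_lens [where D = "ball 0 1" and f = "sol0 (n + l) l m" and g = "rhs1 n m l"])
  show "rhs1 n m l holomorphic_on ball 0 1"
    using rhs1_holomorphic ball_subset_slit_complement holomorphic_on_subset by blast
  show "sol0 (n + l) l m w = rhs1 n m l w" if "w \<in> lens" for w
    using sol0_log_split(1) [OF that] sol1_log_free [OF that] by metis
qed (use assms lens_subset(2) sol0_holomorphic in simp_all)

lemma continued_sum_continues:
  assumes "continues_series t A D g"
  shows "continues_series t A D (continued_sum t A D)"
  unfolding continued_sum_def by (rule someI [of _ g]) (rule assms)

text \<open>
  Any explicit continuation may replace the chosen one.
\<close>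

lemma continued_sum_eq:
  assumes "continues_series t A D g" "open D" "connected D" "open S" "S \<noteq> {}" "S \<subseteq> A \<inter> D" "z \<in> D"
  shows "continued_sum t A D z = g z"
proof (rule analytic_continuation_open [of S D "continued_sum t A D" g])
  note c = continued_sum_continues [OF assms(1)]
  show "continued_sum t A D holomorphic_on D" "g holomorphic_on D"
    using c assms(1) by (simp_all add: continues_series_def)
  show "continued_sum t A D w = g w" if "w \<in> S" for w
    using c assms(1) that assms(6) sums_unique2 unfolding continues_series_def by blast
qed (use assms in auto)

lemma fact_add_pochhammer: "fact (N + j) = fact N * pochhammer (of_nat (Suc N)) j" for N :: nat
  by (induction j) (simp_all add: pochhammer_Suc algebra_simps)

lemma hyp2F1_summand_coeff0:
  "hyp2F1_summand (of_nat (m + l + 1)) (of_nat (m + n + l + 1)) (of_nat (m + n + 2 * l + 2)) k z =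
   fact (m + n + 2 * l + 1) * (coeff0 (n + l) l m k * z ^ k)"
proof -
  have "m + (n + l) + l + 1 + k = (m + n + 2 * l + 1) + k" by simp
  then have f: "fact (m + (n + l) + l + 1 + k) =
      (fact (m + n + 2 * l + 1) * pochhammer (of_nat (m + n + 2 * l + 2)) k :: complex)"
    using fact_add_pochhammer [of "m + n + 2 * l + 1" k, where ?'a = complex] by (simp only:) simp
  show ?thesis
    unfolding hyp2F1_summand_def coeff0_def f
    by (simp add: add.assoc mult_ac del: of_nat_add of_nat_Suc fact_Suc)
qed

lemma hyp2F1_sums:
  assumes "norm z < 1"
  shows "(\<lambda>k. hyp2F1_summand (of_nat (m + l + 1)) (of_nat (m + n + l + 1)) (of_nat (m + n + 2 * l + 2)) k z)
    sums (fact (m + n + 2 * l + 1) * powser (coeff0 (n + l) l m) z)"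
  unfolding hyp2F1_summand_coeff0 powser_def
  by (intro sums_mult summable_sums disc_summableD disc_summable_coeff0 assms)

text \<open>
  The right side of (1) is holomorphic off the slit, since it consists of elementary functions.  Divided
  by \<open>z\<^sup>N\<close> it continues the hypergeometric series, except at \<open>0\<close>, where the series itself is available.
\<close>

lemma hyp2F1_continuation:
  fixes n m l
  defines "F \<equiv> hyp2F1 (of_nat (m + l + 1)) (of_nat (m + n + l + 1)) (of_nat (m + n + 2 * l + 2))"
  shows "continues_series
       (hyp2F1_summand (of_nat (m + l + 1)) (of_nat (m + n + l + 1)) (of_nat (m + n + 2 * l + 2)))
       {z. norm z < 1} (- right_slit) F"
    and "z \<in> - right_slit \<Longrightarrow> U3 n m l z = rhs1 n m l z"
proof -
  let ?N = "m + n + 2 * l + 1"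
  let ?t = "hyp2F1_summand (of_nat (m + l + 1)) (of_nat (m + n + l + 1)) (of_nat (m + n + 2 * l + 2))"
  let ?S = "\<lambda>z. fact ?N * powser (coeff0 (n + l) l m) z"
  \<comment> \<open>The definition of \<open>U3\<close>, solved for the hypergeometric function.\<close>
  let ?G = "\<lambda>z. fact ?N * (- 1) ^ (m + 1) * rhs1 n m l z / z ^ ?N"
  let ?g = "\<lambda>z. if z \<in> ball 0 1 then ?S z else ?G z"
  have eq: "rhs1 n m l z = (- 1) ^ (m + 1) * z ^ ?N * powser (coeff0 (n + l) l m) z" if "norm z < 1" for z
    using sol0_eq_rhs1 [OF that, of n l m] unfolding sol0_def by (simp add: mult_2 add.assoc add.left_commute)
  have "?g holomorphic_on ball 0 1 \<union> (- right_slit - {0})"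
  proof (rule holomorphic_on_If_Un)
    show "?S holomorphic_on ball 0 1"
      by (rule holomorphic_on_mult [OF _ powser_holomorphic [OF disc_summable_coeff0]])
        (intro holomorphic_intros)
    show "?G holomorphic_on - right_slit - {0}"
      by (intro holomorphic_intros holomorphic_on_subset [OF rhs1_holomorphic]) auto
    show "open (- right_slit - {0})" using open_slit_complement by (rule open_delete)
    show "?S z = ?G z" if "z \<in> ball 0 1" "z \<in> - right_slit - {0}" for z
      using that eq [of z] by (cases "even m") auto
  qed auto
  moreover have "- right_slit \<subseteq> ball 0 1 \<union> (- right_slit - {0})" by auto
  ultimately have "?g holomorphic_on - right_slit" by (rule holomorphic_on_subset)
  then have g: "continues_series ?t {z. norm z < 1} (- right_slit) ?g"
    unfolding continues_series_def using hyp2F1_sums by auto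
  then show "continues_series ?t {z. norm z < 1} (- right_slit) F"
    unfolding F_def hyp2F1_def by (rule continued_sum_continues)
  show "U3 n m l z = rhs1 n m l z" if z: "z \<in> - right_slit"
  proof -
    have "F z = ?g z"
      unfolding F_def hyp2F1_def
      by (rule continued_sum_eq [OF g open_slit_complement connected_slit_complement open_ball [of 0 1] _ _ z])
        (use ball_subset_slit_complement in auto)
    then have "U3 n m l z = (- 1) ^ (m + 1) / fact ?N * z ^ ?N * ?g z"
      unfolding U3_def F_def by simp
    also have "\<dots> = rhs1 n m l z"
    proof (cases "norm z < 1")
      case True
      then show ?thesis using eq [OF True] by (simp del: fact_Suc)
    next
      case False
      then have "z \<noteq> 0" by auto
      with False show ?thesis by (cases "even m") (simp_all del: fact_Suc power_Suc)
    qed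
    finally show ?thesis .
  qed
qed

lemma C3_nonzero: "C3 n m l \<noteq> 0"
  by (simp add: C3_def)

lemma finite_part2_holomorphic:
  assumes "1 \<notin> A"
  shows "finite_part2 n m l holomorphic_on A"
proof -
  have nz: "z \<noteq> 1" if "z \<in> A" for z using assms that by auto
  have sums: "(\<lambda>z. \<Sum>k\<in>K. c k * (z - 1) ^ k) holomorphic_on A" for K and c :: "nat \<Rightarrow> complex"
    by (intro holomorphic_intros)
  show ?thesis
    unfolding finite_part2_def [abs_def]
    by (rule holomorphic_on_mult [OF _ sums], rule holomorphic_on_mult [OF _ holomorphic_on_power_int])
      (auto simp: nz intro!: holomorphic_intros)
qed

lemma finite_part3_holomorphic:
  assumes "1 \<notin> A" "0 \<notin> A"
  shows "finite_part3 p q m holomorphic_on A"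
proof -
  have nz: "z \<noteq> 1" "z \<noteq> 0" if "z \<in> A" for z using assms that by auto
  have sums: "(\<lambda>z. \<Sum>k\<in>K. c k * ((z - 1) ^ k / z ^ k)) holomorphic_on A"
    "(\<lambda>z. \<Sum>k\<in>K. c k * ((1 - z) ^ k / z ^ k)) holomorphic_on A" for K and c :: "nat \<Rightarrow> complex"
    by (intro holomorphic_intros, simp add: nz, intro holomorphic_intros, simp add: nz)
  have factors: "(\<lambda>z. z ^ (m + q) * (z - 1) powi (- int m) / c) holomorphic_on A"
    "(\<lambda>z. z ^ q / c) holomorphic_on A" if "c \<noteq> 0" for c :: complex
    using that nz
    by (auto intro!: holomorphic_on_divide holomorphic_on_mult holomorphic_on_power_int holomorphic_intros)
  show ?thesis
    unfolding finite_part3_def [abs_def]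
    by (rule holomorphic_on_add [OF holomorphic_on_minus [OF holomorphic_on_mult [OF factors(1) sums(1)]]
        holomorphic_on_mult [OF factors(2) sums(2)]]) simp_all
qed

text \<open>
  Formulas (1) and (2) contain the same logarithmic term.  Solving them for the infinite series leaves a
  rational function that can have poles at \<open>0\<close> and \<open>1\<close> only.  Around \<open>1\<close> it agrees with the convergent
  series, so the singularity there is removable.
\<close>

lemma summand2_continuation:
  shows "continues_series (summand2 n m l) region2 (- {0}) (continued_sum (summand2 n m l) region2 (- {0}))"
    and "z \<in> - right_slit - {0} \<Longrightarrow> rhs2 n m l z = rhs1 n m l z"
proof -
  let ?N = "m + n + 2 * l + 1"
  let ?A = "\<lambda>z. (rational1 n m l z - finite_part2 n m l z) / (C3 n m l * z ^ ?N)"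
  let ?g = "\<lambda>z. if z \<in> ball 1 1 then series2 n m l z else ?A z"
  have region2: "region2 = ball 1 1" by (auto simp: dist_norm)
  have A: "?A holomorphic_on D" if "D \<subseteq> - {0, 1}" for D
    using that C3_nonzero by (intro holomorphic_intros rational1_holomorphic finite_part2_holomorphic) auto
  have "series2 n m l = powser (\<lambda>k. deriv (coeff2 (n + l) l m) (of_nat k)) \<circ> (\<lambda>z. 1 - z)"
    by (simp add: series2_def fun_eq_iff)
  then have series: "series2 n m l holomorphic_on ball 1 1"
    by (auto intro!: holomorphic_on_compose_gen [OF _ powser_holomorphic [OF disc_summable_deriv(1)]] holomorphic_intros
        simp: dist_norm norm_minus_commute)
  have zero: "z \<noteq> 0" if "z \<in> ball 1 1" for z :: complex using that by auto
  have eq: "series2 n m l z = ?A z" if "z \<in> ball 1 1 - {1}" for z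
  proof (rule eq_from_lens [where D = "ball 1 1 - {1}" and f = "series2 n m l" and g = ?A])
    show "connected (ball 1 1 - {1 :: complex})" by (rule connected_punctured_ball) simp
    show "series2 n m l holomorphic_on ball 1 1 - {1}" using series holomorphic_on_subset by blast
    show "?A holomorphic_on ball 1 1 - {1}" by (rule A) (use zero in auto)
    show "series2 n m l z = ?A z" if z: "z \<in> lens" for z
    proof -
      have "z \<noteq> 0" using lensD [OF z] by simp
      moreover have "rational1 n m l z = finite_part2 n m l z + C3 n m l * z ^ ?N * series2 n m l z"
      proof -
        have e: "rhs1 n m l z = log_coeff n m l z * Ln (1 - z) + sol2 (- Ln (1 - z)) (n + l) l m z"
          using sol0_log_split(1,2) [OF z, of n l m] sol1_log_free [OF z, of n m l] by metis
        show ?thesis unfolding rational1_def e sol2_log_free [OF z] by simp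
      qed
      ultimately show ?thesis using C3_nonzero [of n m l] by simp
    qed
  qed (use lens_subset that in auto)
  have "?g holomorphic_on ball 1 1 \<union> - {0, 1}"
    by (rule holomorphic_on_If_Un [OF series A]) (use eq in \<open>auto intro: open_Compl\<close>)
  moreover have "- {0} \<subseteq> ball 1 1 \<union> - {0, 1 :: complex}" by auto
  ultimately have "?g holomorphic_on - {0}" by (rule holomorphic_on_subset)
  then have g: "continues_series (summand2 n m l) region2 (- {0}) ?g"
    unfolding continues_series_def region2 by (auto intro!: summand2_sums simp: dist_norm)
  then show "continues_series (summand2 n m l) region2 (- {0}) (continued_sum (summand2 n m l) region2 (- {0}))"
    by (rule continued_sum_continues)
  show "rhs2 n m l z = rhs1 n m l z" if z: "z \<in> - right_slit - {0}"
  proof -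
    have "z \<noteq> 1" "z \<noteq> 0" using z by (auto simp: right_slit_iff)
    have "continued_sum (summand2 n m l) region2 (- {0}) z = ?g z"
      by (rule continued_sum_eq [OF g _ _ open_ball [of 1 1]])
        (use zero \<open>z \<noteq> 0\<close> in \<open>auto simp: dist_norm intro: connected_punctured_universe\<close>)
    also have "\<dots> = ?A z" using eq [of z] \<open>z \<noteq> 1\<close> by auto
    finally show ?thesis
      unfolding rhs_decomposition(1) using \<open>z \<noteq> 0\<close> C3_nonzero [of n m l] by (simp add: rational1_def)
  qed
qed

text \<open>
  Here two different logarithms meet and the continuation is confined to the doubly slit plane.
\<close>

lemma tail3_continuation:
  assumes lens: "\<And>z. z \<in> lens \<Longrightarrow> rhs1 n m l z = log_coeff n m l z * Ln ((1 - z) / z) + finite_part3 p q k z +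
      (- z) ^ q / (fact p * fact (k + p)) * series3 p q k z"
  shows "continues_series (tail3 p q k) region34 two_slit_plane (continued_sum (tail3 p q k) region34 two_slit_plane)"
    and "z \<in> two_slit_plane \<Longrightarrow> rhs1 n m l z = log_coeff n m l z * Ln ((1 - z) / z) + finite_part3 p q k z +
      (- z) ^ q / (fact p * fact (k + p)) * continued_sum (tail3 p q k) region34 two_slit_plane z"
proof -
  let ?D = "region34 \<inter> two_slit_plane"
  let ?c = "\<lambda>z. (- z) ^ q / (fact p * fact (k + p)) :: complex"
  let ?g = "\<lambda>z. (rhs1 n m l z - log_coeff n m l z * Ln ((1 - z) / z) - finite_part3 p q k z) / ?c z"
  have c: "?c z \<noteq> 0" if "z \<in> two_slit_plane" for z
    using that two_slit_plane_subset by auto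
  have quotient: "(1 - z) / z \<notin> \<real>\<^sub>\<le>\<^sub>0" if "z \<in> two_slit_plane" for z
  proof
    assume "(1 - z) / z \<in> \<real>\<^sub>\<le>\<^sub>0"
    then obtain r where r: "(1 - z) / z = complex_of_real r" "r \<le> 0" by (rule nonpos_Reals_cases)
    moreover have "z \<noteq> 0" using that two_slit_plane_subset by auto
    ultimately have *: "1 = complex_of_real (1 + r) * z" by (simp add: field_simps)
    have "inverse (complex_of_real (1 + r)) = z"
      by (rule inverse_unique) (rule * [symmetric])
    then have "z = complex_of_real (inverse (1 + r))" by simp
    then have "Re z = inverse (1 + r)" "Im z = 0"
      by (simp_all only: Re_complex_of_real Im_complex_of_real)
    then have "0 < inverse (1 + r)" "inverse (1 + r) < 1" using that by (auto simp: two_slit_plane_iff)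
    then show False using r(2) by (smt (verit) one_le_inverse inverse_positive_iff_positive)
  qed
  have g: "?g holomorphic_on two_slit_plane"
    using c quotient two_slit_plane_subset
    by (intro holomorphic_intros finite_part3_holomorphic holomorphic_on_subset [OF rhs1_holomorphic])
      (auto simp: two_slit_plane_iff)
  have series: "series3 p q k holomorphic_on ?D"
  proof -
    have t: "(\<lambda>z. (1 - z) / z) holomorphic_on ?D"
      using two_slit_plane_subset by (intro holomorphic_intros) auto
    have "powser (\<lambda>j. deriv (coeff3 p q k) (of_nat j)) \<circ> (\<lambda>z. (1 - z) / z) holomorphic_on ?D"
      by (rule holomorphic_on_compose_gen [OF t powser_holomorphic [OF disc_summable_deriv(2)]])
        (auto simp: norm_divide norm_minus_commute)
    then show ?thesis
      unfolding series3_def [abs_def] using t by (intro holomorphic_intros) (auto simp: o_def two_slit_plane_iff)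
  qed
  have eq: "series3 p q k z = ?g z" if "z \<in> ?D" for z
  proof (rule eq_from_lens [where f = "series3 p q k" and g = ?g, OF region34_domain series _ _ that])
    show "?g holomorphic_on ?D" using g holomorphic_on_subset by blast
    show "series3 p q k z = ?g z" if z: "z \<in> lens" for z
      using lens [OF z] c [of z] lens_subset(1) z by auto
  qed
  have "(\<lambda>j. tail3 p q k j z) sums ?g z" if "z \<in> ?D" for z
    using tail3_sums [of z p q k] eq [OF that] that by (simp add: norm_divide norm_minus_commute)
  with g have cg: "continues_series (tail3 p q k) region34 two_slit_plane ?g"
    unfolding continues_series_def by blast
  then show "continues_series (tail3 p q k) region34 two_slit_plane (continued_sum (tail3 p q k) region34 two_slit_plane)"
    by (rule continued_sum_continues)
  show "rhs1 n m l z = log_coeff n m l z * Ln ((1 - z) / z) + finite_part3 p q k z +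
      ?c z * continued_sum (tail3 p q k) region34 two_slit_plane z" if z: "z \<in> two_slit_plane"
  proof -
    have "continued_sum (tail3 p q k) region34 two_slit_plane z = ?g z"
      by (rule continued_sum_eq [OF cg open_two_slit_plane connected_two_slit_plane open_lens lens_nonempty
            region34_domain(3) z])
    then show ?thesis using c [OF z] by simp
  qed
qed

lemma summand34_continuation:
  shows "continues_series (summand3 n m l) region34 two_slit_plane (continued_sum (summand3 n m l) region34 two_slit_plane)"
    and "continues_series (summand4 n m l) region34 two_slit_plane (continued_sum (summand4 n m l) region34 two_slit_plane)"
    and "z \<in> two_slit_plane \<Longrightarrow> rhs3 n m l z = rhs1 n m l z"
    and "z \<in> two_slit_plane \<Longrightarrow> rhs4 n m l z = rhs1 n m l z"
proof -
  have lens: "rhs1 n m l z = log_coeff n m l z * Ln ((1 - z) / z) + finite_part3 (n + l) l m z +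
      (- z) ^ l / (fact (n + l) * fact (m + (n + l))) * series3 (n + l) l m z"
    "rhs1 n m l z = log_coeff n m l z * Ln ((1 - z) / z) + finite_part3 l (n + l) m z +
      (- z) ^ (n + l) / (fact l * fact (m + l)) * series3 l (n + l) m z" if z: "z \<in> lens" for z
  proof -
    have e: "rhs1 n m l z = sol0 (n + l) l m z"
      using sol0_log_split(1) [OF z, of n l m] sol1_log_free [OF z, of n m l] by simp
    show "rhs1 n m l z = log_coeff n m l z * Ln ((1 - z) / z) + finite_part3 (n + l) l m z +
      (- z) ^ l / (fact (n + l) * fact (m + (n + l))) * series3 (n + l) l m z"
      unfolding e sol0_log_split(3) [OF z] sol3_log_free [OF z] add.assoc ..
    show "rhs1 n m l z = log_coeff n m l z * Ln ((1 - z) / z) + finite_part3 l (n + l) m z +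
      (- z) ^ (n + l) / (fact l * fact (m + l)) * series3 l (n + l) m z"
      unfolding e sol0_log_split(4) [OF z] sol3_log_free [OF z] add.assoc ..
  qed
  show "continues_series (summand3 n m l) region34 two_slit_plane (continued_sum (summand3 n m l) region34 two_slit_plane)"
    "continues_series (summand4 n m l) region34 two_slit_plane (continued_sum (summand4 n m l) region34 two_slit_plane)"
    unfolding rhs_decomposition(4,5)
    using tail3_continuation(1) [OF lens(1)] tail3_continuation(1) [OF lens(2)] by blast+
  show "rhs3 n m l z = rhs1 n m l z" "rhs4 n m l z = rhs1 n m l z" if z: "z \<in> two_slit_plane"
    unfolding rhs_decomposition(2-5)
    using tail3_continuation(2) [OF lens(1) z] tail3_continuation(2) [OF lens(2) z] by (simp_all add: add.assoc)
qed

section \<open>The interchange of the two parameters\<close>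

definition involution :: "complex \<Rightarrow> complex" where
  "involution z = z / (z - 1)"

lemma involution_slit: "z \<in> - right_slit \<Longrightarrow> involution z \<in> - right_slit"
proof -
  assume z: "z \<in> - right_slit"
  then have "z \<noteq> 1" by (auto simp: right_slit_iff)
  show "involution z \<in> - right_slit"
  proof
    assume "involution z \<in> right_slit"
    then obtain r where r: "r \<ge> 1" "z / (z - 1) = complex_of_real r"
      by (auto simp: right_slit_def involution_def)
    then have "complex_of_real (r - 1) * z = complex_of_real r"
      using \<open>z \<noteq> 1\<close> by (simp add: field_simps)
    moreover have "r \<noteq> 1" using calculation by auto
    ultimately have "z = complex_of_real (r / (r - 1))"
      by (simp add: field_simps)
    moreover have "r / (r - 1) \<ge> 1" using r \<open>r \<noteq> 1\<close> by (simp add: field_simps)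
    ultimately show False using z by (auto simp: right_slit_iff)
  qed
qed

lemma small_ball:
  assumes "z \<in> ball 0 (1 / 2)"
  shows "norm z < 1" "norm (involution z) < 1" "z \<noteq> 1"
proof -
  have z: "norm z < 1 / 2" using assms by simp
  have "1 \<le> norm z + norm (1 - z)" using norm_triangle_ineq [of z "1 - z"] by simp
  then have lt: "norm z < norm (z - 1)" using z by (simp add: norm_minus_commute)
  show "norm z < 1" using z by simp
  show "z \<noteq> 1" using z by auto
  show "norm (involution z) < 1"
    using lt by (simp add: involution_def norm_divide divide_less_eq)
qed

text \<open>
  The interchanged expression, with \<open>m\<close> and \<open>n\<close> exchanged and \<open>z / (z - 1)\<close> in place of \<open>z\<close>.  In terms of
  \<open>(p, q, m) = (n + l, l, m)\<close> the interchanged parameters are \<open>(m + l, l, n)\<close>.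
\<close>

definition reflected :: "nat \<Rightarrow> nat \<Rightarrow> nat \<Rightarrow> complex \<Rightarrow> complex" where
  "reflected n m l z = - ((1 - z) ^ l * sol0 (m + l) l n (involution z))"

text \<open>
  The substitution exchanges the operators that raise \<open>p\<close> and \<open>m\<close>, and turns the diagonal operator into
  the one that raises \<open>q\<close>.  Thus \<open>reflected\<close> obeys the relations of \<open>sol0\<close>.  The factor \<open>1 - z\<close> in the third
  relation comes from \<open>1 - z / (z - 1) = 1 / (1 - z)\<close>.
\<close>

lemma reflected_derivative:
  assumes z: "z \<in> ball 0 (1 / 2)"
  obtains R' where "(reflected n m l has_field_derivative R') (at z)"
    "z * (1 - z) * R' - (of_nat (m + n + l + l + 1) - of_nat l * z) * reflected n m l z =
       - of_nat ((n + l + 1) * (m + n + l + 1)) * reflected (Suc n) m l z"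
    "(1 - z) * (z * R' - of_nat (m + n + l + l + 1) * reflected n m l z) =
       (1 - z) * (- of_nat ((m + n + l + 1) * (m + l + 1)) * reflected n (Suc m) l z)"
    "n = Suc k \<Longrightarrow> z * (1 - z) * R' - (of_nat (m + n + l + l + 1) - of_nat (n + l) * z) * reflected n m l z =
       - of_nat ((l + 1) * (m + l + 1)) * reflected k m (Suc l) z"
proof -
  define w where "w = involution z"
  define V where "V = sol0 (m + l) l n w"
  define Q where "Q = (1 - z) ^ l"
  have w: "norm w < 1" and z1: "1 - z \<noteq> 0" using small_ball [OF z] by (auto simp: w_def)
  have wz: "w * (1 - z) = - z"
    using z1 by (simp add: w_def involution_def field_simps)
  have w1: "(1 - w) * (1 - z) = 1" using wz by (simp add: algebra_simps)
  obtain V' where V': "(sol0 (m + l) l n has_field_derivative V') (at w)"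
    and p: "w * (1 - w) * V' - (of_nat (n + (m + l) + l + 1) - of_nat l * w) * V =
       - of_nat ((m + l + 1) * (n + (m + l) + 1)) * sol0 (Suc (m + l)) l n w"
    and q: "w * V' - of_nat (n + (m + l) + l + 1) * V =
       - of_nat ((n + (m + l) + 1) * (n + l + 1)) * sol0 (m + l) l (Suc n) w"
    and d: "n = Suc k \<Longrightarrow> w * (1 - w) * V' - (of_nat (n + (m + l) + l + 1) - of_nat (m + l + l + 1) * w) * V =
       - of_nat ((m + l + 1) * (l + 1)) * sol0 (Suc (m + l)) (Suc l) k w"
    using sol0_derivative [OF w, of "m + l" l n k] unfolding V_def by metis
  define e where "e = - 1 / (z - 1)\<^sup>2"
  define R' where "R' = - (- of_nat l * (1 - z) ^ (l - 1) * V + V' * e * Q)"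
  have dw: "(involution has_field_derivative e) (at z)"
    unfolding involution_def [abs_def] e_def using z1
    by (auto intro!: derivative_eq_intros simp: power2_eq_square field_simps)
  have "((\<lambda>z. sol0 (m + l) l n (involution z)) has_field_derivative V' * e) (at z)"
    by (rule DERIV_chain2 [OF V' [unfolded w_def] dw])
  moreover have "((\<lambda>z. (1 - z) ^ l) has_field_derivative - of_nat l * (1 - z) ^ (l - 1)) (at z)"
    by (auto intro!: derivative_eq_intros)
  ultimately have "((\<lambda>z. (1 - z) ^ l * sol0 (m + l) l n (involution z)) has_field_derivative
      - of_nat l * (1 - z) ^ (l - 1) * V + V' * e * Q) (at z)"
    unfolding V_def Q_def w_def by (rule DERIV_mult [rotated])
  then have 1: "(reflected n m l has_field_derivative R') (at z)"
    unfolding reflected_def [abs_def] R'_def by (rule DERIV_minus)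
  have R: "reflected n m l z = - (Q * V)"
    by (simp add: reflected_def Q_def V_def w_def)
  have zR': "z * (1 - z) * R' = Q * (of_nat l * z * V - w * V')"
  proof -
    have "of_nat l * (1 - z) ^ (l - 1) * (1 - z) = of_nat l * Q" by (cases l) (auto simp: Q_def)
    moreover have "z * (1 - z) * e = w"
    proof -
      have "z * - d * (- 1 / d\<^sup>2) = z / d" if "d \<noteq> 0" for d
        using that by (simp add: power2_eq_square)
      from this [of "z - 1"] show ?thesis
        using z1 by (simp add: e_def w_def involution_def)
    qed
    moreover have "z * (1 - z) * (- (- a * b * V + V' * f * Q)) = Q * (a * z * V - w * V')"
      if "a * b * (1 - z) = a * Q" "z * (1 - z) * f = w" for a b f
      using that by algebra
    ultimately show ?thesis unfolding R'_def by blast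
  qed
  have N: "of_nat (m + n + l + l + 1) = (of_nat m + of_nat n + of_nat l + of_nat l + 1 :: complex)"
    "of_nat (n + (m + l) + l + 1) = (of_nat m + of_nat n + of_nat l + of_nat l + 1 :: complex)"
    "of_nat (m + l + l + 1) = (of_nat m + of_nat l + of_nat l + 1 :: complex)"
    "of_nat (n + l) = (of_nat n + of_nat l :: complex)" by simp_all
  have R_n: "of_nat ((n + l + 1) * (m + n + l + 1)) * reflected (Suc n) m l z =
      - (Q * (of_nat ((n + (m + l) + 1) * (n + l + 1)) * sol0 (m + l) l (Suc n) w))"
    by (simp add: reflected_def Q_def w_def algebra_simps)
  have R_m: "of_nat ((m + n + l + 1) * (m + l + 1)) * reflected n (Suc m) l z =
      - (Q * (of_nat ((m + l + 1) * (n + (m + l) + 1)) * sol0 (Suc (m + l)) l n w))"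
    by (simp add: reflected_def Q_def w_def algebra_simps)
  have R_l: "of_nat ((l + 1) * (m + l + 1)) * reflected k m (Suc l) z =
      - (Q * (1 - z) * (of_nat ((m + l + 1) * (l + 1)) * sol0 (Suc (m + l)) (Suc l) k w))"
    by (simp add: reflected_def Q_def w_def algebra_simps)
  have 2: "z * (1 - z) * R' - (of_nat (m + n + l + l + 1) - of_nat l * z) * reflected n m l z =
       - of_nat ((n + l + 1) * (m + n + l + 1)) * reflected (Suc n) m l z"
    unfolding mult_minus_left R_n R zR' using q unfolding N mult_minus_left by algebra
  have 3: "(1 - z) * (z * R' - of_nat (m + n + l + l + 1) * reflected n m l z) =
       (1 - z) * (- of_nat ((m + n + l + 1) * (m + l + 1)) * reflected n (Suc m) l z)"
    unfolding mult_minus_left R_m R using zR' p wz w1 unfolding N mult_minus_left by algebra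
  have 4: "z * (1 - z) * R' - (of_nat (m + n + l + l + 1) - of_nat (n + l) * z) * reflected n m l z =
       - of_nat ((l + 1) * (m + l + 1)) * reflected k m (Suc l) z" if "n = Suc k"
    unfolding mult_minus_left R_l R using zR' d [OF that] wz w1 unfolding N mult_minus_left by algebra
  show thesis by (rule that [OF 1 2 3 4])
qed

lemma sol0_reflection_step:
  assumes eq: "\<And>z. z \<in> ball 0 (1 / 2) \<Longrightarrow> sol0 (n + l) l m z = reflected n m l z"
    and z: "z \<in> ball 0 (1 / 2)"
  shows "sol0 (Suc n + l) l m z = reflected (Suc n) m l z"
    and "sol0 (n + l) l (Suc m) z = reflected n (Suc m) l z"
    and "n = Suc k \<Longrightarrow> sol0 (k + Suc l) (Suc l) m z = reflected k m (Suc l) z"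
proof -
  obtain V' where V: "(sol0 (n + l) l m has_field_derivative V') (at z)"
     "z * (1 - z) * V' - (of_nat (m + (n + l) + l + 1) - of_nat l * z) * sol0 (n + l) l m z =
       - of_nat ((n + l + 1) * (m + (n + l) + 1)) * sol0 (Suc (n + l)) l m z"
     "z * (1 - z) * V' - (of_nat (m + (n + l) + l + 1) - of_nat (n + l) * z) * sol0 (n + l) l m z =
       - of_nat ((l + 1) * (m + l + 1)) * sol0 (n + l) (Suc l) m z"
     "z * V' - of_nat (m + (n + l) + l + 1) * sol0 (n + l) l m z =
       - of_nat ((m + (n + l) + 1) * (m + l + 1)) * sol0 (n + l) l (Suc m) z"
    using ladderE [OF ladder_sol0, of z "n + l" l m] small_ball(1) [OF z]
    by (metis mem_ball_0)
  obtain R' where R: "(reflected n m l has_field_derivative R') (at z)"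
    "z * (1 - z) * R' - (of_nat (m + n + l + l + 1) - of_nat l * z) * reflected n m l z =
       - of_nat ((n + l + 1) * (m + n + l + 1)) * reflected (Suc n) m l z"
    "(1 - z) * (z * R' - of_nat (m + n + l + l + 1) * reflected n m l z) =
       (1 - z) * (- of_nat ((m + n + l + 1) * (m + l + 1)) * reflected n (Suc m) l z)"
    "n = Suc k \<Longrightarrow> z * (1 - z) * R' - (of_nat (m + n + l + l + 1) - of_nat (n + l) * z) * reflected n m l z =
       - of_nat ((l + 1) * (m + l + 1)) * reflected k m (Suc l) z"
    using reflected_derivative [OF z] by metis
  have "(sol0 (n + l) l m has_field_derivative R') (at z)"
    by (rule has_field_derivative_transform_within_open [OF R(1) open_ball z]) (use eq in simp)
  then have V'R': "V' = R'" using V(1) DERIV_unique by blast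
  have cancel: "v = w" if "- of_nat ((a + 1) * (c + 1)) * v = - of_nat ((a + 1) * (c + 1)) * w"
    for a c :: nat and v w :: complex
    using that by (simp del: of_nat_mult of_nat_add of_nat_Suc)
  note V = V [unfolded V'R' eq [OF z] add.assoc [symmetric]]
  show "sol0 (Suc n + l) l m z = reflected (Suc n) m l z"
    using cancel [OF trans [OF V(2) [symmetric] R(2)]] by simp
  have "1 - z \<noteq> 0" using small_ball(3) [OF z] by simp
  note R3 = R(3) [unfolded mult_left_cancel [OF this]]
  show "sol0 (n + l) l (Suc m) z = reflected n (Suc m) l z"
    by (rule cancel [OF trans [OF V(4) [symmetric] R3]])
  show "sol0 (k + Suc l) (Suc l) m z = reflected k m (Suc l) z" if n: "n = Suc k"
  proof -
    have "sol0 (n + l) (Suc l) m z = reflected k m (Suc l) z"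
      by (rule cancel [OF trans [OF V(3) [symmetric] R(4) [OF n]]])
    moreover have "n + l = k + Suc l" using n by simp
    ultimately show ?thesis by simp
  qed
qed

text \<open>
  From \<open>l = 0\<close> one reaches all parameters: first \<open>n\<close>, then \<open>m\<close> is raised.  A step in \<open>l\<close> lowers \<open>n\<close>, hence
  the induction on \<open>l\<close> is over all \<open>n\<close> at once.
\<close>

lemma sol0_reflection:
  assumes "z \<in> ball 0 (1 / 2)"
  shows "sol0 (n + l) l m z = reflected n m l z"
proof -
  have base: "\<forall>z\<in>ball 0 (1 / 2). sol0 (0 + 0) 0 0 z = reflected 0 0 0 z"
  proof
    fix z :: complex assume z: "z \<in> ball 0 (1 / 2)"
    note zs = small_ball [OF z]
    have "1 - involution z = inverse (1 - z)"
      using zs(3) by (simp add: involution_def field_simps)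
    moreover have "1 - z \<notin> \<real>\<^sub>\<le>\<^sub>0"
      using zs(1) ball_subset_slit_complement by (intro one_minus_slit) auto
    ultimately have "Ln (1 - involution z) = - Ln (1 - z)"
      using Ln_inverse by simp
    then show "sol0 (0 + 0) 0 0 z = reflected 0 0 0 z"
      using zs by (simp add: reflected_def sol0_base)
  qed
  have "\<forall>z\<in>ball 0 (1 / 2). sol0 (n + 0) 0 0 z = reflected n 0 0 z" for n
    by (induction n) (use base sol0_reflection_step(1) in blast)+
  then have "\<forall>z\<in>ball 0 (1 / 2). sol0 (n + 0) 0 m z = reflected n m 0 z" for n m
    by (induction m) (use sol0_reflection_step(2) in blast)+
  then have "\<forall>z\<in>ball 0 (1 / 2). sol0 (n + l) l m z = reflected n m l z" for n m
    by (induction l arbitrary: n) (use sol0_reflection_step(3) in blast)+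
  then show ?thesis using assms by blast
qed

lemma rhs1_reflection:
  assumes "z \<in> - right_slit"
  shows "rhs1 n m l z = - ((1 - z) ^ l * rhs1 m n l (involution z))"
proof (rule analytic_continuation_open [of "ball 0 (1 / 2)" "- right_slit" "rhs1 n m l"
      "\<lambda>z. - ((1 - z) ^ l * rhs1 m n l (involution z))"])
  have "involution holomorphic_on - right_slit"
    unfolding involution_def [abs_def] by (intro holomorphic_intros) (auto simp: right_slit_iff)
  then have "(rhs1 m n l \<circ> involution) holomorphic_on - right_slit"
    using involution_slit by (intro holomorphic_on_compose_gen [OF _ rhs1_holomorphic]) auto
  then have "(\<lambda>z. rhs1 m n l (involution z)) holomorphic_on - right_slit"
    by (simp add: o_def)
  then show "(\<lambda>z. - ((1 - z) ^ l * rhs1 m n l (involution z))) holomorphic_on - right_slit"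
    by (intro holomorphic_on_minus holomorphic_on_mult) (intro holomorphic_intros)
  show "rhs1 n m l z = - ((1 - z) ^ l * rhs1 m n l (involution z))" if z: "z \<in> ball 0 (1 / 2)" for z
    using sol0_reflection [OF z, of n l m] small_ball [OF z]
    by (simp add: reflected_def sol0_eq_rhs1)
  show "ball 0 (1 / 2) \<subseteq> - right_slit"
    using ball_subset_slit_complement by (auto simp: subset_iff)
qed (use assms open_slit_complement connected_slit_complement rhs1_holomorphic in auto)

theorem theorem9p1:
  fixes n m l :: nat
  shows
    \<comment> \<open>the analytic continuations in the formulas exist, and extend the convergent series\<close>
    "continues_series
       (hyp2F1_summand (of_nat (m + l + 1)) (of_nat (m + n + l + 1)) (of_nat (m + n + 2 * l + 2)))
       {z. norm z < 1} (- right_slit)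
       (hyp2F1 (of_nat (m + l + 1)) (of_nat (m + n + l + 1)) (of_nat (m + n + 2 * l + 2)))
     \<and> continues_series (summand2 n m l) region2 (- {0})
         (continued_sum (summand2 n m l) region2 (- {0}))
     \<and> continues_series (summand3 n m l) region34 two_slit_plane
         (continued_sum (summand3 n m l) region34 two_slit_plane)
     \<and> continues_series (summand4 n m l) region34 two_slit_plane
         (continued_sum (summand4 n m l) region34 two_slit_plane)
     \<and> (\<forall>z \<in> two_slit_plane.
          U3 n m l z = rhs1 n m l z \<and>
          U3 n m l z = rhs2 n m l z \<and>
          U3 n m l z = rhs3 n m l z \<and>
          U3 n m l z = rhs4 n m l z)
     \<and> (\<forall>z \<in> - right_slit.
          U3 n m l z = interchanged U3 n m l z \<and>
          U3 n m l z = interchanged rhs1 n m l z \<and>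
          (z \<noteq> 0 \<longrightarrow> U3 n m l z = interchanged rhs2 n m l z) \<and>
          (z / (z - 1) \<in> two_slit_plane \<longrightarrow>
             U3 n m l z = interchanged rhs3 n m l z \<and>
             U3 n m l z = interchanged rhs4 n m l z))"
proof (intro conjI ballI impI)
  have slit: "z \<in> - right_slit" "z \<in> - right_slit - {0}" if "z \<in> two_slit_plane" for z
    using that two_slit_plane_subset by auto
  fix z assume z: "z \<in> two_slit_plane"
  show "U3 n m l z = rhs1 n m l z" "U3 n m l z = rhs2 n m l z" "U3 n m l z = rhs3 n m l z"
    "U3 n m l z = rhs4 n m l z"
    using hyp2F1_continuation(2) [OF slit(1) [OF z]] summand2_continuation(2) [OF slit(2) [OF z]]
      summand34_continuation(3,4) [OF z] by simp_all
next
  fix z assume z: "z \<in> - right_slit"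
  have reflect: "U3 n m l z = interchanged E n m l z" if "E m n l (z / (z - 1)) = rhs1 m n l (z / (z - 1))" for E
    using that hyp2F1_continuation(2) [OF z] rhs1_reflection [OF z]
    by (simp add: interchanged_def involution_def)
  have w: "z / (z - 1) \<in> - right_slit" using involution_slit [OF z] by (simp add: involution_def)
  show "U3 n m l z = interchanged U3 n m l z" by (rule reflect) (rule hyp2F1_continuation(2) [OF w])
  show "U3 n m l z = interchanged rhs1 n m l z" by (rule reflect) (rule refl)
  show "U3 n m l z = interchanged rhs2 n m l z" if "z \<noteq> 0"
  proof (rule reflect, rule summand2_continuation(2))
    have "z \<noteq> 1" using z by (auto simp: right_slit_iff)
    then show "z / (z - 1) \<in> - right_slit - {0}" using w that by simp
  qed
  show "U3 n m l z = interchanged rhs3 n m l z" "U3 n m l z = interchanged rhs4 n m l z"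
    if "z / (z - 1) \<in> two_slit_plane"
    by (rule reflect, rule summand34_continuation(3,4), rule that)+
qed (rule hyp2F1_continuation(1) summand2_continuation(1) summand34_continuation(1,2))+

end
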